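(* Let $M \in \mathbf{M}_n(\mathbb{C})$ have distinct eigenvalues $\lambda_1, \lambda_2, \ldots, \lambda_n$ with corresponding unit eigenvectors $\mathbf{x}_1,\mathbf{x}_2,\ldots,\mathbf{x}_n \in \mathbb{C}^n$. Then $M$ is unitarily equivalent to an analytic truncated Toeplitz operator if and only if there exist distinct points $z_1,z_2,\ldots,z_{n-1}$ in $\mathbb{D}$ such that $$\langle \mathbf{x}_n,\mathbf{x}_i\rangle\,\langle \mathbf{x}_i,\mathbf{x}_j\rangle\,\langle \mathbf{x}_j,\mathbf{x}_n\rangle = \frac{(1-|z_i|^2)(1-|z_j|^2)}{1-\overline{z_j}z_i}$$ holds for all $1 \leq i \leq j < n$.
   Context: $\mathbf{M}_n(\mathbb{C})$ is the set of $n\times n$ complex matrices, acting on $\mathbb{C}^n$ with its standard inner product $\langle\cdot,\cdot\rangle$, linear in the first variable and conjugate-linear in the second. $\mathbb{D}$ is the open unit disk, $H^2$ the Hardy space on $\mathbb{D}$ (regarded via boundary values as a closed subspace of $L^2=L^2(\partial\mathbb{D})$), and $H^\infty$ the algebra of bounded analytic functions on $\mathbb{D}$. For a nonconstant inner function $\Theta$, the model space is $\mathcal{K}_\Theta := H^2 \ominus \Theta H^2$, with the inner product inherited from $L^2$, and $P_\Theta$ is the orthogonal projection of $L^2$ onto $\mathcal{K}_\Theta$. For $\varphi\in H^\infty$, the analytic truncated Toeplitz operator $A_\varphi^\Theta:\mathcal{K}_\Theta\to\mathcal{K}_\Theta$ is defined by $A_\varphi^\Theta f := P_\Theta(\varphi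 f)$. An "analytic truncated Toeplitz operator" means an operator of the form $A_\varphi^\Theta$ for some nonconstant inner function $\Theta$ and some $\varphi\in H^\infty$. The matrix $M$ is unitarily equivalent to $A_\varphi^\Theta$ if there is a unitary operator $U:\mathbb{C}^n\to\mathcal{K}_\Theta$ with $UM = A_\varphi^\Theta U$ (in particular $\dim\mathcal{K}_\Theta=n$). *)

theory Defs
  imports "HOL-Analysis.Analysis"
begin

text \<open>Normalized arc length on the unit circle, as a Borel measure on the complex plane.\<close>

definition arc_measure :: "complex measure" where
  "arc_measure = distr (uniform_measure lborel {0..<2 * pi}) borel cis"

text \<open>Elements of \<open>L\<^sup>2\<close> of the circle are given by Borel square-integrable representatives; two of
  them stand for the same element iff they agree almost everywhere with respect to
  \<^const>\<open>arc_measure\<close>.\<close>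

definition L2_inner :: "(complex \<Rightarrow> complex) \<Rightarrow> (complex \<Rightarrow> complex) \<Rightarrow> complex" where
  "L2_inner h k = (LINT \<zeta>|arc_measure. h \<zeta> * cnj (k \<zeta>))"

text \<open>Functions in \<open>H2\<close> are extended by \<open>0\<close> outside the open disk, so that equality of
  functions of type \<^typ>\<open>complex \<Rightarrow> complex\<close> is equality on the disk and \<open>H2\<close> is closed under
  pointwise linear combinations.\<close>

definition H2 :: "(complex \<Rightarrow> complex) set" where
  "H2 = {f. f holomorphic_on ball 0 1 \<and> (\<forall>z. z \<notin> ball 0 1 \<longrightarrow> f z = 0) \<and>
            bdd_above ((\<lambda>r::real. LINT \<zeta>|arc_measure. (cmod (f (of_real r * \<zeta>)))\<^sup>2) ` {0..<1})}"

definition Hinf :: "(complex \<Rightarrow> complex) set" where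
  "Hinf = {\<phi>. \<phi> holomorphic_on ball 0 1 \<and> bounded (\<phi> ` ball 0 1)}"

text \<open>Radial boundary values. By Fatou's theorem the limit exists for almost every point of the
  circle if the function is in \<open>H2\<close> or \<open>Hinf\<close>; elsewhere the value is irrelevant.\<close>

definition boundary_fun :: "(complex \<Rightarrow> complex) \<Rightarrow> complex \<Rightarrow> complex" where
  "boundary_fun f \<zeta> = Lim (at_left (1::real)) (\<lambda>r. f (of_real r * \<zeta>))"

definition inner_function :: "(complex \<Rightarrow> complex) \<Rightarrow> bool" where
  "inner_function \<Theta> \<longleftrightarrow> \<Theta> \<in> Hinf \<and> (AE \<zeta> in arc_measure. cmod (boundary_fun \<Theta> \<zeta>) = 1)"

definition H2_inner :: "(complex \<Rightarrow> complex) \<Rightarrow> (complex \<Rightarrow> complex) \<Rightarrow> complex" where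
  "H2_inner f g = L2_inner (boundary_fun f) (boundary_fun g)"

definition model_space :: "(complex \<Rightarrow> complex) \<Rightarrow> (complex \<Rightarrow> complex) set" where
  "model_space \<Theta> = {f \<in> H2. \<forall>g\<in>H2. H2_inner f (\<lambda>z. \<Theta> z * g z) = 0}"

text \<open>The orthogonal projection of \<open>L\<^sup>2\<close> onto the model space (which is a closed subspace
  via boundary values); it is meaningful for square-integrable \<open>h\<close> only.\<close>

definition model_proj ::
    "(complex \<Rightarrow> complex) \<Rightarrow> (complex \<Rightarrow> complex) \<Rightarrow> (complex \<Rightarrow> complex)" where
  "model_proj \<Theta> h = (THE f. f \<in> model_space \<Theta> \<and>
     (\<forall>k\<in>model_space \<Theta>. L2_inner (\<lambda>\<zeta>. h \<zeta> - boundary_fun f \<zeta>) (boundary_fun k) = 0))"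

definition TTO ::
    "(complex \<Rightarrow> complex) \<Rightarrow> (complex \<Rightarrow> complex) \<Rightarrow> (complex \<Rightarrow> complex) \<Rightarrow> (complex \<Rightarrow> complex)" where
  "TTO \<Theta> \<phi> f = model_proj \<Theta> (boundary_fun (\<lambda>z. \<phi> z * f z))"

text \<open>The Hermitian inner product; the library's \<^const>\<open>inner\<close> on this type is its real part.\<close>

definition cinner :: "complex ^ 'n \<Rightarrow> complex ^ 'n \<Rightarrow> complex" where
  "cinner x y = (\<Sum>i\<in>UNIV. x $ i * cnj (y $ i))"

definition unitary_onto_model ::
    "(complex \<Rightarrow> complex) \<Rightarrow> (complex ^ 'n \<Rightarrow> (complex \<Rightarrow> complex)) \<Rightarrow> bool" where
  "unitary_onto_model \<Theta> U \<longleftrightarrow>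
     (\<forall>a b u v. U (a *s u + b *s v) = (\<lambda>z. a * U u z + b * U v z)) \<and>
     bij_betw U UNIV (model_space \<Theta>) \<and>
     (\<forall>u v. H2_inner (U u) (U v) = cinner u v)"

definition unitarily_equiv_TTO ::
    "complex ^ 'n ^ 'n \<Rightarrow> (complex \<Rightarrow> complex) \<Rightarrow> (complex \<Rightarrow> complex) \<Rightarrow> bool" where
  "unitarily_equiv_TTO M \<Theta> \<phi> \<longleftrightarrow>
     (\<exists>U. unitary_onto_model \<Theta> U \<and> (\<forall>v. U (M *v v) = TTO \<Theta> \<phi> (U v)))"

definition unitarily_equiv_analytic_TTO :: "complex ^ 'n ^ 'n \<Rightarrow> bool" where
  "unitarily_equiv_analytic_TTO M \<longleftrightarrow>
     (\<exists>\<Theta> \<phi>. inner_function \<Theta> \<and> \<not> \<Theta> constant_on ball 0 1 \<and> \<phi> \<in> Hinf \<and>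
             unitarily_equiv_TTO M \<Theta> \<phi>)"

end

theory Submission
  imports Defs "HOL-Complex_Analysis.Cauchy_Integral_Formula"
begin

text \<open>
  Let \<open>K\<close> be the model space of an inner function \<open>\<Theta>\<close>. For \<open>f \<in> K\<close> one has
  \<open>z f = A f + \<langle>z f, \<Theta>\<rangle> \<Theta>\<close> with \<open>A f \<in> K\<close>, and \<open>A\<close> commutes with every analytic truncated Toeplitz
  operator. If such an operator has simple spectrum, its unit eigenvectors \<open>y\<^sub>i\<close> are therefore
  eigenvectors of \<open>A\<close>, that is \<open>z y\<^sub>i = \<alpha>\<^sub>i y\<^sub>i + c\<^sub>i \<Theta>\<close>. Since multiplication by \<open>z\<close> is isometric, this
  gives \<open>\<langle>y\<^sub>i, y\<^sub>j\<rangle> (1 - \<alpha>\<^sub>i cnj \<alpha>\<^sub>j) = c\<^sub>i cnj c\<^sub>j\<close>, and the disk automorphism that sends \<open>\<alpha>\<^sub>n\<close> to \<open>0\<close>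
  sends the \<open>\<alpha>\<^sub>i\<close> to the points \<open>z\<^sub>i\<close>. Conversely, for given \<open>z\<^sub>1, \<dots>, z\<^sub>n\<^sub>-\<^sub>1\<close> and \<open>z\<^sub>n = 0\<close>, the
  functions \<open>\<Theta> / (z - z\<^sub>i)\<close>, where \<open>\<Theta>\<close> is the Blaschke product with zeros \<open>z\<^sub>i\<close>, form a basis of the
  model space with the required Gram matrix up to unimodular factors, and any bounded \<open>\<phi>\<close> with
  \<open>\<phi>(z\<^sub>i) = \<lambda>\<^sub>i\<close> has them as eigenvectors.

  Both directions rest on the existence of radial limits in \<open>H\<^sup>2\<close>, which follows from the \<open>L\<^sup>2\<close> bound
  for the radial maximal function. That bound is obtained by linearizing the supremum, which
  turns it into an integral operator \<open>T\<close> with a Poisson kernel, and comparing \<open>T T\<^sup>*\<close> with \<open>T + T\<^sup>*\<close>.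
\<close>

section \<open>Arc length on the circle\<close>

text \<open>The inner product is defined through pointwise radial limits, so even its definiteness
  and the isometry of multiplication by \<open>z\<close> rest on Fatou's theorem; convergence in the
  mean would not reach \<open>boundary_fun\<close>. The maximal bound serves twice: it gives the
  limits almost everywhere, and it supplies the integrable majorant under which integrals over
  smaller circles converge to those of the boundary values. From there on Taylor coefficients and
  orthogonality suffice.

  Projections onto the model space exist because it is finite-dimensional: in one direction the
  given unitary map carries over an orthonormal basis, in the other the projected function is
  exhibited.

  Triple products appear because the phases of the unit eigenvectors are arbitrary and cancel in a
  cyclic product. Fixing \<open>z_n = 0\<close> uses up the freedom of a disk automorphism. The case
  \<open>i = j\<close> reads |<x_n, x_i>|^2 = 1 - |z_i|^2. Distinctness of the points, in both
  directions, comes from the equality case of Cauchy-Schwarz, which distinct eigenvalues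
  exclude.\<close>

lemma space_arc [simp]: "space arc_measure = UNIV"
  and sets_arc [simp, measurable_cong]: "sets arc_measure = sets borel"
  by (simp_all add: arc_measure_def)

lemma borel_measurable_cis [measurable]: "cis \<in> borel_measurable borel"
  by (intro borel_measurable_continuous_onI continuous_intros)

lemma borel_measurable_cnj [measurable]: "cnj \<in> borel_measurable borel"
  by (intro borel_measurable_continuous_onI continuous_intros)

lemma emeasure_arc: "emeasure arc_measure UNIV = 1"
proof -
  have "emeasure arc_measure UNIV = emeasure (uniform_measure lborel {0..<2 * pi}) UNIV"
    unfolding arc_measure_def by (subst emeasure_distr) auto
  also have "\<dots> = emeasure lborel {0..<2 * pi} / emeasure lborel {0..<2 * pi}"
    by (subst emeasure_uniform_measure) auto
  also have "\<dots> = 1"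
    by (simp add: ennreal_divide_self)
  finally show ?thesis .
qed

lemma measure_arc [simp]: "measure arc_measure UNIV = 1"
  by (simp add: measure_def emeasure_arc)

lemma finite_measure_arc: "finite_measure arc_measure"
  by (rule finite_measureI) (simp add: emeasure_arc)

interpretation arc: finite_measure arc_measure
  by (rule finite_measure_arc)

text \<open>The half-open interval of the definition is traded for the closed one, which differs by
  a null set, so that the fundamental theorem of calculus on a closed interval applies.\<close>

lemma integral_arc:
  fixes f :: "complex \<Rightarrow> 'b::{banach, second_countable_topology}"
  assumes [measurable]: "f \<in> borel_measurable borel"
  shows "(LINT \<zeta>|arc_measure. f \<zeta>) =
    (1 / (2 * pi)) *\<^sub>R (LINT t|lborel. indicator {0..2 * pi} t *\<^sub>R f (cis t))"
proof -
  have "(LINT \<zeta>|arc_measure. f \<zeta>) = (LINT t|uniform_measure lborel {0..<2 * pi}. f (cis t))"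
    unfolding arc_measure_def by (rule integral_distr) auto
  also have "\<dots> = (LINT t|density lborel (\<lambda>t. ennreal (indicator {0..<2 * pi} t / (2 * pi))). f (cis t))"
    unfolding uniform_measure_def
    by (intro arg_cong2[where f = lebesgue_integral] arg_cong2[where f = density] ext refl)
       (auto simp: indicator_def divide_ennreal[symmetric] ennreal_mult simp del: divide_ennreal)
  also have "\<dots> = (LINT t|lborel. (indicator {0..<2 * pi} t / (2 * pi)) *\<^sub>R f (cis t))"
    by (subst integral_density) auto
  also have "\<dots> = (LINT t|lborel. (1 / (2 * pi)) *\<^sub>R (indicator {0..2 * pi} t *\<^sub>R f (cis t)))"
    by (rule integral_cong_AE)
       (use AE_lborel_singleton[of "2 * pi"] in \<open>auto simp: indicator_def\<close>)
  also have "\<dots> = (1 / (2 * pi)) *\<^sub>R (LINT t|lborel. indicator {0..2 * pi} t *\<^sub>R f (cis t))"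
    by (rule integral_scaleR_right)
  finally show ?thesis .
qed

lemma AE_arc_circle: "AE \<zeta> in arc_measure. cmod \<zeta> = 1"
  unfolding arc_measure_def by (subst AE_distr_iff) auto

lemma AE_arcI:
  assumes "\<And>\<zeta>. cmod \<zeta> = 1 \<Longrightarrow> P \<zeta>"
  shows "AE \<zeta> in arc_measure. P \<zeta>"
  using AE_arc_circle by eventually_elim (use assms in auto)

lemma integrable_arc_bounded:
  fixes f :: "complex \<Rightarrow> 'b::{banach, second_countable_topology}"
  assumes "f \<in> borel_measurable borel" "\<And>\<zeta>. cmod \<zeta> = 1 \<Longrightarrow> norm (f \<zeta>) \<le> B"
  shows "integrable arc_measure f"
  using assms by (intro arc.integrable_const_bound[where B = B] AE_arcI) auto

lemma integral_cis_zero: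
  assumes "j \<noteq> (0::int)"
  shows "(LINT t|lborel. indicator {0..2 * pi} t *\<^sub>R cis (of_int j * t)) = 0"
proof -
  let ?F = "\<lambda>t. cis (of_int j * t) / (\<i> * of_int j)"
  have "(LINT t|lborel. indicator {0..2 * pi} t *\<^sub>R cis (of_int j * t)) = ?F (2 * pi) - ?F 0"
  proof (rule integral_FTC_Icc)
    fix t :: real
    have "((\<lambda>t. exp (\<i> * complex_of_real (of_int j * t)) / (\<i> * of_int j)) has_vector_derivative
       exp (\<i> * complex_of_real (of_int j * t))) (at t within {0..2*pi})"
      using assms
      by (auto intro!: derivative_eq_intros has_vector_derivative_real_field simp: field_simps)
    then show "(?F has_vector_derivative cis (of_int j * t)) (at t within {0..2*pi})"
      by (simp add: cis_conv_exp)
  qed (auto intro!: continuous_intros)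
  also have "cis (of_int j * (2 * pi)) = 1"
    using cis_multiple_2pi[of "of_int j"] by (simp add: mult_ac)
  then have "?F (2 * pi) - ?F 0 = 0"
    by (simp add: mult_ac)
  finally show ?thesis .
qed

lemma arc_moment: "(LINT \<zeta>|arc_measure. \<zeta> ^ m * cnj (\<zeta> ^ k)) = (if m = k then 1 else 0)"
proof -
  have "cis t ^ m * cnj (cis t ^ k) = cis (of_int (int m - int k) * t)" for t
    by (simp add: cis_cnj Complex.DeMoivre cis_mult algebra_simps)
  then have "(LINT \<zeta>|arc_measure. \<zeta> ^ m * cnj (\<zeta> ^ k)) =
    (1 / (2 * pi)) *\<^sub>R (LINT t|lborel. indicator {0..2 * pi} t *\<^sub>R cis (of_int (int m - int k) * t))"
    by (subst integral_arc) (auto simp del: of_int_diff)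
  moreover have "(LINT t|lborel. indicator {0..2 * pi} t *\<^sub>R (1::complex)) = of_real (2 * pi)"
    by (subst has_bochner_integral_integral_eq[OF has_bochner_integral_indicator])
       (auto simp: scaleR_conv_of_real)
  ultimately show ?thesis
    using integral_cis_zero[of "int m - int k"]
    by (cases "m = k") (auto simp: scaleR_conv_of_real)
qed

text \<open>Absolute summability bounds all partial sums uniformly on the circle, so orthonormality
  of the monomials passes to the limit by dominated convergence. The lemma is meant for functions
  whose series converges beyond the circle, such as dilations of functions on the disk.\<close>

lemma arc_parseval:
  fixes a b :: "nat \<Rightarrow> complex"
  assumes a: "summable (\<lambda>k. cmod (a k))" and b: "summable (\<lambda>k. cmod (b k))"
  shows "(\<lambda>k. a k * cnj (b k)) sums
    (LINT \<zeta>|arc_measure. (\<Sum>k. a k * \<zeta> ^ k) * cnj (\<Sum>k. b k * \<zeta> ^ k))"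
proof -
  let ?S = "\<lambda>c n \<zeta>. \<Sum>k<n. c k * \<zeta> ^ k :: complex"
  have bound: "cmod (?S c n \<zeta>) \<le> (\<Sum>k. cmod (c k))"
    if "summable (\<lambda>k. cmod (c k))" "cmod \<zeta> = 1" for c n \<zeta>
  proof -
    have "cmod (?S c n \<zeta>) \<le> (\<Sum>k<n. cmod (c k * \<zeta> ^ k))" by (rule norm_sum)
    also have "\<dots> = (\<Sum>k<n. cmod (c k))" using that by (simp add: norm_mult norm_power)
    also have "\<dots> \<le> (\<Sum>k. cmod (c k))" by (rule sum_le_suminf) (use that in auto)
    finally show ?thesis .
  qed
  have lim: "(\<lambda>n. ?S c n \<zeta>) \<longlonglongrightarrow> (\<Sum>k. c k * \<zeta> ^ k)"
    if "summable (\<lambda>k. cmod (c k))" "cmod \<zeta> = 1" for c \<zeta>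
    by (rule summable_LIMSEQ, rule summable_norm_cancel)
      (use that in \<open>simp add: norm_mult norm_power\<close>)
  have S: "(LINT \<zeta>|arc_measure. ?S a n \<zeta> * cnj (?S b n \<zeta>)) = (\<Sum>k<n. a k * cnj (b k))" for n
  proof -
    have int: "integrable arc_measure (\<lambda>\<zeta>. \<zeta> ^ j * cnj (\<zeta> ^ k))" for j k
      by (rule integrable_arc_bounded[where B = 1]) (auto simp: norm_mult norm_power)
    have "(LINT \<zeta>|arc_measure. ?S a n \<zeta> * cnj (?S b n \<zeta>)) =
      (LINT \<zeta>|arc_measure. (\<Sum>j<n. \<Sum>k<n. (a j * cnj (b k)) * (\<zeta> ^ j * cnj (\<zeta> ^ k))))"
      by (simp add: sum_product mult_ac)
    also have "\<dots> = (\<Sum>j<n. \<Sum>k<n. (a j * cnj (b k)) * (if j = k then 1 else 0))"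
      by (simp add: Bochner_Integration.integral_sum Bochner_Integration.integrable_sum
          integrable_mult_right int arc_moment del: complex_cnj_power)
    also have "\<dots> = (\<Sum>k<n. a k * cnj (b k))"
      by (simp add: if_distrib cong: if_cong)
    finally show ?thesis .
  qed
  have "(\<lambda>n. LINT \<zeta>|arc_measure. ?S a n \<zeta> * cnj (?S b n \<zeta>)) \<longlonglongrightarrow>
    (LINT \<zeta>|arc_measure. (\<Sum>k. a k * \<zeta> ^ k) * cnj (\<Sum>k. b k * \<zeta> ^ k))"
  proof (rule integral_dominated_convergence[where w = "\<lambda>_. (\<Sum>k. cmod (a k)) * (\<Sum>k. cmod (b k))"])
    show "AE \<zeta> in arc_measure. (\<lambda>n. ?S a n \<zeta> * cnj (?S b n \<zeta>)) \<longlonglongrightarrow>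
      (\<Sum>k. a k * \<zeta> ^ k) * cnj (\<Sum>k. b k * \<zeta> ^ k)"
      by (intro AE_arcI tendsto_mult tendsto_cnj lim assms)
    show "AE \<zeta> in arc_measure. norm (?S a n \<zeta> * cnj (?S b n \<zeta>))
      \<le> (\<Sum>k. cmod (a k)) * (\<Sum>k. cmod (b k))" for n
      unfolding norm_mult complex_mod_cnj
      by (intro AE_arcI mult_mono bound assms suminf_nonneg) auto
  qed (auto intro!: borel_measurable_suminf)
  then show ?thesis unfolding S sums_def .
qed

section \<open>The maximal function\<close>

text \<open>If \<open>c\<close> bounds the norm of \<open>T\<close>, then \<open>T T\<^sup>* \<le> C (T + T\<^sup>*)\<close> shows that \<open>sqrt (2 C c)\<close> does as well, so
  the best constant is at most \<open>2 C\<close>. Boundedness of \<open>k\<close> is only needed for the best constant to be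
  finite; it does not enter the bound.\<close>

lemma TTstar_bound:
  fixes M :: "'a measure" and k :: "'a \<Rightarrow> 'a \<Rightarrow> real"
  assumes fin: "finite_measure M" and sp: "space M = UNIV" and prob: "measure M UNIV = 1"
    and k_meas: "(\<lambda>(x, y). k x y) \<in> borel_measurable (M \<Otimes>\<^sub>M M)"
    and k_nonneg: "\<And>x y. 0 \<le> k x y" and k_le: "\<And>x y. k x y \<le> K"
    and kk: "\<And>x x'. (LINT y|M. k x y * k x' y) \<le> C * (k x x' + k x' x)" and C: "C > 0"
    and F: "F \<in> borel_measurable M" "\<And>x. 0 \<le> F x" "\<And>x. F x \<le> B"
  shows "(LINT x|M. (LINT y|M. k x y * F y)\<^sup>2) \<le> 4 * C\<^sup>2 * (LINT x|M. (F x)\<^sup>2)"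
proof -
  interpret finite_measure M by (rule fin)
  interpret pair_sigma_finite M M ..
  interpret P: finite_measure "M \<Otimes>\<^sub>M M" by (intro finite_measure_pair_measure fin)
  \<comment> \<open>Nonnegative bounded functions are stable under \<open>T\<close>, its adjoint
    \<open>S\<close>, sums and products, which makes every integral below finite. Nonnegativity
    costs nothing, since the bound is applied to a modulus.\<close>
  define bd where "bd = {F :: 'a \<Rightarrow> real. F \<in> borel_measurable M \<and> (\<forall>x. 0 \<le> F x) \<and> (\<exists>B. \<forall>x. F x \<le> B)}"
  define T where "T F x = (LINT y|M. k x y * F y)" for F x
  define S where "S G y = (LINT x|M. k x y * G x)" for G y
  note [measurable] = k_meas
  have k_meas1 [measurable]: "(\<lambda>y. k x y) \<in> borel_measurable M" for x
    using measurable_compose[OF measurable_Pair1' k_meas, of x] sp by simp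
  have k_meas2 [measurable]: "(\<lambda>x. k x y) \<in> borel_measurable M" for y
    using measurable_compose[OF measurable_Pair2' k_meas, of y] sp by simp
  have K: "0 \<le> K" using k_nonneg k_le by (meson order_trans)
  have bd_meas: "F \<in> borel_measurable M" if "F \<in> bd" for F using that by (simp add: bd_def)
  have bd_int: "integrable M F" if "F \<in> bd" for F
  proof -
    from that obtain B where "\<And>x. F x \<le> B" "\<And>x. 0 \<le> F x" by (auto simp: bd_def)
    then show ?thesis using bd_meas[OF that] by (intro integrable_const_bound[where B = B]) auto
  qed
  have bd_mult: "(\<lambda>x. F x * G x) \<in> bd" if "F \<in> bd" "G \<in> bd" for F G
  proof -
    from that obtain B B' where "\<And>x. F x \<le> B" "\<And>x. 0 \<le> F x" "\<And>x. G x \<le> B'" "\<And>x. 0 \<le> G x"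
      by (auto simp: bd_def)
    then have "F x * G x \<le> B * B'" for x by (intro mult_mono) (auto intro: order_trans)
    with that show ?thesis by (auto simp: bd_def)
  qed
  have bd_add: "(\<lambda>x. F x + G x) \<in> bd" if "F \<in> bd" "G \<in> bd" for F G
    using that unfolding bd_def by (auto intro: add_mono) (meson add_mono)
  have bd_k: "(\<lambda>y. k x y) \<in> bd" "(\<lambda>y. k y x) \<in> bd" for x
    unfolding bd_def mem_Collect_eq by (intro conjI allI k_nonneg exI[of _ K] k_le; measurable)+
  have bd_integral: "(LINT y|M. F y) \<le> B'" "0 \<le> (LINT y|M. F y)" if "F \<in> bd" "\<And>y. F y \<le> B'" for F B'
  proof -
    have "(LINT y|M. F y) \<le> (LINT y|M. B')" by (rule integral_mono) (use that bd_int in auto)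
    then show "(LINT y|M. F y) \<le> B'" by (simp add: sp prob)
    show "0 \<le> (LINT y|M. F y)" using that by (intro integral_nonneg_AE) (auto simp: bd_def)
  qed
  have bd_TS: "T F \<in> bd" "S F \<in> bd" if "F \<in> bd" for F
  proof -
    note [measurable] = bd_meas[OF that]
    from that obtain B where B: "\<And>x. F x \<le> B" "\<And>x. 0 \<le> F x" by (auto simp: bd_def)
    have le: "k x y * F z \<le> K * B" for x y z
      using B k_nonneg k_le K by (intro mult_mono) auto
    show "T F \<in> bd" unfolding bd_def T_def
      using bd_integral[OF bd_mult[OF bd_k(1) that] le] by auto
    have "(\<lambda>(y, x). k x y * F x) \<in> borel_measurable (M \<Otimes>\<^sub>M M)" 
      using measurable_compose[OF measurable_pair_swap' k_meas] by (simp add: case_prod_unfold)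
    then show "S F \<in> bd" unfolding bd_def S_def
      using bd_integral[OF bd_mult[OF bd_k(2) that] le] by auto
  qed
  have adj: "(LINT x|M. T F x * G x) = (LINT y|M. F y * S G y)" if "F \<in> bd" "G \<in> bd" for F G
  proof -
    note [measurable] = bd_meas[OF that(1)] bd_meas[OF that(2)]
    from that obtain B B' where B: "\<And>x. F x \<le> B" "\<And>x. 0 \<le> F x" "\<And>x. G x \<le> B'" "\<And>x. 0 \<le> G x"
      by (auto simp: bd_def)
    have "k x y * F y * G x \<le> K * B * B'" for x y
      using B k_nonneg k_le K by (intro mult_mono mult_nonneg_nonneg) (auto intro: order_trans[OF B(2) B(1)])
    then have "integrable (M \<Otimes>\<^sub>M M) (\<lambda>(x, y). k x y * F y * G x)"
      using B k_nonneg by (intro P.integrable_const_bound[where B = "K * B * B'"]) (auto simp: abs_mult)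
    from Fubini_integral[OF this]
    have "(LINT y|M. LINT x|M. k x y * F y * G x) = (LINT x|M. LINT y|M. k x y * F y * G x)"
      by simp
    then show ?thesis unfolding T_def S_def
      by (simp add: mult_ac flip: integral_mult_right_zero integral_mult_left_zero)
  qed
  \<comment> \<open>By Fubini the kernel of \<open>T S\<close> is the integral of
    \<open>k x y * k x' y\<close> over \<open>y\<close>, so \<open>kk\<close> compares operators as
    soon as the argument is nonnegative.\<close>
  have TS: "T (S G) x \<le> C * (T G x + S G x)" if G: "G \<in> bd" for G x
  proof -
    note [measurable] = bd_meas[OF G]
    from that obtain B where B: "\<And>x. G x \<le> B" "\<And>x. 0 \<le> G x" by (auto simp: bd_def)
    have "k x y * k x' y * G x' \<le> K * K * B" for x' y
      using B k_nonneg k_le K by (intro mult_mono mult_nonneg_nonneg) auto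
    then have "integrable (M \<Otimes>\<^sub>M M) (\<lambda>(x', y). k x y * k x' y * G x')"
      using B k_nonneg by (intro P.integrable_const_bound[where B = "K * K * B"]) (auto simp: abs_mult)
    from Fubini_integral[OF this]
    have "T (S G) x = (LINT x'|M. (LINT y|M. k x y * k x' y) * G x')" unfolding T_def S_def
      by (simp add: mult_ac flip: integral_mult_right_zero integral_mult_left_zero)
    also have "\<dots> \<le> (LINT x'|M. C * (k x x' + k x' x) * G x')"
    proof (rule integral_mono)
      show "integrable M (\<lambda>x'. C * (k x x' + k x' x) * G x')"
        using bd_int[OF bd_mult[OF bd_add[OF bd_k] G]]
        by (simp add: mult.assoc)
      have "(\<lambda>x'. LINT y|M. k x y * k x' y) = T (k x)" by (auto simp: T_def mult_ac)
      then show "integrable M (\<lambda>x'. (LINT y|M. k x y * k x' y) * G x')"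
        using bd_int[OF bd_mult[OF bd_TS(1)[OF bd_k(1)] G]] by (simp add: fun_eq_iff)
    qed (use B kk in \<open>auto intro: mult_right_mono\<close>)
    also have "\<dots> = C * (T G x + S G x)"
      using bd_int[OF bd_mult[OF bd_k(1) G]] bd_int[OF bd_mult[OF bd_k(2) G]]
      unfolding T_def S_def by (simp add: algebra_simps)
    finally show ?thesis .
  qed
  have amgm: "(LINT x|M. F x * G x) \<le> (c * (LINT x|M. (F x)\<^sup>2) + (LINT x|M. (G x)\<^sup>2) / c) / 2"
    if F: "F \<in> bd" and G: "G \<in> bd" and c: "c > 0" for F G and c :: real
  proof -
    have i: "integrable M (\<lambda>x. (F x)\<^sup>2)" "integrable M (\<lambda>x. (G x)\<^sup>2)"
      using bd_int[OF bd_mult[OF F F]] bd_int[OF bd_mult[OF G G]] by (auto simp: power2_eq_square)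
    have "F x * G x \<le> (c * (F x)\<^sup>2 + (G x)\<^sup>2 / c) / 2" for x
    proof -
      have "0 \<le> (c * F x - G x)\<^sup>2 / c" using c by simp
      then show ?thesis using c by (simp add: power2_eq_square field_simps)
    qed
    then have "(LINT x|M. F x * G x) \<le> (LINT x|M. (c * (F x)\<^sup>2 + (G x)\<^sup>2 / c) / 2)"
      using i by (intro integral_mono bd_int[OF bd_mult[OF F G]]) auto
    also have "\<dots> = (c * (LINT x|M. (F x)\<^sup>2) + (LINT x|M. (G x)\<^sup>2) / c) / 2"
      using i by simp
    finally show ?thesis .
  qed
  define A where "A D \<longleftrightarrow> (\<forall>F\<in>bd. (LINT x|M. (T F x)\<^sup>2) \<le> D * (LINT x|M. (F x)\<^sup>2))" for D
  have sq_nonneg: "0 \<le> (LINT x|M. (F x)\<^sup>2)" for F :: "'a \<Rightarrow> real" by simp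
  have improve: "A (2 * C * c)" if "A (c\<^sup>2)" "c > 0" for c
    unfolding A_def
  proof
    fix F assume F: "F \<in> bd"
    define G where "G = T F"
    have G: "G \<in> bd" using bd_TS F by (simp add: G_def)
    have GTG: "(LINT x|M. G x * T G x) \<le> c * (LINT x|M. (G x)\<^sup>2)"
    proof -
      have "(LINT x|M. G x * T G x) \<le> (c * (LINT x|M. (G x)\<^sup>2) + (LINT x|M. (T G x)\<^sup>2) / c) / 2"
        by (rule amgm) (use G bd_TS that in auto)
      also have "\<dots> \<le> (c * (LINT x|M. (G x)\<^sup>2) + (c\<^sup>2 * (LINT x|M. (G x)\<^sup>2)) / c) / 2"
        using that G unfolding A_def by (intro divide_right_mono add_left_mono) auto
      finally show ?thesis using that by (simp add: power2_eq_square)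
    qed
    have "(LINT x|M. (S G x)\<^sup>2) = (LINT x|M. G x * T (S G) x)"
      using adj[of "S G" G] G bd_TS by (simp add: power2_eq_square mult_ac)
    also have "\<dots> \<le> (LINT x|M. G x * (C * (T G x + S G x)))"
      using G C bd_TS bd_int[OF bd_mult[OF G bd_TS(1)[OF bd_TS(2)[OF G]]]]
        bd_int[OF bd_mult[OF G bd_add[OF bd_TS(1)[OF G] bd_TS(2)[OF G]]]]
      by (intro integral_mono mult_left_mono TS) (auto simp: bd_def mult.left_commute)
    also have "\<dots> = C * ((LINT x|M. G x * T G x) + (LINT x|M. G x * S G x))"
      using bd_int[OF bd_mult[OF G bd_TS(1)[OF G]]] bd_int[OF bd_mult[OF G bd_TS(2)[OF G]]]
      by (simp add: algebra_simps)
    also have "(LINT x|M. G x * S G x) = (LINT x|M. G x * T G x)"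
      using adj[OF G G] by (simp add: mult_ac)
    finally have "(LINT x|M. (S G x)\<^sup>2) \<le> 2 * C * (LINT x|M. G x * T G x)"
      by simp
    also have "\<dots> \<le> 2 * C * (c * (LINT x|M. (G x)\<^sup>2))"
      using GTG C by (intro mult_left_mono) auto
    finally have SG: "(LINT x|M. (S G x)\<^sup>2) \<le> 2 * C * c * (LINT x|M. (G x)\<^sup>2)"
      by (simp add: mult.assoc)
    \<comment> \<open>The weight \<open>2 * C * c\<close> in the inequality between the means is the
      one for which the second term becomes half of the left-hand side and can be absorbed.\<close>
    have "(LINT x|M. (G x)\<^sup>2) = (LINT x|M. F x * S G x)"
      using adj[OF F G] by (simp add: G_def power2_eq_square)
    also have "\<dots> \<le> ((2 * C * c) * (LINT x|M. (F x)\<^sup>2) + (LINT x|M. (S G x)\<^sup>2) / (2 * C * c)) / 2"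
      by (rule amgm) (use F G C bd_TS that in auto)
    also have "\<dots> \<le> ((2 * C * c) * (LINT x|M. (F x)\<^sup>2) + (2 * C * c * (LINT x|M. (G x)\<^sup>2)) / (2 * C * c)) / 2"
      using C that SG by (intro divide_right_mono add_left_mono) auto
    also have "\<dots> = ((2 * C * c) * (LINT x|M. (F x)\<^sup>2) + (LINT x|M. (G x)\<^sup>2)) / 2"
      using C that by simp
    finally show "(LINT x|M. (T F x)\<^sup>2) \<le> 2 * C * c * (LINT x|M. (F x)\<^sup>2)"
      unfolding G_def by simp
  qed
  have start: "A (K\<^sup>2)" unfolding A_def
  proof
    fix F assume F: "F \<in> bd"
    define m where "m = (LINT y|M. F y)"
    have i: "integrable M F" "integrable M (\<lambda>x. (F x)\<^sup>2)"
      using bd_int[OF F] bd_int[OF bd_mult[OF F F]] by (auto simp: power2_eq_square)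
    \<comment> \<open>Cauchy-Schwarz against the constant 1 on a probability space, in the form that
      a variance is nonnegative.\<close>
    have "0 \<le> (LINT x|M. (F x - m)\<^sup>2)" by simp
    also have "\<dots> = (LINT x|M. (F x)\<^sup>2 - 2 * m * F x + m\<^sup>2)"
      by (simp add: power2_diff algebra_simps)
    also have "\<dots> = (LINT x|M. (F x)\<^sup>2) - m\<^sup>2"
      using i by (simp add: m_def[symmetric] sp prob power2_eq_square)
    finally have m: "m\<^sup>2 \<le> (LINT x|M. (F x)\<^sup>2)" by simp
    have TF: "(T F x)\<^sup>2 \<le> K\<^sup>2 * (LINT x|M. (F x)\<^sup>2)" for x
    proof -
      have "T F x \<le> (LINT y|M. K * F y)" unfolding T_def
        using F k_le i by (intro integral_mono bd_int[OF bd_mult[OF bd_k(1) F]] mult_right_mono) (auto simp: bd_def)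
      then have "T F x \<le> K * m" by (simp add: m_def)
      then have "(T F x)\<^sup>2 \<le> (K * m)\<^sup>2"
        using bd_TS[OF F] by (intro power_mono) (auto simp: bd_def)
      also have "\<dots> \<le> K\<^sup>2 * (LINT x|M. (F x)\<^sup>2)"
        using m by (simp add: power_mult_distrib mult_left_mono)
      finally show ?thesis .
    qed
    have "(LINT x|M. (T F x)\<^sup>2) \<le> (LINT x|M. K\<^sup>2 * (LINT x|M. (F x)\<^sup>2))"
      using bd_int[OF bd_mult[OF bd_TS(1)[OF F] bd_TS(1)[OF F]]]
      by (intro integral_mono TF) (auto simp: power2_eq_square)
    then show "(LINT x|M. (T F x)\<^sup>2) \<le> K\<^sup>2 * (LINT x|M. (F x)\<^sup>2)"
      by (simp add: sp prob)
  qed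
  have A_mono: "A D'" if "A D" "D \<le> D'" for D D'
    using that sq_nonneg unfolding A_def by (meson mult_right_mono order_trans)
  \<comment> \<open>The condition \<open>2 * C \<le> c\<close> keeps the constants positive and
    survives the passage from \<open>c\<close> to \<open>sqrt (2 * C * c)\<close>. Hence the infimum
    \<open>c0\<close>, which is itself admissible, satisfies
    \<open>c0 \<le> sqrt (2 * C * c0)\<close> and is exactly \<open>2 * C\<close>.\<close>
  define X where "X = {c. 2 * C \<le> c \<and> A (c\<^sup>2)}"
  define c0 where "c0 = Inf X"
  have X_ne: "X \<noteq> {}"
  proof -
    have "2 * C + K \<in> X"
      using A_mono[OF start, of "(2 * C + K)\<^sup>2"] C K by (auto simp: X_def intro: power_mono)
    then show ?thesis by blast
  qed
  have bddX: "bdd_below X" by (rule bdd_belowI[of _ "2 * C"]) (auto simp: X_def)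
  have c0: "2 * C \<le> c0" unfolding c0_def by (rule cInf_greatest[OF X_ne]) (auto simp: X_def)
  have Ac0: "A (c0\<^sup>2)" unfolding A_def
  proof
    fix F assume F: "F \<in> bd"
    have "(LINT x|M. (T F x)\<^sup>2) \<le> (c0 + e)\<^sup>2 * (LINT x|M. (F x)\<^sup>2)" if "e > 0" for e
    proof -
      obtain c where "c \<in> X" "c < c0 + e"
        using cInf_lessD[OF X_ne, of "c0 + e"] \<open>e > 0\<close> by (auto simp: c0_def)
      then have "A ((c0 + e)\<^sup>2)"
        using A_mono[of "c\<^sup>2" "(c0 + e)\<^sup>2"] C by (auto simp: X_def intro: power_mono)
      then show ?thesis using F by (simp add: A_def)
    qed
    moreover have "((\<lambda>e. (c0 + e)\<^sup>2 * (LINT x|M. (F x)\<^sup>2)) \<longlongrightarrow> (c0 + 0)\<^sup>2 * (LINT x|M. (F x)\<^sup>2)) (at_right 0)"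
      by (intro tendsto_intros)
    ultimately show "(LINT x|M. (T F x)\<^sup>2) \<le> c0\<^sup>2 * (LINT x|M. (F x)\<^sup>2)"
      by (intro tendsto_lowerbound[where F = "at_right (0::real)" and f = "\<lambda>e. (c0 + e)\<^sup>2 * (LINT x|M. (F x)\<^sup>2)"])
         (auto simp: eventually_at_right_less intro: eventually_mono[OF eventually_at_right_less])
  qed
  have "sqrt (2 * C * c0) \<in> X"
  proof -
    have "(2 * C)\<^sup>2 \<le> 2 * C * c0" using c0 C by (simp add: power2_eq_square)
    then have "2 * C \<le> sqrt (2 * C * c0)" by (rule real_le_rsqrt)
    moreover have "A ((sqrt (2 * C * c0))\<^sup>2)" using improve[OF Ac0] c0 C by simp
    ultimately show ?thesis by (simp add: X_def)
  qed
  then have "c0 \<le> sqrt (2 * C * c0)" unfolding c0_def by (intro cInf_lower bddX)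
  then have "c0\<^sup>2 \<le> 2 * C * c0" using c0 C by (intro sqrt_ge_absD) auto
  then have "c0 \<le> 2 * C" using c0 C by (simp add: power2_eq_square)
  with c0 have "c0 = 2 * C" by simp
  then have "c0\<^sup>2 = 4 * C\<^sup>2" by (simp add: power_mult_distrib)
  with Ac0 have "A (4 * C\<^sup>2)" by simp
  moreover have "F \<in> bd" using F by (auto simp: bd_def)
  ultimately show ?thesis by (auto simp: A_def T_def)
qed

section \<open>The Poisson kernel, as a function of the radius and of the quotient of two points on
  the circle\<close>

definition poisson :: "real \<Rightarrow> complex \<Rightarrow> real" where
  "poisson r w = (1 - r\<^sup>2) / (cmod (1 - of_real r * w))\<^sup>2"

lemma poisson_cnj: "poisson r (cnj w) = poisson r w"
proof -
  have "cnj (1 - of_real r * w) = 1 - of_real r * cnj w" by simp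
  then have "cmod (1 - of_real r * cnj w) = cmod (1 - of_real r * w)"
    by (metis complex_mod_cnj)
  then show ?thesis by (simp add: poisson_def)
qed

lemma poisson_swap: "poisson r (w * cnj z) = poisson r (z * cnj w)"
  using poisson_cnj[of r "z * cnj w"] by (simp add: mult.commute)

lemma poisson_nonneg: "0 \<le> r \<Longrightarrow> r < 1 \<Longrightarrow> 0 \<le> poisson r w"
  unfolding poisson_def by (intro divide_nonneg_nonneg) (auto simp: power_le_one)

lemma poisson_denom_ge:
  assumes "0 \<le> r" "cmod w \<le> 1"
  shows "1 - r \<le> cmod (1 - of_real r * w)"
proof -
  have "cmod (of_real r * w) \<le> r" using assms by (simp add: norm_mult mult_left_le)
  then show ?thesis using norm_triangle_ineq2[of 1 "of_real r * w"] by simp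
qed

lemma poisson_le:
  assumes "0 \<le> r" "r \<le> r0" "r0 < 1" "cmod w \<le> 1"
  shows "poisson r w \<le> 2 / (1 - r0)\<^sup>2"
  unfolding poisson_def
proof (rule frac_le)
  show "(1 - r0)\<^sup>2 \<le> (cmod (1 - of_real r * w))\<^sup>2"
    using poisson_denom_ge[of r w] assms by (intro power_mono) auto
  have "0 \<le> r\<^sup>2" by simp
  then show "1 - r\<^sup>2 \<le> 2" by linarith
qed (use assms in auto)

text \<open>Replacing \<open>r\<close> by \<open>r * s\<close> with \<open>s\<close> at least
  \<open>r\<close> moves the point by no more than its distance to the circle. This costs a factor 2
  in the numerator and a factor 2 in the modulus below, which is squared: 8 = 2 * 4.\<close>

lemma poisson_mult_le:
  assumes "0 \<le> r" "r \<le> s" "s < 1" "cmod w \<le> 1"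
  shows "poisson (r * s) w \<le> 8 * poisson r w"
proof -
  have rs: "0 \<le> r * s" "r * s < 1" "r < 1" using assms mult_strict_mono[of r 1 s 1] by auto
  have r1: "cmod (1 - of_real r * w) > 0" using poisson_denom_ge[of r w] assms rs by auto
  have "cmod (1 - of_real r * w) \<le> cmod (1 - of_real (r * s) * w) + cmod (of_real (r * (1 - s)) * w)"
    using norm_triangle_ineq4[of "1 - of_real (r * s) * w" "of_real (r * (1 - s)) * w"]
    by (simp add: algebra_simps)
  also have "cmod (of_real (r * (1 - s)) * w) \<le> r * (1 - s)"
    unfolding norm_mult norm_of_real using assms by (simp add: mult_left_le)
  also have "\<dots> \<le> 1 - r * s" using assms rs by (simp add: algebra_simps)
  also have "\<dots> \<le> cmod (1 - of_real (r * s) * w)"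
    using poisson_denom_ge[of "r * s" w] assms rs by auto
  finally have le: "cmod (1 - of_real r * w) / 2 \<le> cmod (1 - of_real (r * s) * w)" by simp
  have "s\<^sup>2 \<le> 1" using assms by (simp add: power_le_one)
  have "r\<^sup>2 \<le> s\<^sup>2" using assms by (simp add: power_mono)
  have "r\<^sup>2 * (1 - s\<^sup>2) \<le> 1 * (1 - r\<^sup>2)"
    using \<open>s\<^sup>2 \<le> 1\<close> \<open>r\<^sup>2 \<le> s\<^sup>2\<close> by (intro mult_mono) auto
  then have num: "1 - (r * s)\<^sup>2 \<le> 2 * (1 - r\<^sup>2)"
    by (simp add: power_mult_distrib algebra_simps)
  have "poisson (r * s) w \<le> (2 * (1 - r\<^sup>2)) / (cmod (1 - of_real r * w) / 2)\<^sup>2"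
    unfolding poisson_def
    by (rule frac_le[OF _ num])
       (use r1 le rs assms in \<open>auto intro!: power_mono power_le_one\<close>)
  also have "\<dots> = 8 * poisson r w" by (simp add: poisson_def power_divide)
  finally show ?thesis .
qed

text \<open>The smaller of the two radii dominates. Taking the sum avoids knowing which one it is
  and matches the symmetric right-hand side \<open>T + T*\<close> of the operator
  comparison.\<close>

lemma poisson_mult_le_add:
  assumes "0 \<le> r" "r < 1" "0 \<le> s" "s < 1" "cmod w \<le> 1"
  shows "poisson (r * s) w \<le> 8 * (poisson r w + poisson s w)"
proof (cases "r \<le> s")
  case True
  then show ?thesis using poisson_mult_le[of r s w] poisson_nonneg[of s w] assms by simp
next
  case False
  then show ?thesis using poisson_mult_le[of s r w] poisson_nonneg[of r w] assms
    by (simp add: mult.commute)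
qed

section \<open>Cauchy's and Poisson's formulas from power series\<close>

lemma holomorphic_ball_series:
  fixes h :: "complex \<Rightarrow> complex"
  assumes "h holomorphic_on ball 0 R"
  obtains a where "\<And>z. cmod z < R \<Longrightarrow> (\<lambda>k. a k * z ^ k) sums h z"
    and "\<And>s. 0 \<le> s \<Longrightarrow> s < R \<Longrightarrow> summable (\<lambda>k. cmod (a k) * s ^ k)"
proof -
  define a where "a k = (deriv ^^ k) h 0 / fact k" for k
  have s: "(\<lambda>k. a k * z ^ k) sums h z" if "cmod z < R" for z
    using holomorphic_power_series[OF assms, of z] that by (simp add: a_def)
  have "summable (\<lambda>k. cmod (a k) * s ^ k)" if "0 \<le> s" "s < R" for s
  proof -
    have "summable (\<lambda>k. a k * of_real ((s + R) / 2) ^ k)"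
      using s[of "of_real ((s + R) / 2)"] that by (auto simp: sums_iff simp del: of_real_divide of_real_add)
    from powser_insidea[OF this, of "of_real s"] that show ?thesis
      by (auto simp: norm_mult norm_power simp del: of_real_divide of_real_add)
  qed
  with s show ?thesis by (rule that)
qed

text \<open>Cauchy's formula as an instance of Parseval: the coefficients of the kernel are
  \<open>cnj \<alpha> ^ k\<close>, so the pairing with the series of \<open>h\<close> sums to
  \<open>h \<alpha>\<close>.\<close>

lemma arc_reproducing:
  assumes h: "h holomorphic_on ball 0 R" "R > 1" and \<alpha>: "cmod \<alpha> < 1"
    and [measurable]: "h \<in> borel_measurable borel"
  shows "(LINT \<zeta>|arc_measure. h \<zeta> * cnj (1 / (1 - cnj \<alpha> * \<zeta>))) = h \<alpha>"
proof -
  from h(1) obtain a where a: "\<And>z. cmod z < R \<Longrightarrow> (\<lambda>k. a k * z ^ k) sums h z"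
    and s: "\<And>s. 0 \<le> s \<Longrightarrow> s < R \<Longrightarrow> summable (\<lambda>k. cmod (a k) * s ^ k)"
    by (rule holomorphic_ball_series) blast
  have b: "summable (\<lambda>k. cmod (cnj \<alpha> ^ k))" using \<alpha> by (simp add: norm_power)
  have "summable (\<lambda>k. cmod (a k))" using s[of 1] h by simp
  from arc_parseval[OF this b]
  have "(LINT \<zeta>|arc_measure. (\<Sum>k. a k * \<zeta> ^ k) * cnj (\<Sum>k. cnj \<alpha> ^ k * \<zeta> ^ k)) = h \<alpha>"
    using a[of \<alpha>] \<alpha> h by (auto simp: sums_iff)
  moreover have "(LINT \<zeta>|arc_measure. (\<Sum>k. a k * \<zeta> ^ k) * cnj (\<Sum>k. cnj \<alpha> ^ k * \<zeta> ^ k)) =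
     (LINT \<zeta>|arc_measure. h \<zeta> * cnj (1 / (1 - cnj \<alpha> * \<zeta>)))"
  proof (rule integral_cong_AE)
    show "AE \<zeta> in arc_measure. (\<Sum>k. a k * \<zeta> ^ k) * cnj (\<Sum>k. cnj \<alpha> ^ k * \<zeta> ^ k) =
      h \<zeta> * cnj (1 / (1 - cnj \<alpha> * \<zeta>))"
    proof (rule AE_arcI)
      fix \<zeta> :: complex assume \<zeta>: "cmod \<zeta> = 1"
      have "(\<Sum>k. cnj \<alpha> ^ k * \<zeta> ^ k) = 1 / (1 - cnj \<alpha> * \<zeta>)"
        using suminf_geometric[of "cnj \<alpha> * \<zeta>"] \<alpha> \<zeta> by (simp add: norm_mult power_mult_distrib)
      then show "(\<Sum>k. a k * \<zeta> ^ k) * cnj (\<Sum>k. cnj \<alpha> ^ k * \<zeta> ^ k) =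
          h \<zeta> * cnj (1 / (1 - cnj \<alpha> * \<zeta>))"
        using a[of \<zeta>] \<zeta> h by (simp add: sums_iff)
    qed
  qed (auto intro!: borel_measurable_suminf)
  ultimately show ?thesis by simp
qed

text \<open>The Poisson kernel is the squared modulus of the Cauchy kernel times
  \<open>1 - r\<^sup>2\<close>. Attaching one holomorphic Cauchy factor to \<open>h\<close> leaves
  its conjugate as the reproducing kernel, and the attached factor has the value 1 at
  \<open>\<alpha>\<close>.\<close>

lemma arc_poisson:
  assumes h: "h holomorphic_on ball 0 R" "R > 1" and r: "0 \<le> r" "r < 1" and \<zeta>: "cmod \<zeta> = 1"
    and [measurable]: "h \<in> borel_measurable borel"
  shows "(LINT \<eta>|arc_measure. of_real (poisson r (\<zeta> * cnj \<eta>)) * h \<eta>) = h (of_real r * \<zeta>)"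
proof -
  define \<alpha> where "\<alpha> = of_real r * \<zeta>"
  have \<alpha>: "cmod \<alpha> = r" using r \<zeta> by (simp add: \<alpha>_def norm_mult)
  let ?h = "\<lambda>\<eta>. (1 - (of_real r)\<^sup>2) * (h \<eta> / (1 - cnj \<alpha> * \<eta>))"
  \<comment> \<open>The attached factor has its pole at modulus \<open>1 / r\<close>;
    \<open>2 / (1 + r)\<close> lies strictly between 1 and that and stays meaningful for
    \<open>r = 0\<close>.\<close>
  define R' where "R' = min R (2 / (1 + r))"
  have R': "R' > 1" using h r by (simp add: R'_def)
  have "?h holomorphic_on ball 0 R'"
  proof (intro holomorphic_intros holomorphic_on_subset[OF h(1)])
    show "ball 0 R' \<subseteq> ball 0 R" by (auto simp: R'_def)
    fix z :: complex assume "z \<in> ball 0 R'"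
    then have "cmod z < 2 / (1 + r)" by (auto simp: R'_def)
    then have "r * cmod z \<le> r * (2 / (1 + r))" using r by (intro mult_left_mono) auto
    also have "\<dots> < 1" using r by (simp add: field_simps)
    finally have "cmod (cnj \<alpha> * z) < 1" by (simp add: norm_mult \<alpha>)
    then show "1 - cnj \<alpha> * z \<noteq> 0" by auto
  qed
  from arc_reproducing[OF this R', of \<alpha>]
  have "(LINT \<eta>|arc_measure. ?h \<eta> * cnj (1 / (1 - cnj \<alpha> * \<eta>))) = ?h \<alpha>"
    using r \<alpha> by simp
  also have "cnj \<alpha> * \<alpha> = (of_real r)\<^sup>2" using \<alpha> complex_norm_square[of \<alpha>] by (simp add: mult.commute)
  then have "?h \<alpha> = h \<alpha>" using r abs_square_less_1[of r]
    by (simp flip: of_real_power of_real_diff)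
  finally have eq: "(LINT \<eta>|arc_measure. ?h \<eta> * cnj (1 / (1 - cnj \<alpha> * \<eta>))) = h \<alpha>" .
  have "?h \<eta> * cnj (1 / (1 - cnj \<alpha> * \<eta>)) = of_real (poisson r (\<zeta> * cnj \<eta>)) * h \<eta>" for \<eta>
  proof -
    have eq: "poisson r (\<zeta> * cnj \<eta>) = (1 - r\<^sup>2) / (cmod (1 - cnj \<alpha> * \<eta>))\<^sup>2"
      by (subst poisson_swap) (simp add: poisson_def \<alpha>_def mult_ac)
    have "complex_of_real ((cmod (1 - cnj \<alpha> * \<eta>))\<^sup>2) = (1 - cnj \<alpha> * \<eta>) * cnj (1 - cnj \<alpha> * \<eta>)"
      by (rule complex_norm_square)
    then show ?thesis unfolding eq of_real_divide by simp
  qed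
  then have "(LINT \<eta>|arc_measure. of_real (poisson r (\<zeta> * cnj \<eta>)) * h \<eta>) = h \<alpha>"
    using eq by (simp only:)
  then show ?thesis by (simp only: \<alpha>_def)
qed

lemma Re_cayley: "Re ((1 + u) / (1 - u)) = (1 - (cmod u)\<^sup>2) / (cmod (1 - u))\<^sup>2"
proof -
  have "Re ((1 + u) / (1 - u)) = Re ((1 + u) * cnj (1 - u)) / (cmod (1 - u))\<^sup>2"
    by (subst complex_div_cnj) (simp flip: of_real_power)
  also have "Re ((1 + u) * cnj (1 - u)) = 1 - (cmod u)\<^sup>2"
    unfolding cmod_power2 by (simp add: power2_eq_square algebra_simps)
  finally show ?thesis .
qed

text \<open>As a function of \<open>\<eta>\<close> on the circle, the second kernel is the real part
  of the function \<open>H\<close>, holomorphic beyond the closed disk. Poisson's formula therefore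
  evaluates the integral as the real part of \<open>H\<close> at the inner point
  \<open>r * \<zeta>\<close>, where it is a Poisson kernel of radius \<open>r * s\<close>.\<close>

lemma poisson_semigroup:
  assumes r: "0 \<le> r" "r < 1" and s: "0 \<le> s" "s < 1" and \<zeta>: "cmod \<zeta> = 1" "cmod \<zeta>' = 1"
  shows "(LINT \<eta>|arc_measure. poisson r (\<zeta> * cnj \<eta>) * poisson s (\<zeta>' * cnj \<eta>)) =
    poisson (r * s) (\<zeta> * cnj \<zeta>')"
proof -
  define H where "H \<eta> = (1 + of_real s * cnj \<zeta>' * \<eta>) / (1 - of_real s * cnj \<zeta>' * \<eta>)" for \<eta>
  have Re_H: "Re (H \<eta>) = poisson s' (\<zeta>' * cnj \<eta>')"
    if "of_real s * \<eta> = of_real s' * \<eta>'" "cmod \<eta>' = 1" for \<eta> \<eta>' s'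
  proof -
    have *: "of_real s * cnj \<zeta>' * \<eta> = of_real s' * cnj \<zeta>' * \<eta>'"
      using that(1) by (metis mult.assoc mult.left_commute)
    have "poisson s' (\<zeta>' * cnj \<eta>') = Re ((1 + of_real s' * cnj \<zeta>' * \<eta>') / (1 - of_real s' * cnj \<zeta>' * \<eta>'))"
      unfolding Re_cayley
      by (subst poisson_swap) (use \<zeta> that(2) in \<open>simp add: poisson_def norm_mult mult_ac\<close>)
    then show ?thesis unfolding H_def * ..
  qed
  have [measurable]: "H \<in> borel_measurable borel" unfolding H_def by measurable
  have "H holomorphic_on ball 0 (2 / (1 + s))" unfolding H_def
  proof (intro holomorphic_intros)
    fix z :: complex assume "z \<in> ball 0 (2 / (1 + s))"
    then have "cmod z < 2 / (1 + s)" by auto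
    then have "s * cmod z \<le> s * (2 / (1 + s))" using s by (intro mult_left_mono) auto
    also have "\<dots> < 1" using s by (simp add: field_simps)
    finally have "cmod (of_real s * cnj \<zeta>' * z) < 1" using s \<zeta> by (simp add: norm_mult)
    then show "1 - of_real s * cnj \<zeta>' * z \<noteq> 0" by auto
  qed
  from arc_poisson[OF this _ r \<zeta>(1)]
  have P: "(LINT \<eta>|arc_measure. of_real (poisson r (\<zeta> * cnj \<eta>)) * H \<eta>) = H (of_real r * \<zeta>)"
    using s by simp
  have meas: "(\<lambda>\<eta>. poisson r (\<zeta> * cnj \<eta>)) \<in> borel_measurable borel" for r \<zeta>
    unfolding poisson_def by measurable
  note [measurable] = meas
  have "integrable arc_measure (\<lambda>\<eta>. of_real (poisson r (\<zeta> * cnj \<eta>)) * H \<eta>)"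
  proof (rule integrable_arc_bounded[where B = "2 / (1 - r)\<^sup>2 * (2 / (1 - s))"])
    fix \<eta> :: complex assume \<eta>: "cmod \<eta> = 1"
    have u: "cmod (of_real s * cnj \<zeta>' * \<eta>) = s" using s \<zeta> \<eta> by (simp add: norm_mult)
    have "cmod (1 + of_real s * cnj \<zeta>' * \<eta>) \<le> 2"
      using norm_triangle_ineq[of 1 "of_real s * cnj \<zeta>' * \<eta>"] u s by simp
    moreover have "1 - s \<le> cmod (1 - of_real s * cnj \<zeta>' * \<eta>)"
      using norm_triangle_ineq2[of 1 "of_real s * cnj \<zeta>' * \<eta>"] u s by simp
    ultimately have "cmod (H \<eta>) \<le> 2 / (1 - s)"
      unfolding H_def norm_divide using s by (intro frac_le) auto
    moreover have "norm (of_real (poisson r (\<zeta> * cnj \<eta>)) :: complex) \<le> 2 / (1 - r)\<^sup>2"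
      using poisson_le[of r r "\<zeta> * cnj \<eta>"] poisson_nonneg[of r "\<zeta> * cnj \<eta>"] r \<zeta> \<eta> by (simp add: norm_mult)
    ultimately show "norm (of_real (poisson r (\<zeta> * cnj \<eta>)) * H \<eta>) \<le> 2 / (1 - r)\<^sup>2 * (2 / (1 - s))"
      unfolding norm_mult by (intro mult_mono) auto
  qed measurable
  from integral_Re[OF this] P
  have "(LINT \<eta>|arc_measure. poisson r (\<zeta> * cnj \<eta>) * Re (H \<eta>)) = Re (H (of_real r * \<zeta>))"
    by simp
  also have "Re (H (of_real r * \<zeta>)) = poisson (r * s) (\<zeta> * cnj \<zeta>')"
    unfolding poisson_swap[of _ \<zeta>] using \<zeta> by (intro Re_H) (simp_all add: mult_ac)
  also have "(LINT \<eta>|arc_measure. poisson r (\<zeta> * cnj \<eta>) * Re (H \<eta>)) =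
    (LINT \<eta>|arc_measure. poisson r (\<zeta> * cnj \<eta>) * poisson s (\<zeta>' * cnj \<eta>))"
  proof (rule integral_cong_AE)
    show "AE \<eta> in arc_measure. poisson r (\<zeta> * cnj \<eta>) * Re (H \<eta>) = poisson r (\<zeta> * cnj \<eta>) * poisson s (\<zeta>' * cnj \<eta>)"
      by (rule AE_arcI) (simp only: Re_H[OF refl])
  qed measurable
  finally show ?thesis .
qed

text \<open>Parametrizing by the angle makes the bounds on the Poisson kernel hold at all points and not
  only almost everywhere, as \<open>TTstar_bound\<close> requires.\<close>

definition angle_measure :: "real measure" where
  "angle_measure = uniform_measure lborel {0..<2 * pi}"

lemma arc_measure_eq: "arc_measure = distr angle_measure borel cis"
  by (simp add: arc_measure_def angle_measure_def)

lemma sets_angle [simp, measurable_cong]: "sets angle_measure = sets borel"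
  and space_angle [simp]: "space angle_measure = UNIV"
  by (simp_all add: angle_measure_def)

lemma integral_angle:
  fixes f :: "complex \<Rightarrow> 'b::{banach, second_countable_topology}"
  assumes [measurable]: "f \<in> borel_measurable borel"
  shows "(LINT t|angle_measure. f (cis t)) = (LINT \<zeta>|arc_measure. f \<zeta>)"
  unfolding arc_measure_eq by (rule integral_distr[symmetric]) measurable

lemma emeasure_angle: "emeasure angle_measure UNIV = 1"
proof -
  have "emeasure arc_measure UNIV = emeasure angle_measure UNIV"
    unfolding arc_measure_eq by (subst emeasure_distr) auto
  then show ?thesis by (simp add: emeasure_arc)
qed

text \<open>This is the linearized maximal inequality: \<open>r\<close> selects a radius at each
  point, and Poisson's formula bounds the left-hand modulus by \<open>T\<close> applied to the
  modulus of \<open>f\<close>. The semigroup law together with \<open>poisson_mult_le_add\<close>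
  gives the comparison with \<open>C = 8\<close>, whence 256 = 4 * 8^2. The bound \<open>r0\<close>
  enters only the qualitative boundedness of the kernel, not the constant.\<close>

lemma radial_max_bound_closed:
  assumes f: "f holomorphic_on ball 0 R" "R > 1" and [measurable]: "f \<in> borel_measurable borel"
    and [measurable]: "r \<in> borel_measurable borel"
    and r: "\<And>\<zeta>. 0 \<le> r \<zeta>" "\<And>\<zeta>. r \<zeta> \<le> r0" "r0 < (1::real)"
  shows "(LINT \<zeta>|arc_measure. (cmod (f (of_real (r \<zeta>) * \<zeta>)))\<^sup>2) \<le>
    256 * (LINT \<zeta>|arc_measure. (cmod (f \<zeta>))\<^sup>2)"
proof -
  define k where "k s t = poisson (r (cis s)) (cis s * cnj (cis t))" for s t
  define F where "F t = cmod (f (cis t))" for t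
  have meas_p: "(\<lambda>\<eta>. poisson r (\<zeta> * cnj \<eta>)) \<in> borel_measurable borel" for r \<zeta>
    unfolding poisson_def by measurable
  note [measurable] = meas_p
  have "continuous_on (sphere 0 1) f"
    by (rule holomorphic_on_imp_continuous_on, rule holomorphic_on_subset[OF f(1)]) (use f(2) in auto)
  then have "compact (f ` sphere 0 1)" by (rule compact_continuous_image) auto
  then obtain B where "\<forall>y\<in>f ` sphere 0 1. cmod y \<le> B"
    using compact_imp_bounded bounded_iff by blast
  then have B: "cmod (f \<zeta>) \<le> B" if "cmod \<zeta> = 1" for \<zeta> using that by simp
  have r1: "r \<zeta> < 1" for \<zeta> using r(2)[of \<zeta>] r(3) by linarith
  have fin: "finite_measure angle_measure" by (rule finite_measureI) (simp add: emeasure_angle)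
  have k_le: "k x y \<le> 2 / (1 - r0)\<^sup>2" for x y
    unfolding k_def using r by (intro poisson_le) (auto simp: norm_mult)
  have "(LINT x|angle_measure. (LINT y|angle_measure. k x y * F y)\<^sup>2) \<le>
    4 * 8\<^sup>2 * (LINT x|angle_measure. (F x)\<^sup>2)"
  proof (rule TTstar_bound)
    show "(\<lambda>(x, y). k x y) \<in> borel_measurable (angle_measure \<Otimes>\<^sub>M angle_measure)"
      unfolding k_def poisson_def by measurable
    show "measure angle_measure UNIV = 1" by (simp add: measure_def emeasure_angle)
    show "0 \<le> k x y" for x y unfolding k_def using r r1 by (intro poisson_nonneg) auto
    show "(LINT y|angle_measure. k x y * k x' y) \<le> 8 * (k x x' + k x' x)" for x x'
    proof -
      have "(LINT y|angle_measure. k x y * k x' y) =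
        (LINT \<eta>|arc_measure. poisson (r (cis x)) (cis x * cnj \<eta>) * poisson (r (cis x')) (cis x' * cnj \<eta>))"
        unfolding k_def by (subst integral_angle[symmetric]) auto
      also have "\<dots> = poisson (r (cis x) * r (cis x')) (cis x * cnj (cis x'))"
        using r r1 by (intro poisson_semigroup) auto
      also have "\<dots> \<le> 8 * (poisson (r (cis x)) (cis x * cnj (cis x')) + poisson (r (cis x')) (cis x * cnj (cis x')))"
        using r r1 by (intro poisson_mult_le_add) (auto simp: norm_mult)
      also have "poisson (r (cis x')) (cis x * cnj (cis x')) = poisson (r (cis x')) (cis x' * cnj (cis x))"
        by (rule poisson_swap)
      finally show ?thesis by (simp add: k_def)
    qed
    show "F \<in> borel_measurable angle_measure" unfolding F_def by measurable
    show "F x \<le> B" for x unfolding F_def by (rule B) simp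
  qed (use fin k_le in \<open>auto simp: F_def\<close>)
  also have "(LINT x|angle_measure. (F x)\<^sup>2) = (LINT \<zeta>|arc_measure. (cmod (f \<zeta>))\<^sup>2)"
    unfolding F_def by (subst integral_angle[symmetric]) auto
  finally have le: "(LINT x|angle_measure. (LINT y|angle_measure. k x y * F y)\<^sup>2) \<le>
    256 * (LINT \<zeta>|arc_measure. (cmod (f \<zeta>))\<^sup>2)" by simp
  have B0: "B \<ge> 0" using B[of 1] by (meson norm_ge_zero norm_one order_trans)
  have kF: "(LINT y|angle_measure. k x y * F y) = 
    (LINT \<eta>|arc_measure. poisson (r (cis x)) (cis x * cnj \<eta>) * cmod (f \<eta>))" for x
    unfolding k_def F_def by (subst integral_angle[symmetric]) auto
  have pt: "cmod (f (of_real (r (cis x)) * cis x)) \<le> (LINT y|angle_measure. k x y * F y)" for x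
  proof -
    have "f (of_real (r (cis x)) * cis x) =
      (LINT \<eta>|arc_measure. of_real (poisson (r (cis x)) (cis x * cnj \<eta>)) * f \<eta>)"
      using r r1 f by (intro arc_poisson[symmetric, of _ R]) auto
    also have "cmod \<dots> \<le> (LINT \<eta>|arc_measure. cmod (of_real (poisson (r (cis x)) (cis x * cnj \<eta>)) * f \<eta>))"
      by (rule integral_norm_bound)
    also have "\<dots> = (LINT y|angle_measure. k x y * F y)"
      unfolding kF using r r1 by (intro Bochner_Integration.integral_cong) (auto simp: norm_mult poisson_nonneg)
    finally show ?thesis .
  qed
  have "(LINT \<zeta>|arc_measure. (cmod (f (of_real (r \<zeta>) * \<zeta>)))\<^sup>2) =
    (LINT x|angle_measure. (cmod (f (of_real (r (cis x)) * cis x)))\<^sup>2)"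
    by (subst integral_angle[symmetric]) auto
  also have "\<dots> \<le> (LINT x|angle_measure. (LINT y|angle_measure. k x y * F y)\<^sup>2)"
  proof (rule integral_mono)
    interpret finite_measure angle_measure by (rule fin)
    have K: "0 \<le> k x y" for x y unfolding k_def using r r1 by (intro poisson_nonneg) auto
    have kFB: "k x y * F y \<le> 2 / (1 - r0)\<^sup>2 * B" for x y
      using k_le[of x y] K[of x y] B[of "cis y"] B0 by (intro mult_mono) (auto simp: F_def)
    have m1: "(\<lambda>y. k x y * F y) \<in> borel_measurable angle_measure" for x
      unfolding k_def F_def poisson_def by measurable
    have i: "integrable angle_measure (\<lambda>y. k x y * F y)" for x
      by (rule integrable_const_bound[where B = "2 / (1 - r0)\<^sup>2 * B"])
        (use kFB K m1 in \<open>auto simp: abs_mult F_def\<close>)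
    have "(LINT y|angle_measure. k x y * F y) \<le> 2 / (1 - r0)\<^sup>2 * B" for x
      using integral_mono[OF i integrable_const[of "2 / (1 - r0)\<^sup>2 * B"] kFB]
      by (simp add: measure_def emeasure_angle)
    moreover have nn: "0 \<le> (LINT y|angle_measure. k x y * F y)" for x
      using K by (intro integral_nonneg_AE) (auto simp: F_def)
    moreover have m2: "(\<lambda>x. LINT y|angle_measure. k x y * F y) \<in> borel_measurable angle_measure"
      unfolding k_def F_def poisson_def by measurable
    ultimately show i2: "integrable angle_measure (\<lambda>x. (LINT y|angle_measure. k x y * F y)\<^sup>2)"
      by (intro integrable_const_bound[where B = "(2 / (1 - r0)\<^sup>2 * B)\<^sup>2"] AE_I2)
         (auto intro!: power_mono simp del: power_divide power_mult_distrib)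
    show "integrable angle_measure (\<lambda>x. (cmod (f (of_real (r (cis x)) * cis x)))\<^sup>2)"
      by (rule Bochner_Integration.integrable_bound[OF i2]) (use pt nn in \<open>auto intro!: power_mono\<close>)
  qed (use pt in \<open>auto intro!: power_mono\<close>)
  also note le
  finally show ?thesis .
qed

section \<open>Radial limits\<close>

lemma circle_bounded:
  assumes f: "f holomorphic_on ball 0 1" and r0: "r0 < (1::real)"
  obtains B where "\<And>r \<zeta>. 0 \<le> r \<Longrightarrow> r \<le> r0 \<Longrightarrow> cmod \<zeta> = 1 \<Longrightarrow> cmod (f (of_real r * \<zeta>)) \<le> B"
proof -
  have "continuous_on (cball 0 r0) f"
    by (rule holomorphic_on_imp_continuous_on, rule holomorphic_on_subset[OF f]) (use r0 in auto)
  then have "compact (f ` cball 0 r0)" by (rule compact_continuous_image) auto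
  then obtain B where "\<forall>y\<in>f ` cball 0 r0. cmod y \<le> B"
    using compact_imp_bounded bounded_iff by blast
  then have "cmod (f (of_real r * \<zeta>)) \<le> B" if "0 \<le> r" "r \<le> r0" "cmod \<zeta> = 1" for r \<zeta>
    using that by (auto simp: norm_mult)
  then show ?thesis by (rule that)
qed

text \<open>A dilation by some \<open>\<rho>\<close> between \<open>r0\<close> and 1 makes the
  function holomorphic past the closed disk; the selected radii are divided by \<open>\<rho>\<close>
  to compensate.\<close>

lemma radial_max_bound:
  assumes f: "f holomorphic_on ball 0 1" and [measurable]: "f \<in> borel_measurable borel"
    and [measurable]: "r \<in> borel_measurable borel"
    and r: "\<And>\<zeta>. 0 \<le> r \<zeta>" "\<And>\<zeta>. r \<zeta> \<le> r0" "r0 < (1::real)"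
    and A: "\<And>\<rho>. 0 \<le> \<rho> \<Longrightarrow> \<rho> < 1 \<Longrightarrow> (LINT \<zeta>|arc_measure. (cmod (f (of_real \<rho> * \<zeta>)))\<^sup>2) \<le> A"
  shows "(LINT \<zeta>|arc_measure. (cmod (f (of_real (r \<zeta>) * \<zeta>)))\<^sup>2) \<le> 256 * A"
proof -
  define \<rho> where "\<rho> = (1 + r0) / 2"
  have "0 \<le> r0" using r by (meson order_trans)
  then have \<rho>: "0 < \<rho>" "\<rho> < 1" "r0 < \<rho>" using r(3) by (auto simp: \<rho>_def)
  define g where "g z = f (of_real \<rho> * z)" for z
  have [measurable]: "g \<in> borel_measurable borel" unfolding g_def by measurable
  have "g holomorphic_on ball 0 (1 / \<rho>)"
    unfolding g_def using \<rho>
    by (intro holomorphic_on_compose_gen[OF _ f, unfolded o_def] holomorphic_intros)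
       (auto simp: norm_mult field_simps)
  then have "(LINT \<zeta>|arc_measure. (cmod (g (of_real (r \<zeta> / \<rho>) * \<zeta>)))\<^sup>2) \<le>
    256 * (LINT \<zeta>|arc_measure. (cmod (g \<zeta>))\<^sup>2)"
    by (rule radial_max_bound_closed[where ?r0.0 = "r0 / \<rho>"])
       (use \<rho> r in \<open>auto intro: divide_right_mono\<close>)
  also have "(LINT \<zeta>|arc_measure. (cmod (g \<zeta>))\<^sup>2) \<le> A"
    unfolding g_def using A[of \<rho>] \<rho> by simp
  also have "(\<lambda>\<zeta>. g (of_real (r \<zeta> / \<rho>) * \<zeta>)) = (\<lambda>\<zeta>. f (of_real (r \<zeta>) * \<zeta>))"
    using \<rho> by (simp add: g_def fun_eq_iff)
  finally show ?thesis by simp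
qed

text \<open>An enumeration of the rational radii in \<open>{0..<1}\<close>: a supremum over
  countably many radii is measurable, and by continuity on each radius of the disk it loses
  nothing.\<close>

definition radii :: "nat \<Rightarrow> real" where
  "radii = from_nat_into (\<rat> \<inter> {0..<1})"

lemma radii_bounds: "0 \<le> radii i" "radii i < 1"
proof -
  have "(0::real) \<in> \<rat> \<inter> {0..<1}" by simp
  then have "radii i \<in> \<rat> \<inter> {0..<1}" unfolding radii_def by (intro from_nat_into) blast
  then show "0 \<le> radii i" "radii i < 1" by auto
qed

lemma radii_dense:
  assumes "0 \<le> x" "x < y" "y \<le> 1"
  shows "\<exists>i. x < radii i \<and> radii i < y"
proof -
  obtain q where q: "q \<in> \<rat>" "x < q" "q < y" using Rats_dense_in_real assms by blast
  have "countable (\<rat> \<inter> {0..<1::real})" using countable_rat by auto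
  moreover have "q \<in> \<rat> \<inter> {0..<1}" using q assms by auto
  ultimately obtain i where "radii i = q" unfolding radii_def
    using from_nat_into_surj by metis
  with q show ?thesis by blast
qed

text \<open>The square of the radial maximal function. It takes values in \<open>ennreal\<close>
  because its finiteness almost everywhere is a conclusion, not a premise.\<close>

definition radial_sup :: "(complex \<Rightarrow> complex) \<Rightarrow> complex \<Rightarrow> ennreal" where
  "radial_sup f \<zeta> = (SUP i. ennreal ((cmod (f (of_real (radii i) * \<zeta>)))\<^sup>2))"

lemma radial_sup_measurable [measurable]:
  assumes [measurable]: "f \<in> borel_measurable borel"
  shows "radial_sup f \<in> borel_measurable borel"
  unfolding radial_sup_def by measurable

lemma radii_approx:
  assumes r: "0 \<le> r" "r < 1"
  obtains i :: "nat \<Rightarrow> nat" where "\<And>n. r < radii (i n)" "(\<lambda>n. radii (i n)) \<longlonglongrightarrow> r"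
proof -
  have "\<exists>i. r < radii i \<and> radii i < min 1 (r + 1 / Suc n)" for n
    by (rule radii_dense) (use r in auto)
  then obtain i where i: "\<And>n. r < radii (i n)" "\<And>n. radii (i n) < r + 1 / Suc n"
    unfolding choice_iff by (metis min_less_iff_conj)
  have "(\<lambda>n. radii (i n)) \<longlonglongrightarrow> r"
  proof (rule tendsto_sandwich[where f = "\<lambda>_. r" and h = "\<lambda>n. r + 1 / Suc n"])
    have "(\<lambda>n. r + 1 / Suc n) \<longlonglongrightarrow> r + 0"
      by (intro tendsto_intros LIMSEQ_inverse_real_of_nat[unfolded inverse_eq_divide])
    then show "(\<lambda>n. r + 1 / Suc n) \<longlonglongrightarrow> r" by simp
    show "\<forall>\<^sub>F n in sequentially. radii (i n) \<le> r + 1 / Suc n"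
      using i(2) by (intro always_eventually allI less_imp_le)
  qed (use i in \<open>auto intro!: always_eventually less_imp_le\<close>)
  with i(1) that show ?thesis by blast
qed

lemma radial_tendsto:
  assumes f: "continuous_on (ball 0 1) f" and r: "0 \<le> r" "r < 1" and \<zeta>: "cmod \<zeta> = 1"
    and \<rho>: "\<rho> \<longlonglongrightarrow> r"
  shows "(\<lambda>n. f (of_real (\<rho> n) * \<zeta>)) \<longlonglongrightarrow> f (of_real r * \<zeta>)"
proof -
  have "isCont f (of_real r * \<zeta>)"
    using f r \<zeta> by (simp add: continuous_on_eq_continuous_at norm_mult)
  then show ?thesis
    by (rule isCont_tendsto_compose) (intro tendsto_intros \<rho>)
qed

lemma radial_sup_ge:
  assumes f: "continuous_on (ball 0 1) f" and r: "0 \<le> r" "r < 1" and \<zeta>: "cmod \<zeta> = 1"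
  shows "ennreal ((cmod (f (of_real r * \<zeta>)))\<^sup>2) \<le> radial_sup f \<zeta>"
proof -
  obtain i where "(\<lambda>n. radii (i n)) \<longlonglongrightarrow> r" using radii_approx[OF r] by blast
  from radial_tendsto[OF f r \<zeta> this]
  have "(\<lambda>n. ennreal ((cmod (f (of_real (radii (i n)) * \<zeta>)))\<^sup>2)) \<longlonglongrightarrow> ennreal ((cmod (f (of_real r * \<zeta>)))\<^sup>2)"
    by (intro tendsto_intros tendsto_ennrealI)
  then show ?thesis
    unfolding radial_sup_def by (rule LIMSEQ_le_const2) (intro exI allI impI SUP_upper UNIV_I)
qed

text \<open>Among finitely many radii the least index attaining the maximum is a measurable
  selection, so the linearized inequality applies with a constant that does not depend on how many
  radii are used. Monotone convergence then reaches the full supremum.\<close>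

lemma nn_integral_radial_sup:
  assumes f: "f holomorphic_on ball 0 1" and [measurable]: "f \<in> borel_measurable borel"
    and A: "\<And>\<rho>. 0 \<le> \<rho> \<Longrightarrow> \<rho> < 1 \<Longrightarrow> (LINT \<zeta>|arc_measure. (cmod (f (of_real \<rho> * \<zeta>)))\<^sup>2) \<le> A"
  shows "(\<integral>\<^sup>+\<zeta>. radial_sup f \<zeta> \<partial>arc_measure) \<le> ennreal (256 * A)"
proof -
  define g where "g N \<zeta> = (SUP i\<in>{..N}. ennreal ((cmod (f (of_real (radii i) * \<zeta>)))\<^sup>2))" for N :: nat and \<zeta>
  have "radial_sup f \<zeta> = (SUP N. g N \<zeta>)" for \<zeta>
    unfolding radial_sup_def g_def
    by (rule antisym) (auto intro!: SUP_least intro: SUP_upper SUP_upper2)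
  then have "(\<integral>\<^sup>+\<zeta>. radial_sup f \<zeta> \<partial>arc_measure) = (\<integral>\<^sup>+\<zeta>. (SUP N. g N \<zeta>) \<partial>arc_measure)"
    by simp
  also have "\<dots> = (SUP N. \<integral>\<^sup>+\<zeta>. g N \<zeta> \<partial>arc_measure)"
  proof (rule nn_integral_monotone_convergence_SUP)
    show "incseq g" unfolding g_def by (intro monoI le_funI SUP_subset_mono) auto
  qed (simp add: g_def)
  also have "\<dots> \<le> ennreal (256 * A)"
  proof (rule SUP_least)
    fix N :: nat
    define P where "P \<zeta> i \<longleftrightarrow> i \<le> N \<and>
      (\<forall>j\<in>{..N}. cmod (f (of_real (radii j) * \<zeta>)) \<le> cmod (f (of_real (radii i) * \<zeta>)))" for \<zeta> i
    define i where "i \<zeta> = (LEAST i. P \<zeta> i)" for \<zeta>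
    have [measurable]: "i \<in> measurable borel (count_space UNIV)"
      unfolding i_def P_def by measurable
    have ex: "\<exists>i. P \<zeta> i" for \<zeta>
    proof -
      define h where "h = (\<lambda>j. cmod (f (of_real (radii j) * \<zeta>)))"
      have "Max (h ` {..N}) \<in> h ` {..N}" by (intro Max_in) auto
      then obtain i where "i \<le> N" "h i = Max (h ` {..N})" by (metis imageE atMost_iff)
      then have "P \<zeta> i" unfolding P_def h_def[symmetric] by (auto simp: h_def)
      then show ?thesis ..
    qed
    have i: "i \<zeta> \<le> N" "\<And>j. j \<le> N \<Longrightarrow> cmod (f (of_real (radii j) * \<zeta>)) \<le> cmod (f (of_real (radii (i \<zeta>)) * \<zeta>))" for \<zeta>
    proof -
      have "P \<zeta> (i \<zeta>)" unfolding i_def by (rule LeastI_ex[OF ex])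
      then show "i \<zeta> \<le> N" "\<And>j. j \<le> N \<Longrightarrow> cmod (f (of_real (radii j) * \<zeta>)) \<le> cmod (f (of_real (radii (i \<zeta>)) * \<zeta>))"
        by (auto simp: P_def)
    qed
    define r where "r \<zeta> = radii (i \<zeta>)" for \<zeta>
    have [measurable]: "r \<in> borel_measurable borel" unfolding r_def by measurable
    define r0 where "r0 = Max (radii ` {..N})"
    have r0: "r0 < 1" unfolding r0_def using radii_bounds by (subst Max_less_iff) auto
    have r: "0 \<le> r \<zeta>" "r \<zeta> \<le> r0" for \<zeta>
      using i radii_bounds by (auto simp: r_def r0_def)
    obtain B where B: "\<And>r \<zeta>. 0 \<le> r \<Longrightarrow> r \<le> r0 \<Longrightarrow> cmod \<zeta> = 1 \<Longrightarrow> cmod (f (of_real r * \<zeta>)) \<le> B"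
      using circle_bounded[OF f r0] by blast
    have int: "integrable arc_measure (\<lambda>\<zeta>. (cmod (f (of_real (r \<zeta>) * \<zeta>)))\<^sup>2)"
      by (rule integrable_arc_bounded[where B = "B\<^sup>2"]) (use B r in \<open>auto intro!: power_mono\<close>)
    have "(\<integral>\<^sup>+\<zeta>. g N \<zeta> \<partial>arc_measure) \<le> (\<integral>\<^sup>+\<zeta>. ennreal ((cmod (f (of_real (r \<zeta>) * \<zeta>)))\<^sup>2) \<partial>arc_measure)"
      unfolding g_def using i by (intro nn_integral_mono SUP_least) (auto simp: r_def intro!: ennreal_leI power_mono)
    also have "\<dots> = ennreal (LINT \<zeta>|arc_measure. (cmod (f (of_real (r \<zeta>) * \<zeta>)))\<^sup>2)"
      by (rule nn_integral_eq_integral[OF int]) auto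
    also have "\<dots> \<le> ennreal (256 * A)"
      by (intro ennreal_leI radial_max_bound[OF f _ _ r r0 A]) auto
    finally show "(\<integral>\<^sup>+\<zeta>. g N \<zeta> \<partial>arc_measure) \<le> ennreal (256 * A)" .
  qed
  finally show ?thesis .
qed

section \<open>Taylor coefficients and the norm in the Hardy space\<close>

lemma disk_series_abs_summable:
  fixes a :: "nat \<Rightarrow> complex"
  assumes a: "\<And>z. cmod z < 1 \<Longrightarrow> (\<lambda>k. a k * z ^ k) sums f z" and r: "0 \<le> r" "r < 1"
  shows "summable (\<lambda>k. cmod (a k * of_real r ^ k))"
  using powser_insidea[of a "of_real ((1 + r) / 2)" "of_real r"] a[of "of_real ((1 + r) / 2)"] r
  by (auto simp: sums_iff simp del: of_real_divide of_real_add)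

lemma disk_parseval:
  fixes a b :: "nat \<Rightarrow> complex"
  assumes a: "\<And>z. cmod z < 1 \<Longrightarrow> (\<lambda>k. a k * z ^ k) sums f z"
    and b: "\<And>z. cmod z < 1 \<Longrightarrow> (\<lambda>k. b k * z ^ k) sums g z"
    and [measurable]: "f \<in> borel_measurable borel" "g \<in> borel_measurable borel"
    and r: "0 \<le> r" "r < 1"
  shows "(\<lambda>k. a k * cnj (b k) * of_real r ^ (2 * k)) sums
    (LINT \<zeta>|arc_measure. f (of_real r * \<zeta>) * cnj (g (of_real r * \<zeta>)))"
proof -
  have "(\<lambda>k. (a k * of_real r ^ k) * cnj (b k * of_real r ^ k)) sums
    (LINT \<zeta>|arc_measure. (\<Sum>k. (a k * of_real r ^ k) * \<zeta> ^ k) * cnj (\<Sum>k. (b k * of_real r ^ k) * \<zeta> ^ k))"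
    by (intro arc_parseval disk_series_abs_summable[OF a r] disk_series_abs_summable[OF b r])
  also have "(LINT \<zeta>|arc_measure. (\<Sum>k. (a k * of_real r ^ k) * \<zeta> ^ k) * cnj (\<Sum>k. (b k * of_real r ^ k) * \<zeta> ^ k)) =
    (LINT \<zeta>|arc_measure. f (of_real r * \<zeta>) * cnj (g (of_real r * \<zeta>)))"
  proof (rule integral_cong_AE)
    show "AE \<zeta> in arc_measure. (\<Sum>k. (a k * of_real r ^ k) * \<zeta> ^ k) * cnj (\<Sum>k. (b k * of_real r ^ k) * \<zeta> ^ k) =
      f (of_real r * \<zeta>) * cnj (g (of_real r * \<zeta>))"
    proof (rule AE_arcI)
      fix \<zeta> :: complex assume "cmod \<zeta> = 1"
      then have "cmod (of_real r * \<zeta>) < 1" using r by (simp add: norm_mult)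
      with a b show "(\<Sum>k. (a k * of_real r ^ k) * \<zeta> ^ k) * cnj (\<Sum>k. (b k * of_real r ^ k) * \<zeta> ^ k) =
        f (of_real r * \<zeta>) * cnj (g (of_real r * \<zeta>))"
        by (simp add: sums_iff mult.assoc flip: power_mult_distrib)
    qed
  qed (auto intro!: borel_measurable_suminf)
  finally show ?thesis by (simp add: power_mult mult_ac power2_eq_square power_mult_distrib)
qed

lemma disk_parseval_norm:
  fixes a :: "nat \<Rightarrow> complex"
  assumes a: "\<And>z. cmod z < 1 \<Longrightarrow> (\<lambda>k. a k * z ^ k) sums f z"
    and [measurable]: "f \<in> borel_measurable borel" and r: "0 \<le> r" "r < 1"
  shows "(\<lambda>k. (cmod (a k))\<^sup>2 * r ^ (2 * k)) sums (LINT \<zeta>|arc_measure. (cmod (f (of_real r * \<zeta>)))\<^sup>2)"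
proof -
  have "(\<lambda>k. of_real ((cmod (a k))\<^sup>2 * r ^ (2 * k)) :: complex) sums
    (LINT \<zeta>|arc_measure. of_real ((cmod (f (of_real r * \<zeta>)))\<^sup>2))"
    using disk_parseval[OF a a _ _ r] unfolding of_real_mult complex_norm_square by simp
  then show ?thesis unfolding integral_complex_of_real by (simp only: sums_of_real_iff)
qed

lemma H2_holomorphic: "f \<in> H2 \<Longrightarrow> f holomorphic_on ball 0 1"
  and H2_outside: "f \<in> H2 \<Longrightarrow> 1 \<le> cmod z \<Longrightarrow> f z = 0"
  by (auto simp: H2_def)

lemma H2_continuous: "f \<in> H2 \<Longrightarrow> continuous_on (ball 0 1) f"
  by (intro holomorphic_on_imp_continuous_on H2_holomorphic)

lemma borel_measurable_zero_outside:
  assumes "f holomorphic_on ball 0 1" "\<And>z. z \<notin> ball 0 1 \<Longrightarrow> f z = 0"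
  shows "f \<in> borel_measurable borel"
proof -
  have "(\<lambda>z. if z \<in> ball 0 1 then f z else 0) \<in> borel_measurable borel"
    by (rule borel_measurable_continuous_on_if)
      (use assms in \<open>auto intro!: holomorphic_on_imp_continuous_on\<close>)
  also have "(\<lambda>z. if z \<in> ball 0 1 then f z else 0) = f"
    using assms(2) by (auto simp: fun_eq_iff)
  finally show ?thesis .
qed

lemma H2_measurable: "f \<in> H2 \<Longrightarrow> f \<in> borel_measurable borel"
  by (rule borel_measurable_zero_outside) (auto simp: H2_def)

lemma H2E_bound:
  assumes "f \<in> H2"
  obtains B where "\<And>r. 0 \<le> r \<Longrightarrow> r < 1 \<Longrightarrow> (LINT \<zeta>|arc_measure. (cmod (f (of_real r * \<zeta>)))\<^sup>2) \<le> B"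
proof -
  obtain B where "\<forall>r\<in>{0..<1}. (LINT \<zeta>|arc_measure. (cmod (f (of_real r * \<zeta>)))\<^sup>2) \<le> B"
    using assms by (auto simp: H2_def bdd_above_def)
  then have "(LINT \<zeta>|arc_measure. (cmod (f (of_real r * \<zeta>)))\<^sup>2) \<le> B" if "0 \<le> r" "r < 1" for r
    using that by simp
  then show ?thesis by (rule that)
qed

text \<open>On every circle a finite part of the Parseval sum lies below the uniform bound; in a
  finite sum the radius may tend to 1.\<close>

lemma H2_series:
  assumes f: "f \<in> H2"
  obtains a where "\<And>z. cmod z < 1 \<Longrightarrow> (\<lambda>k. a k * z ^ k) sums f z" "summable (\<lambda>k. (cmod (a k))\<^sup>2)"
proof -
  obtain a where a: "\<And>z. cmod z < 1 \<Longrightarrow> (\<lambda>k. a k * z ^ k) sums f z"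
    by (rule holomorphic_ball_series[OF H2_holomorphic[OF f]]) (rule that)
  obtain B where B: "\<And>r. 0 \<le> r \<Longrightarrow> r < 1 \<Longrightarrow> (LINT \<zeta>|arc_measure. (cmod (f (of_real r * \<zeta>)))\<^sup>2) \<le> B"
    by (rule H2E_bound[OF f]) (rule that)
  have "summable (\<lambda>k. (cmod (a k))\<^sup>2)"
  proof (rule summableI_nonneg_bounded)
    fix n
    have "(\<Sum>k<n. (cmod (a k))\<^sup>2 * r ^ (2 * k)) \<le> B" if "0 \<le> r" "r < 1" for r
    proof -
      have "(\<lambda>k. (cmod (a k))\<^sup>2 * r ^ (2 * k)) sums (LINT \<zeta>|arc_measure. (cmod (f (of_real r * \<zeta>)))\<^sup>2)"
        by (rule disk_parseval_norm[OF a H2_measurable[OF f] that])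
      moreover have "(\<lambda>k. if k \<in> {..<n} then (cmod (a k))\<^sup>2 * r ^ (2 * k) else 0) sums
        (\<Sum>k<n. (cmod (a k))\<^sup>2 * r ^ (2 * k))"
        by (rule sums_If_finite_set) auto
      ultimately have "(\<Sum>k<n. (cmod (a k))\<^sup>2 * r ^ (2 * k)) \<le> (LINT \<zeta>|arc_measure. (cmod (f (of_real r * \<zeta>)))\<^sup>2)"
        using that by (elim sums_le[rotated]) auto
      with B[OF that] show ?thesis by simp
    qed
    then have "\<forall>\<^sub>F r in at_left 1. (\<Sum>k<n. (cmod (a k))\<^sup>2 * r ^ (2 * k)) \<le> B"
      by (intro eventually_at_leftI[of 0]) auto
    moreover have "((\<lambda>r::real. \<Sum>k<n. (cmod (a k))\<^sup>2 * r ^ (2 * k)) \<longlongrightarrow> (\<Sum>k<n. (cmod (a k))\<^sup>2 * 1 ^ (2 * k))) (at_left 1)"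
      by (intro tendsto_intros)
    ultimately show "(\<Sum>k<n. (cmod (a k))\<^sup>2) \<le> B"
      by (intro tendsto_upperbound[of _ _ "at_left (1::real)"]) auto
  qed auto
  with a show ?thesis by (rule that)
qed

lemma disk_norm_le:
  assumes a: "\<And>z. cmod z < 1 \<Longrightarrow> (\<lambda>k. a k * z ^ k) sums f z" "summable (\<lambda>k. (cmod (a k))\<^sup>2)"
    and f: "f \<in> borel_measurable borel" and r: "0 \<le> r" "r < 1"
  shows "(LINT \<zeta>|arc_measure. (cmod (f (of_real r * \<zeta>)))\<^sup>2) \<le> (\<Sum>k. (cmod (a k))\<^sup>2)"
proof -
  have "(cmod (a k))\<^sup>2 * r ^ (2 * k) \<le> (cmod (a k))\<^sup>2" for k
    using r by (intro mult_left_le) (auto intro: power_le_one)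
  then show ?thesis
    using disk_parseval_norm[OF a(1) f r] a(2) by (intro sums_le[OF _ _ summable_sums]) auto
qed

lemma Cauchy_at_left_imp_tendsto:
  fixes g :: "real \<Rightarrow> 'a::complete_space"
  assumes "\<And>e. e > 0 \<Longrightarrow> \<exists>P. eventually P (at_left a) \<and> (\<forall>x y. P x \<and> P y \<longrightarrow> dist (g x) (g y) < e)"
  shows "\<exists>l. (g \<longlongrightarrow> l) (at_left a)"
proof -
  have "cauchy_filter (filtermap g (at_left a))"
    unfolding cauchy_filter_metric_filtermap using assms by blast
  then have "\<exists>c. filtermap g (at_left a) \<le> nhds c"
    by (rule cauchy_filter_complete_converges[OF _ complete_UNIV])
       (simp_all add: filtermap_bot_iff)
  then show ?thesis by (simp add: filterlim_def)
qed

text \<open>Taylor polynomials have limits everywhere on the circle, so the oscillation of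
  \<open>f\<close> along a radius is controlled by the maximal function of a Taylor remainder
  \<open>T N\<close>. Its integral is at most 256 times the tail \<open>A N\<close> of the
  coefficient sum, which tends to 0.\<close>

lemma radial_limit_AE:
  assumes f: "f \<in> H2"
  shows "AE \<zeta> in arc_measure. \<exists>l. ((\<lambda>r. f (of_real r * \<zeta>)) \<longlongrightarrow> l) (at_left (1::real))"
proof -
  note [measurable] = H2_measurable[OF f]
  obtain a where a: "\<And>z. cmod z < 1 \<Longrightarrow> (\<lambda>k. a k * z ^ k) sums f z" "summable (\<lambda>k. (cmod (a k))\<^sup>2)"
    using H2_series[OF f] by blast
  define S where "S N z = (\<Sum>k<N. a k * z ^ k)" for N z
  define T where "T N z = f z - S N z" for N z
  define A where "A N = (\<Sum>k. (cmod (a k))\<^sup>2) - (\<Sum>k<N. (cmod (a k))\<^sup>2)" for N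
  have [measurable]: "S N \<in> borel_measurable borel" for N unfolding S_def by measurable
  have [measurable]: "T N \<in> borel_measurable borel" for N unfolding T_def by measurable
  have T_le: "(LINT \<zeta>|arc_measure. (cmod (T N (of_real r * \<zeta>)))\<^sup>2) \<le> A N" if "0 \<le> r" "r < 1" for r N
  proof -
    define a' where "a' k = a k - (if k < N then a k else 0)" for k
    have "(\<lambda>k. a' k * z ^ k) sums T N z" if "cmod z < 1" for z
    proof -
      have "(\<lambda>k. a k * z ^ k - (if k \<in> {..<N} then a k * z ^ k else 0)) sums (f z - S N z)"
        unfolding S_def using a(1)[OF that] by (intro sums_diff sums_If_finite_set) auto
      also have "(\<lambda>k. a k * z ^ k - (if k \<in> {..<N} then a k * z ^ k else 0)) = (\<lambda>k. a' k * z ^ k)"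
        by (auto simp: a'_def)
      finally show ?thesis by (simp add: T_def)
    qed
    moreover have s: "(\<lambda>k. (cmod (a' k))\<^sup>2) sums A N"
    proof -
      have "(\<lambda>k. (cmod (a k))\<^sup>2 - (if k \<in> {..<N} then (cmod (a k))\<^sup>2 else 0)) sums A N"
        unfolding A_def using a(2) by (intro sums_diff sums_If_finite_set) auto
      also have "(\<lambda>k. (cmod (a k))\<^sup>2 - (if k \<in> {..<N} then (cmod (a k))\<^sup>2 else 0)) = (\<lambda>k. (cmod (a' k))\<^sup>2)"
        by (auto simp: a'_def)
      finally show ?thesis .
    qed
    ultimately show ?thesis
      using disk_norm_le[of a' "T N" r] that by (simp add: sums_iff)
  qed
  have "(\<lambda>N. A N) \<longlonglongrightarrow> (\<Sum>k. (cmod (a k))\<^sup>2) - (\<Sum>k. (cmod (a k))\<^sup>2)"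
    unfolding A_def by (intro tendsto_intros summable_LIMSEQ a)
  then have A_lim: "(\<lambda>N. ennreal (256 * A N)) \<longlonglongrightarrow> 0"
    by (auto intro!: tendsto_eq_intros simp flip: ennreal_0)
  \<comment> \<open>Fatou's lemma for the limes inferior is enough: at a given point and tolerance,
    a single \<open>N\<close> with small remainder yields the Cauchy property.\<close>
  have "(\<integral>\<^sup>+\<zeta>. liminf (\<lambda>N. radial_sup (T N) \<zeta>) \<partial>arc_measure) \<le>
    liminf (\<lambda>N. \<integral>\<^sup>+\<zeta>. radial_sup (T N) \<zeta> \<partial>arc_measure)"
    by (rule nn_integral_liminf) auto
  also have "\<dots> \<le> liminf (\<lambda>N. ennreal (256 * A N))"
  proof (intro Liminf_mono always_eventually allI nn_integral_radial_sup T_le)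
    show "T N holomorphic_on ball 0 1" for N
      unfolding T_def S_def by (intro holomorphic_intros H2_holomorphic f)
  qed auto
  also have "\<dots> = 0" using A_lim by (rule lim_imp_Liminf[rotated]) auto
  finally have "(\<integral>\<^sup>+\<zeta>. liminf (\<lambda>N. radial_sup (T N) \<zeta>) \<partial>arc_measure) = 0" by simp
  then have "AE \<zeta> in arc_measure. liminf (\<lambda>N. radial_sup (T N) \<zeta>) = 0"
    by (subst (asm) nn_integral_0_iff_AE) auto
  with AE_arc_circle show ?thesis
  proof eventually_elim
    fix \<zeta> assume \<zeta>: "cmod \<zeta> = 1" and lim: "liminf (\<lambda>N. radial_sup (T N) \<zeta>) = 0"
    show "\<exists>l. ((\<lambda>r. f (of_real r * \<zeta>)) \<longlongrightarrow> l) (at_left 1)"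
    proof (rule Cauchy_at_left_imp_tendsto)
      fix e :: real assume e: "e > 0"
      have "\<exists>N. radial_sup (T N) \<zeta> < ennreal ((e / 3)\<^sup>2)"
      proof (rule ccontr)
        assume "\<nexists>N. radial_sup (T N) \<zeta> < ennreal ((e / 3)\<^sup>2)"
        then have "ennreal ((e / 3)\<^sup>2) \<le> liminf (\<lambda>N. radial_sup (T N) \<zeta>)"
          by (intro Liminf_bounded always_eventually allI) (simp add: not_less)
        with e lim show False by (simp add: ennreal_eq_0_iff)
      qed
      then obtain N where N: "radial_sup (T N) \<zeta> < ennreal ((e / 3)\<^sup>2)" ..
      have T_small: "cmod (T N (of_real r * \<zeta>)) < e / 3" if "0 \<le> r" "r < 1" for r
      proof -
        have "continuous_on (ball 0 1) (T N)"
          unfolding T_def S_def by (intro continuous_intros H2_continuous f)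
        from radial_sup_ge[OF this that \<zeta>] N
        have "ennreal ((cmod (T N (of_real r * \<zeta>)))\<^sup>2) < ennreal ((e / 3)\<^sup>2)" by simp
        then have "(cmod (T N (of_real r * \<zeta>)))\<^sup>2 < (e / 3)\<^sup>2" by (subst (asm) ennreal_less_iff) simp_all
        then show ?thesis by (rule power2_less_imp_less) (use e in simp)
      qed
      have "((\<lambda>r::real. S N (of_real r * \<zeta>)) \<longlongrightarrow> S N (of_real 1 * \<zeta>)) (at_left 1)"
        unfolding S_def by (intro tendsto_intros)
      then have "\<forall>\<^sub>F r in at_left 1. dist (S N (of_real r * \<zeta>)) (S N (of_real 1 * \<zeta>)) < e / 6"
        by (rule tendstoD) (use e in simp)
      then have "\<forall>\<^sub>F r in at_left 1. dist (S N (of_real r * \<zeta>)) (S N \<zeta>) < e / 6"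
        by simp
      moreover have "\<forall>\<^sub>F r in at_left (1::real). 0 \<le> r \<and> r < 1"
        by (intro eventually_at_leftI[of 0]) auto
      ultimately have "\<forall>\<^sub>F r in at_left 1. (0 \<le> r \<and> r < 1) \<and> dist (S N (of_real r * \<zeta>)) (S N \<zeta>) < e / 6"
        by (simp add: eventually_conj_iff)
      moreover have "dist (f (of_real x * \<zeta>)) (f (of_real y * \<zeta>)) < e"
        if "(0 \<le> x \<and> x < 1) \<and> dist (S N (of_real x * \<zeta>)) (S N \<zeta>) < e / 6"
          "(0 \<le> y \<and> y < 1) \<and> dist (S N (of_real y * \<zeta>)) (S N \<zeta>) < e / 6" for x y
      proof -
        have "dist (S N (of_real x * \<zeta>)) (S N (of_real y * \<zeta>)) < e / 3"
          using dist_triangle2[of "S N (of_real x * \<zeta>)" "S N (of_real y * \<zeta>)" "S N \<zeta>"] that by simp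
        moreover
        have "f (of_real x * \<zeta>) - f (of_real y * \<zeta>) =
          (S N (of_real x * \<zeta>) - S N (of_real y * \<zeta>)) + (T N (of_real x * \<zeta>) - T N (of_real y * \<zeta>))"
          by (simp add: T_def)
        then have "dist (f (of_real x * \<zeta>)) (f (of_real y * \<zeta>)) \<le> dist (S N (of_real x * \<zeta>)) (S N (of_real y * \<zeta>)) +
            (cmod (T N (of_real x * \<zeta>)) + cmod (T N (of_real y * \<zeta>)))"
          unfolding dist_norm
          by (simp only:) (rule order_trans[OF norm_triangle_ineq add_left_mono[OF norm_triangle_ineq4]])
        moreover have "cmod (T N (of_real x * \<zeta>)) < e / 3" "cmod (T N (of_real y * \<zeta>)) < e / 3"
          using T_small that by blast+
        ultimately show ?thesis by linarith
      qed
      ultimately show "\<exists>P. eventually P (at_left 1) \<and>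
        (\<forall>x y. P x \<and> P y \<longrightarrow> dist (f (of_real x * \<zeta>)) (f (of_real y * \<zeta>)) < e)"
        by (intro exI[of _ "\<lambda>r. (0 \<le> r \<and> r < 1) \<and> dist (S N (of_real r * \<zeta>)) (S N \<zeta>) < e / 6"]) blast
    qed
  qed
qed

lemma boundary_fun_eqI:
  "((\<lambda>r. f (of_real r * \<zeta>)) \<longlongrightarrow> l) (at_left (1::real)) \<Longrightarrow> boundary_fun f \<zeta> = l"
  unfolding boundary_fun_def by (rule tendsto_Lim) auto

lemma boundary_fun_tendsto:
  assumes f: "f \<in> H2"
  shows "AE \<zeta> in arc_measure. ((\<lambda>r. f (of_real r * \<zeta>)) \<longlongrightarrow> boundary_fun f \<zeta>) (at_left (1::real))"
  using radial_limit_AE[OF f] by eventually_elim (auto dest: boundary_fun_eqI)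

text \<open>Dominated convergence is a statement about sequences; these radii replace the filter
  \<open>at_left 1\<close>. The shift in the denominator makes the first one 0.\<close>

definition inner_radius :: "nat \<Rightarrow> real" where
  "inner_radius n = 1 - 1 / Suc n"

lemma inner_radius: "0 \<le> inner_radius n" "inner_radius n < 1" "inner_radius \<longlonglongrightarrow> 1"
  "filterlim inner_radius (at_left 1) sequentially"
proof -
  show *: "0 \<le> inner_radius n" "inner_radius n < 1" for n by (simp_all add: inner_radius_def)
  show lim: "inner_radius \<longlonglongrightarrow> 1" unfolding inner_radius_def
    using tendsto_diff[OF tendsto_const LIMSEQ_inverse_real_of_nat, of 1] by (simp add: inverse_eq_divide)
  then show "filterlim inner_radius (at_left 1) sequentially"
    using * by (auto simp: filterlim_at intro!: always_eventually less_imp_neq)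
qed

text \<open>The convergence set of the radial limits is Borel because, by continuity on the radius, the
  Cauchy criterion need only be tested at countably many radii.\<close>

lemma boundary_fun_measurable:
  assumes f: "f \<in> H2"
  shows "boundary_fun f \<in> borel_measurable borel"
proof -
  note [measurable] = H2_measurable[OF f]
  define C where "C \<zeta> \<longleftrightarrow> (\<forall>k::nat. \<exists>m::nat. \<forall>i j. 1 - 1 / Suc m \<le> radii i \<longrightarrow> 1 - 1 / Suc m \<le> radii j \<longrightarrow>
    dist (f (of_real (radii i) * \<zeta>)) (f (of_real (radii j) * \<zeta>)) \<le> 1 / Suc k)" for \<zeta>
  have C_iff: "C \<zeta> \<longleftrightarrow> (\<exists>l. ((\<lambda>r. f (of_real r * \<zeta>)) \<longlongrightarrow> l) (at_left (1::real)))" if \<zeta>: "cmod \<zeta> = 1" for \<zeta>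
  proof
    let ?g = "\<lambda>r::real. f (of_real r * \<zeta>)"
    assume C: "C \<zeta>"
    show "\<exists>l. (?g \<longlongrightarrow> l) (at_left 1)"
    proof (rule Cauchy_at_left_imp_tendsto)
      fix e :: real assume "e > 0"
      then obtain k where k: "1 / real (Suc k) < e"
        using reals_Archimedean by (auto simp: inverse_eq_divide)
      with C obtain m where m: "\<And>i j. 1 - 1 / Suc m \<le> radii i \<Longrightarrow> 1 - 1 / Suc m \<le> radii j \<Longrightarrow>
        dist (?g (radii i)) (?g (radii j)) \<le> 1 / Suc k"
        unfolding C_def by blast
      have le: "dist (?g x) (?g y) \<le> 1 / Suc k"
        if "1 - 1 / Suc m \<le> x" "x < 1" "1 - 1 / Suc m \<le> y" "y < 1" for x y
      proof -
        have "0 \<le> 1 - 1 / real (Suc m)" by simp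
        then have xy: "0 \<le> x" "x < 1" "0 \<le> y" "y < 1" using that by linarith+
        obtain i where i: "\<And>n. x < radii (i n)" "(\<lambda>n. radii (i n)) \<longlonglongrightarrow> x"
          by (rule radii_approx[of x]) (use xy in auto)
        obtain j where j: "\<And>n. y < radii (j n)" "(\<lambda>n. radii (j n)) \<longlonglongrightarrow> y"
          by (rule radii_approx[of y]) (use xy in auto)
        have "(\<lambda>n. dist (?g (radii (i n))) (?g (radii (j n)))) \<longlonglongrightarrow> dist (?g x) (?g y)"
          using xy by (intro tendsto_dist radial_tendsto H2_continuous f \<zeta> i j)
        moreover have "dist (?g (radii (i n))) (?g (radii (j n))) \<le> 1 / Suc k" for n
          using i(1)[of n] j(1)[of n] that by (intro m) auto
        ultimately show ?thesis by (intro LIMSEQ_le_const2) auto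
      qed
      have "\<forall>\<^sub>F r in at_left (1::real). 1 - 1 / Suc m \<le> r \<and> r < 1"
        by (intro eventually_at_leftI[of "1 - 1 / Suc m"]) auto
      then show "\<exists>P. eventually P (at_left 1) \<and> (\<forall>x y. P x \<and> P y \<longrightarrow> dist (?g x) (?g y) < e)"
        using le k by (intro exI[of _ "\<lambda>r. 1 - 1 / Suc m \<le> r \<and> r < 1"]) (meson le_less_trans)
    qed
  next
    let ?g = "\<lambda>r::real. f (of_real r * \<zeta>)"
    assume "\<exists>l. (?g \<longlongrightarrow> l) (at_left 1)"
    then obtain l where l: "(?g \<longlongrightarrow> l) (at_left 1)" ..
    show "C \<zeta>" unfolding C_def
    proof
      fix k :: nat
      define h where "h = 1 / real (2 * Suc k)"
      have h: "0 < h" "1 / real (Suc k) = h + h" by (simp_all add: h_def field_simps)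
      have "\<forall>\<^sub>F r in at_left 1. dist (?g r) l < h"
        by (rule tendstoD[OF l h(1)])
      then obtain b where b: "b < 1" "\<And>r. b < r \<Longrightarrow> r < 1 \<Longrightarrow> dist (?g r) l < h"
        unfolding eventually_at_left[OF zero_less_one] by auto
      obtain m where m: "1 / real (Suc m) < 1 - b"
        using reals_Archimedean[of "1 - b"] b(1) by (auto simp: inverse_eq_divide)
      have "dist (?g (radii i)) (?g (radii j)) \<le> 1 / Suc k"
        if "1 - 1 / Suc m \<le> radii i" "1 - 1 / Suc m \<le> radii j" for i j
      proof -
        have "b < radii i" "b < radii j" using m that by linarith+
        then have "dist (?g (radii i)) l < h" "dist (?g (radii j)) l < h"
          using b(2) radii_bounds by blast+
        then show ?thesis
          unfolding h using dist_triangle2[of "?g (radii i)" "?g (radii j)" l] by linarith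
      qed
      then show "\<exists>m. \<forall>i j. 1 - 1 / real (Suc m) \<le> radii i \<longrightarrow> 1 - 1 / real (Suc m) \<le> radii j \<longrightarrow>
          dist (?g (radii i)) (?g (radii j)) \<le> 1 / real (Suc k)"
        by blast
    qed
  qed
  \<comment> \<open>Borel measurability concerns the whole plane, although the measure sees only the
    circle. Where no radial limit exists, \<open>Lim\<close> is a definite description without a
    witness, so all such points share the one value \<open>THE l. False\<close>.\<close>
  have "boundary_fun f \<zeta> = (if cmod \<zeta> < 1 then f \<zeta> else if cmod \<zeta> > 1 then 0
      else if C \<zeta> then lim (\<lambda>n. f (of_real (inner_radius n) * \<zeta>)) else (THE l. False))" for \<zeta>
  proof -
    consider "cmod \<zeta> < 1" | "cmod \<zeta> > 1" | "cmod \<zeta> = 1" "C \<zeta>" | "cmod \<zeta> = 1" "\<not> C \<zeta>" by linarith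
    then show ?thesis
    proof cases
      case 1
      then have "isCont f \<zeta>" using H2_continuous[OF f] by (simp add: continuous_on_eq_continuous_at)
      moreover have "((\<lambda>r::real. of_real r * \<zeta>) \<longlongrightarrow> of_real 1 * \<zeta>) (at_left 1)" by (intro tendsto_intros)
      ultimately have "boundary_fun f \<zeta> = f \<zeta>"
        by (intro boundary_fun_eqI isCont_tendsto_compose[of \<zeta> f]) simp_all
      with 1 show ?thesis by simp
    next
      case 2
      have "\<forall>\<^sub>F r in at_left (1::real). f (of_real r * \<zeta>) = 0"
      proof (rule eventually_at_leftI[of "1 / cmod \<zeta>"])
        fix r :: real assume r: "r \<in> {1 / cmod \<zeta><..<1}"
        have "0 < 1 / cmod \<zeta>" using 2 by (intro divide_pos_pos) linarith+
        moreover have *: "1 / cmod \<zeta> < r" using r by simp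
        ultimately have "0 < r" by linarith
        moreover have "1 \<le> r * cmod \<zeta>" using * 2 pos_divide_less_eq[of "cmod \<zeta>" 1 r] by linarith
        ultimately show "f (of_real r * \<zeta>) = 0" by (intro H2_outside[OF f]) (simp add: norm_mult)
      qed (use 2 pos_divide_less_eq[of "cmod \<zeta>" 1 1] in linarith)
      then have "boundary_fun f \<zeta> = 0" by (intro boundary_fun_eqI tendsto_eventually)
      with 2 show ?thesis by simp
    next
      case 3
      then obtain l where l: "((\<lambda>r. f (of_real r * \<zeta>)) \<longlongrightarrow> l) (at_left (1::real))" using C_iff by blast
      from filterlim_compose[OF this inner_radius(4)] have "(\<lambda>n. f (of_real (inner_radius n) * \<zeta>)) \<longlonglongrightarrow> l" .
      with l 3 show ?thesis by (simp add: limI boundary_fun_eqI)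
    next
      case 4
      then have "(\<lambda>l. ((\<lambda>r. f (of_real r * \<zeta>)) \<longlongrightarrow> l) (at_left (1::real))) = (\<lambda>l. False)"
        using C_iff by blast
      with 4 show ?thesis by (simp add: boundary_fun_def t2_space_class.Lim_def)
    qed
  qed
  moreover have "(\<lambda>\<zeta>. if cmod \<zeta> < 1 then f \<zeta> else if cmod \<zeta> > 1 then 0
      else if C \<zeta> then lim (\<lambda>n. f (of_real (inner_radius n) * \<zeta>)) else (THE l. False)) \<in> borel_measurable borel"
    unfolding C_def by measurable
  ultimately show ?thesis by presburger
qed

text \<open>The maximal function is integrable after squaring and dominates all radii at once.
  \<open>enn2real\<close> turns it into a real function at the almost all points where it is
  finite.\<close>

lemma H2_dominated:
  assumes f: "f \<in> H2"
  obtains W :: "complex \<Rightarrow> real" where "integrable arc_measure W" 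
    "AE \<zeta> in arc_measure. \<forall>r. 0 \<le> r \<longrightarrow> r < 1 \<longrightarrow> (cmod (f (of_real r * \<zeta>)))\<^sup>2 \<le> W \<zeta>"
proof -
  note [measurable] = H2_measurable[OF f]
  obtain a where a: "\<And>z. cmod z < 1 \<Longrightarrow> (\<lambda>k. a k * z ^ k) sums f z" "summable (\<lambda>k. (cmod (a k))\<^sup>2)"
    using H2_series[OF f] by blast
  define W where "W \<zeta> = enn2real (radial_sup f \<zeta>)" for \<zeta>
  have fin: "(\<integral>\<^sup>+\<zeta>. radial_sup f \<zeta> \<partial>arc_measure) < \<infinity>"
  proof -
    have "(\<integral>\<^sup>+\<zeta>. radial_sup f \<zeta> \<partial>arc_measure) \<le> ennreal (256 * (\<Sum>k. (cmod (a k))\<^sup>2))"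
      by (intro nn_integral_radial_sup H2_holomorphic f disk_norm_le a) auto
    also have "\<dots> < \<infinity>" by simp
    finally show ?thesis .
  qed
  then have AE: "AE \<zeta> in arc_measure. radial_sup f \<zeta> \<noteq> \<infinity>"
    by (intro nn_integral_PInf_AE) auto
  show ?thesis
  proof (rule that)
    show "integrable arc_measure W"
    proof (rule integrableI_bounded)
      have "(\<integral>\<^sup>+\<zeta>. ennreal (norm (W \<zeta>)) \<partial>arc_measure) \<le> (\<integral>\<^sup>+\<zeta>. radial_sup f \<zeta> \<partial>arc_measure)"
        unfolding W_def by (intro nn_integral_mono) (simp add: ennreal_enn2real_if)
      with fin show "(\<integral>\<^sup>+\<zeta>. ennreal (norm (W \<zeta>)) \<partial>arc_measure) < \<infinity>" by simp
      show "W \<in> borel_measurable arc_measure" unfolding W_def by measurable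
    qed
    from AE AE_arc_circle
    show "AE \<zeta> in arc_measure. \<forall>r. 0 \<le> r \<longrightarrow> r < 1 \<longrightarrow> (cmod (f (of_real r * \<zeta>)))\<^sup>2 \<le> W \<zeta>"
    proof eventually_elim
      fix \<zeta> assume fin: "radial_sup f \<zeta> \<noteq> \<infinity>" and \<zeta>: "cmod \<zeta> = 1"
      show "\<forall>r. 0 \<le> r \<longrightarrow> r < 1 \<longrightarrow> (cmod (f (of_real r * \<zeta>)))\<^sup>2 \<le> W \<zeta>"
      proof (intro allI impI)
        fix r :: real assume "0 \<le> r" "r < 1"
        from radial_sup_ge[OF H2_continuous[OF f] this \<zeta>]
        have "enn2real (ennreal ((cmod (f (of_real r * \<zeta>)))\<^sup>2)) \<le> enn2real (radial_sup f \<zeta>)"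
          by (rule enn2real_mono) (use fin in \<open>simp add: less_top\<close>)
        then show "(cmod (f (of_real r * \<zeta>)))\<^sup>2 \<le> W \<zeta>" by (simp add: W_def)
      qed
    qed
  qed
qed

text \<open>Dominated convergence along the radii, with majorant \<open>W + V\<close> because a
  product of moduli is at most the sum of their squares. The limit formula is the bridge from
  boundary values to Taylor coefficients.\<close>

lemma
  assumes f: "f \<in> H2" and g: "g \<in> H2"
  shows boundary_product_integrable:
      "integrable arc_measure (\<lambda>\<zeta>. boundary_fun f \<zeta> * cnj (boundary_fun g \<zeta>))"
    and H2_inner_LIMSEQ:
      "(\<lambda>n. LINT \<zeta>|arc_measure. f (of_real (inner_radius n) * \<zeta>) * cnj (g (of_real (inner_radius n) * \<zeta>)))
        \<longlonglongrightarrow> H2_inner f g"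
proof -
  note [measurable] = H2_measurable[OF f] H2_measurable[OF g] boundary_fun_measurable[OF f] boundary_fun_measurable[OF g]
  obtain W where W: "integrable arc_measure W"
    "AE \<zeta> in arc_measure. \<forall>r. 0 \<le> r \<longrightarrow> r < 1 \<longrightarrow> (cmod (f (of_real r * \<zeta>)))\<^sup>2 \<le> W \<zeta>"
    using H2_dominated[OF f] by blast
  obtain V where V: "integrable arc_measure V"
    "AE \<zeta> in arc_measure. \<forall>r. 0 \<le> r \<longrightarrow> r < 1 \<longrightarrow> (cmod (g (of_real r * \<zeta>)))\<^sup>2 \<le> V \<zeta>"
    using H2_dominated[OF g] by blast
  let ?r = inner_radius
  have lim: "AE \<zeta> in arc_measure. (\<lambda>n. f (of_real (?r n) * \<zeta>) * cnj (g (of_real (?r n) * \<zeta>)))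
    \<longlonglongrightarrow> boundary_fun f \<zeta> * cnj (boundary_fun g \<zeta>)"
    using boundary_fun_tendsto[OF f] boundary_fun_tendsto[OF g]
    by eventually_elim (intro tendsto_intros; erule filterlim_compose[OF _ inner_radius(4)])
  have bound: "AE \<zeta> in arc_measure. norm (f (of_real (?r n) * \<zeta>) * cnj (g (of_real (?r n) * \<zeta>))) \<le> W \<zeta> + V \<zeta>" for n
    using W(2) V(2)
  proof eventually_elim
    fix \<zeta>
    assume "\<forall>r. 0 \<le> r \<longrightarrow> r < 1 \<longrightarrow> (cmod (f (of_real r * \<zeta>)))\<^sup>2 \<le> W \<zeta>"
      "\<forall>r. 0 \<le> r \<longrightarrow> r < 1 \<longrightarrow> (cmod (g (of_real r * \<zeta>)))\<^sup>2 \<le> V \<zeta>"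
    then have le: "(cmod (f (of_real (?r n) * \<zeta>)))\<^sup>2 \<le> W \<zeta>" "(cmod (g (of_real (?r n) * \<zeta>)))\<^sup>2 \<le> V \<zeta>"
      using inner_radius by auto
    have "norm (f (of_real (?r n) * \<zeta>) * cnj (g (of_real (?r n) * \<zeta>))) \<le>
      (cmod (f (of_real (?r n) * \<zeta>)))\<^sup>2 + (cmod (g (of_real (?r n) * \<zeta>)))\<^sup>2"
    proof -
      have "x * y \<le> x\<^sup>2 + y\<^sup>2" if "0 \<le> x" "0 \<le> y" for x y :: real
        using sum_squares_bound[of x y] mult_nonneg_nonneg[OF that] by linarith
      then show ?thesis by (simp add: norm_mult)
    qed
    with le show "norm (f (of_real (?r n) * \<zeta>) * cnj (g (of_real (?r n) * \<zeta>))) \<le> W \<zeta> + V \<zeta>" by linarith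
  qed
  have WV: "integrable arc_measure (\<lambda>\<zeta>. W \<zeta> + V \<zeta>)" using W V by simp
  show "integrable arc_measure (\<lambda>\<zeta>. boundary_fun f \<zeta> * cnj (boundary_fun g \<zeta>))"
    by (rule integrable_dominated_convergence[OF _ _ WV lim bound]) auto
  show "(\<lambda>n. LINT \<zeta>|arc_measure. f (of_real (?r n) * \<zeta>) * cnj (g (of_real (?r n) * \<zeta>))) \<longlonglongrightarrow> H2_inner f g"
    unfolding H2_inner_def L2_inner_def
    by (rule integral_dominated_convergence[OF _ _ WV lim bound]) auto
qed

section \<open>The Hardy space as an inner product space\<close>

lemma H2I:
  assumes "f holomorphic_on ball 0 1" "\<And>z. 1 \<le> cmod z \<Longrightarrow> f z = 0"
    "\<And>r. 0 \<le> r \<Longrightarrow> r < 1 \<Longrightarrow> (LINT \<zeta>|arc_measure. (cmod (f (of_real r * \<zeta>)))\<^sup>2) \<le> B"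
  shows "f \<in> H2"
  using assms by (auto simp: H2_def intro!: bdd_aboveI[of _ B])

lemma circle_square_integrable:
  assumes f: "f holomorphic_on ball 0 1" "f \<in> borel_measurable borel" and r: "0 \<le> r" "r < 1"
  shows "integrable arc_measure (\<lambda>\<zeta>. (cmod (f (of_real r * \<zeta>)))\<^sup>2)"
proof -
  note [measurable] = f(2)
  obtain B where "\<And>s \<zeta>. 0 \<le> s \<Longrightarrow> s \<le> r \<Longrightarrow> cmod \<zeta> = 1 \<Longrightarrow> cmod (f (of_real s * \<zeta>)) \<le> B"
    using circle_bounded[OF f(1) r(2)] by blast
  then show ?thesis
    by (intro integrable_arc_bounded[where B = "B\<^sup>2"]) (use r in \<open>auto intro!: power_mono\<close>)
qed

text \<open>A membership test that covers linear combinations, bounded multiples and the removal of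
  zeros, where near the zero one compares with a constant and away from it with the given
  function.\<close>

lemma H2_dominatedI:
  assumes f: "f holomorphic_on ball 0 1" "\<And>z. 1 \<le> cmod z \<Longrightarrow> f z = 0"
    and g: "g \<in> H2" and h: "h \<in> H2"
    and le: "\<And>z. cmod z < 1 \<Longrightarrow> (cmod (f z))\<^sup>2 \<le> C * (cmod (g z))\<^sup>2 + D * (cmod (h z))\<^sup>2" and CD: "0 \<le> C" "0 \<le> D"
  shows "f \<in> H2"
proof -
  have m: "f \<in> borel_measurable borel" by (rule borel_measurable_zero_outside) (use f in auto)
  obtain Bg where Bg: "\<And>r. 0 \<le> r \<Longrightarrow> r < 1 \<Longrightarrow> (LINT \<zeta>|arc_measure. (cmod (g (of_real r * \<zeta>)))\<^sup>2) \<le> Bg"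
    by (rule H2E_bound[OF g]) (rule that)
  obtain Bh where Bh: "\<And>r. 0 \<le> r \<Longrightarrow> r < 1 \<Longrightarrow> (LINT \<zeta>|arc_measure. (cmod (h (of_real r * \<zeta>)))\<^sup>2) \<le> Bh"
    by (rule H2E_bound[OF h]) (rule that)
  show ?thesis
  proof (rule H2I[OF f])
    fix r :: real assume r: "0 \<le> r" "r < 1"
    note i = circle_square_integrable[OF H2_holomorphic H2_measurable r]
    have "(LINT \<zeta>|arc_measure. (cmod (f (of_real r * \<zeta>)))\<^sup>2) \<le>
      (LINT \<zeta>|arc_measure. C * (cmod (g (of_real r * \<zeta>)))\<^sup>2 + D * (cmod (h (of_real r * \<zeta>)))\<^sup>2)"
      using i[OF g g] i[OF h h]
      by (intro integral_mono_AE circle_square_integrable f(1) m r AE_arcI le) (use r in \<open>auto simp: norm_mult\<close>)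
    also have "\<dots> = C * (LINT \<zeta>|arc_measure. (cmod (g (of_real r * \<zeta>)))\<^sup>2) + D * (LINT \<zeta>|arc_measure. (cmod (h (of_real r * \<zeta>)))\<^sup>2)"
      using i[OF g g] i[OF h h] by simp
    also have "\<dots> \<le> C * Bg + D * Bh"
      using Bg[OF r] Bh[OF r] CD by (intro add_mono mult_left_mono)
    finally show "(LINT \<zeta>|arc_measure. (cmod (f (of_real r * \<zeta>)))\<^sup>2) \<le> C * Bg + D * Bh" .
  qed
qed

lemma H2_lincomb:
  assumes f: "f \<in> H2" and g: "g \<in> H2"
  shows "(\<lambda>z. a * f z + b * g z) \<in> H2"
proof (rule H2_dominatedI[OF _ _ f g])
  fix z
  let ?x = "cmod (a * f z)" and ?y = "cmod (b * g z)"
  have "(cmod (a * f z + b * g z))\<^sup>2 \<le> (?x + ?y)\<^sup>2"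
    by (intro power_mono norm_triangle_ineq) simp
  also have "\<dots> \<le> 2 * ?x\<^sup>2 + 2 * ?y\<^sup>2"
    using sum_squares_bound[of ?x ?y] by (simp only: power2_sum)
  finally show "(cmod (a * f z + b * g z))\<^sup>2 \<le> (2 * (cmod a)\<^sup>2) * (cmod (f z))\<^sup>2 + (2 * (cmod b)\<^sup>2) * (cmod (g z))\<^sup>2"
    by (simp add: norm_mult power_mult_distrib)
next
  show "(\<lambda>z. a * f z + b * g z) holomorphic_on ball 0 1"
    by (intro holomorphic_intros H2_holomorphic f g)
qed (simp_all add: H2_outside[OF f] H2_outside[OF g])

lemma H2_zero: "(\<lambda>z. 0) \<in> H2"
  by (rule H2I[where B = 0]) auto

lemma H2_scale: "f \<in> H2 \<Longrightarrow> (\<lambda>z. a * f z) \<in> H2"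
  using H2_lincomb[of f f a 0] by simp

lemma H2_diff: "f \<in> H2 \<Longrightarrow> g \<in> H2 \<Longrightarrow> (\<lambda>z. f z - g z) \<in> H2"
  using H2_lincomb[of f g 1 "- 1"] by simp

lemma H2_sum:
  "finite I \<Longrightarrow> (\<And>i. i \<in> I \<Longrightarrow> f i \<in> H2) \<Longrightarrow> (\<lambda>z. \<Sum>i\<in>I. a i * f i z) \<in> H2"
proof (induction I rule: finite_induct)
  case (insert i I)
  then show ?case using H2_lincomb[of "f i" "\<lambda>z. \<Sum>i\<in>I. a i * f i z" "a i" 1] by simp
qed (simp add: H2_zero)

lemma H2_mult_Hinf:
  assumes \<phi>: "\<phi> \<in> Hinf" and f: "f \<in> H2"
  shows "(\<lambda>z. \<phi> z * f z) \<in> H2"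
proof -
  obtain B where "\<forall>z\<in>ball 0 1. cmod (\<phi> z) \<le> B"
    using \<phi> by (auto simp: Hinf_def bounded_iff)
  then have B: "cmod (\<phi> z) \<le> B" if "cmod z < 1" for z using that by simp
  have hol: "\<phi> holomorphic_on ball 0 1" using \<phi> by (simp add: Hinf_def)
  show ?thesis
  proof (rule H2_dominatedI[OF _ _ f f, where C = "B\<^sup>2" and D = 0])
    fix z :: complex assume "cmod z < 1"
    then have "(cmod (\<phi> z))\<^sup>2 \<le> B\<^sup>2" using B by (intro power_mono) auto
    then show "(cmod (\<phi> z * f z))\<^sup>2 \<le> B\<^sup>2 * (cmod (f z))\<^sup>2 + 0 * (cmod (f z))\<^sup>2"
      by (simp add: norm_mult power_mult_distrib mult_right_mono)
  next
    show "(\<lambda>z. \<phi> z * f z) holomorphic_on ball 0 1"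
      by (intro holomorphic_intros hol H2_holomorphic f)
  qed (simp_all add: H2_outside[OF f])
qed

text \<open>The constant 1 as an element of \<open>H2\<close>, whose members vanish outside the
  disk. Multiplication by it also cuts off a bounded analytic function, whose values outside the
  disk are arbitrary.\<close>

definition disk_one :: "complex \<Rightarrow> complex" where
  "disk_one z = (if cmod z < 1 then 1 else 0)"

lemma disk_one_H2: "disk_one \<in> H2"
proof (rule H2I[where B = 1])
  show "disk_one holomorphic_on ball 0 1"
    by (rule holomorphic_transform[where f = "\<lambda>_. 1"]) (auto simp: disk_one_def)
  have m [measurable]: "disk_one \<in> borel_measurable borel" unfolding disk_one_def by measurable
  fix r :: real assume r: "0 \<le> r" "r < 1"
  have "(LINT \<zeta>|arc_measure. (cmod (disk_one (of_real r * \<zeta>)))\<^sup>2) = (LINT \<zeta>|arc_measure. 1)"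
    by (intro integral_cong_AE AE_arcI) (use r in \<open>auto simp: disk_one_def norm_mult\<close>)
  then show "(LINT \<zeta>|arc_measure. (cmod (disk_one (of_real r * \<zeta>)))\<^sup>2) \<le> 1" by simp
qed (auto simp: disk_one_def)

lemma H2_divide:
  assumes f: "f \<in> H2" and \<alpha>: "cmod \<alpha> < 1" "f \<alpha> = 0"
  obtains g where "g \<in> H2" "\<And>z. f z = (z - \<alpha>) * g z"
proof -
  define g where "g z = (if z = \<alpha> then deriv f \<alpha> else (f z - f \<alpha>) / (z - \<alpha>))" for z
  have hol: "g holomorphic_on ball 0 1"
    unfolding g_def by (rule pole_lemma[OF H2_holomorphic[OF f]]) (use \<alpha> in \<open>simp add: interior_open\<close>)
  have eq: "f z = (z - \<alpha>) * g z" for z using \<alpha> by (simp add: g_def)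
  \<comment> \<open>Half the distance of \<open>\<alpha>\<close> to the circle. For \<open>z\<close>
    of modulus above \<open>1 - \<delta>\<close> the divisor is at least \<open>\<delta>\<close>; on
    the remaining compact disk the quotient is bounded by continuity.\<close>
  define \<delta> where "\<delta> = (1 - cmod \<alpha>) / 2"
  have \<delta>: "\<delta> > 0" "1 - \<delta> < 1" "cmod \<alpha> + \<delta> = 1 - \<delta>" using \<alpha> by (auto simp: \<delta>_def field_simps)
  obtain B where B: "\<And>r \<zeta>. 0 \<le> r \<Longrightarrow> r \<le> 1 - \<delta> \<Longrightarrow> cmod \<zeta> = 1 \<Longrightarrow> cmod (g (of_real r * \<zeta>)) \<le> B"
    by (rule circle_bounded[OF hol \<delta>(2)]) (rule that)
  have "g \<in> H2"
  proof (rule H2_dominatedI[OF hol _ disk_one_H2 f, where C = "B\<^sup>2" and D = "1 / \<delta>\<^sup>2"])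
    fix z :: complex assume z: "1 \<le> cmod z"
    then show "g z = 0" using \<alpha> H2_outside[OF f z] by (auto simp: g_def)
  next
    fix z :: complex assume z: "cmod z < 1"
    show "(cmod (g z))\<^sup>2 \<le> B\<^sup>2 * (cmod (disk_one z))\<^sup>2 + 1 / \<delta>\<^sup>2 * (cmod (f z))\<^sup>2"
    proof (cases "cmod z \<le> 1 - \<delta>")
      case True
      have "cmod (g z) \<le> B"
      proof (cases "z = 0")
        case True
        then show ?thesis using B[of 0 1] \<delta> norm_ge_zero[of \<alpha>] by simp
      next
        case False
        then show ?thesis using B[of "cmod z" "z / of_real (cmod z)"] True
          by (simp add: norm_divide)
      qed
      then have "(cmod (g z))\<^sup>2 \<le> B\<^sup>2" by (intro power_mono) auto
      moreover have "0 \<le> 1 / \<delta>\<^sup>2 * (cmod (f z))\<^sup>2" by simp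
      ultimately show ?thesis using z by (auto simp: disk_one_def intro: add_increasing2)
    next
      case False
      then have "\<delta> \<le> cmod (z - \<alpha>)" using norm_triangle_ineq2[of z \<alpha>] \<delta> by linarith
      then have "\<delta>\<^sup>2 * (cmod (g z))\<^sup>2 \<le> (cmod (z - \<alpha>))\<^sup>2 * (cmod (g z))\<^sup>2"
        using \<delta> by (intro mult_right_mono power_mono) auto
      then have "\<delta>\<^sup>2 * (cmod (g z))\<^sup>2 \<le> (cmod (f z))\<^sup>2"
        unfolding eq by (simp add: norm_mult power_mult_distrib)
      then have "(cmod (g z))\<^sup>2 \<le> 1 / \<delta>\<^sup>2 * (cmod (f z))\<^sup>2"
        using \<delta> by (simp add: field_simps)
      then show ?thesis by (simp add: add_increasing)
    qed
  qed (use \<delta> in auto)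
  then show ?thesis using eq by (rule that)
qed

lemma boundary_fun_lincomb:
  assumes f: "f \<in> H2" and g: "g \<in> H2"
  shows "AE \<zeta> in arc_measure. boundary_fun (\<lambda>z. a * f z + b * g z) \<zeta> = a * boundary_fun f \<zeta> + b * boundary_fun g \<zeta>"
  using boundary_fun_tendsto[OF f] boundary_fun_tendsto[OF g]
  by eventually_elim (intro boundary_fun_eqI tendsto_intros)

lemma H2_inner_lincomb_left:
  assumes f: "f \<in> H2" and g: "g \<in> H2" and h: "h \<in> H2"
  shows "H2_inner (\<lambda>z. a * f z + b * g z) h = a * H2_inner f h + b * H2_inner g h"
proof -
  note [measurable] = boundary_fun_measurable[OF f] boundary_fun_measurable[OF g]
    boundary_fun_measurable[OF h] boundary_fun_measurable[OF H2_lincomb[OF f g]]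
  have "H2_inner (\<lambda>z. a * f z + b * g z) h =
    (LINT \<zeta>|arc_measure. a * (boundary_fun f \<zeta> * cnj (boundary_fun h \<zeta>)) + b * (boundary_fun g \<zeta> * cnj (boundary_fun h \<zeta>)))"
    unfolding H2_inner_def L2_inner_def
    by (rule integral_cong_AE) (use boundary_fun_lincomb[OF f g, of a b] in \<open>auto simp: algebra_simps\<close>)
  also have "\<dots> = a * H2_inner f h + b * H2_inner g h"
    using boundary_product_integrable[OF f h] boundary_product_integrable[OF g h]
    by (simp add: H2_inner_def L2_inner_def)
  finally show ?thesis .
qed

lemma H2_inner_commute: "cnj (H2_inner f g) = H2_inner g f"
  unfolding H2_inner_def L2_inner_def by (subst Bochner_Integration.integral_cnj[symmetric]) (simp add: mult.commute)

lemma H2_inner_lincomb_right: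
  assumes "f \<in> H2" "g \<in> H2" "h \<in> H2"
  shows "H2_inner h (\<lambda>z. a * f z + b * g z) = cnj a * H2_inner h f + cnj b * H2_inner h g"
  using arg_cong[OF H2_inner_lincomb_left[OF assms, of a b], of cnj] by (simp add: H2_inner_commute)

text \<open>The constant is the reproducing kernel at 0: only the zeroth coefficient survives, and
  it does so on every circle.\<close>

lemma H2_inner_one:
  assumes f: "f \<in> H2"
  shows "H2_inner f disk_one = f 0"
proof -
  obtain a where a: "\<And>z. cmod z < 1 \<Longrightarrow> (\<lambda>k. a k * z ^ k) sums f z" "summable (\<lambda>k. (cmod (a k))\<^sup>2)"
    by (rule H2_series[OF f]) (rule that)
  define b where "b k = (if k \<in> {0::nat} then 1 else 0 :: complex)" for k
  have b: "(\<lambda>k. b k * z ^ k) sums disk_one z" if "cmod z < 1" for z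
  proof -
    have "(\<lambda>k. b k * z ^ k) = (\<lambda>k. if k \<in> {0} then z ^ k else 0)" by (auto simp: b_def)
    then show ?thesis
      using sums_If_finite_set[of "{0::nat}" "\<lambda>k. z ^ k"] that by (simp only: disk_one_def) simp
  qed
  have "(LINT \<zeta>|arc_measure. f (of_real r * \<zeta>) * cnj (disk_one (of_real r * \<zeta>))) = f 0" if "0 \<le> r" "r < 1" for r
  proof -
    have "(\<lambda>k. a k * cnj (b k) * of_real r ^ (2 * k)) sums (LINT \<zeta>|arc_measure. f (of_real r * \<zeta>) * cnj (disk_one (of_real r * \<zeta>)))"
      by (rule disk_parseval[OF a(1) b H2_measurable[OF f] H2_measurable[OF disk_one_H2] that])
    moreover have "(\<lambda>k. a k * cnj (b k) * of_real r ^ (2 * k)) = (\<lambda>k. if k \<in> {0} then a k else 0)"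
      by (auto simp: b_def)
    ultimately have "(\<lambda>k. if k \<in> {0} then a k else 0) sums (LINT \<zeta>|arc_measure. f (of_real r * \<zeta>) * cnj (disk_one (of_real r * \<zeta>)))"
      by simp
    moreover have "(\<lambda>k. if k \<in> {0} then a k else 0) sums (\<Sum>k\<in>{0}. a k)" by (rule sums_If_finite_set) simp
    moreover have "a 0 = f 0" using a(1)[of 0] sums_unique2[of "\<lambda>k. a k * 0 ^ k" "f 0" "a 0"] powser_sums_zero[of a] by simp
    ultimately show ?thesis by (auto dest: sums_unique2)
  qed
  then show ?thesis
    using H2_inner_LIMSEQ[OF f disk_one_H2] inner_radius by (simp add: LIMSEQ_const_iff)
qed

text \<open>Definiteness is read off from the Taylor coefficients: by Parseval on smaller circles,
  each \<open>(cmod (a k))\<^sup>2\<close> is at most the squared norm.\<close>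

lemma H2_inner_self:
  assumes f: "f \<in> H2"
  shows "0 \<le> Re (H2_inner f f)" "H2_inner f f = of_real (Re (H2_inner f f))" "H2_inner f f = 0 \<Longrightarrow> f = (\<lambda>_. 0)"
proof -
  have "cnj (H2_inner f f) = H2_inner f f" by (rule H2_inner_commute)
  then show eq: "H2_inner f f = of_real (Re (H2_inner f f))"
    by (metis Reals_cnj_iff of_real_Re)
  obtain a where a: "\<And>z. cmod z < 1 \<Longrightarrow> (\<lambda>k. a k * z ^ k) sums f z" "summable (\<lambda>k. (cmod (a k))\<^sup>2)"
    by (rule H2_series[OF f]) (rule that)
  let ?r = inner_radius
  have "(\<lambda>n. Re (LINT \<zeta>|arc_measure. f (of_real (?r n) * \<zeta>) * cnj (f (of_real (?r n) * \<zeta>)))) \<longlonglongrightarrow> Re (H2_inner f f)"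
    by (intro tendsto_intros H2_inner_LIMSEQ f)
  also have "(\<lambda>n. Re (LINT \<zeta>|arc_measure. f (of_real (?r n) * \<zeta>) * cnj (f (of_real (?r n) * \<zeta>)))) =
    (\<lambda>n. LINT \<zeta>|arc_measure. (cmod (f (of_real (?r n) * \<zeta>)))\<^sup>2)"
    unfolding complex_norm_square[symmetric] integral_complex_of_real by simp
  finally have lim: "(\<lambda>n. LINT \<zeta>|arc_measure. (cmod (f (of_real (?r n) * \<zeta>)))\<^sup>2) \<longlonglongrightarrow> Re (H2_inner f f)" .
  have le: "(cmod (a k))\<^sup>2 \<le> Re (H2_inner f f)" for k
  proof (rule LIMSEQ_le[OF _ lim])
    have "(\<lambda>n. (cmod (a k))\<^sup>2 * ?r n ^ (2 * k)) \<longlonglongrightarrow> (cmod (a k))\<^sup>2 * 1 ^ (2 * k)"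
      by (intro tendsto_intros inner_radius)
    then show "(\<lambda>n. (cmod (a k))\<^sup>2 * ?r n ^ (2 * k)) \<longlonglongrightarrow> (cmod (a k))\<^sup>2" by simp
    have "(cmod (a k))\<^sup>2 * ?r n ^ (2 * k) \<le> (LINT \<zeta>|arc_measure. (cmod (f (of_real (?r n) * \<zeta>)))\<^sup>2)" for n
    proof -
      have "(\<lambda>k. (cmod (a k))\<^sup>2 * ?r n ^ (2 * k)) sums (LINT \<zeta>|arc_measure. (cmod (f (of_real (?r n) * \<zeta>)))\<^sup>2)"
        by (rule disk_parseval_norm[OF a(1) H2_measurable[OF f] inner_radius(1,2)])
      moreover have "(\<lambda>j. if j \<in> {k} then (cmod (a j))\<^sup>2 * ?r n ^ (2 * j) else 0) sums (\<Sum>j\<in>{k}. (cmod (a j))\<^sup>2 * ?r n ^ (2 * j))"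
        by (rule sums_If_finite_set) simp
      ultimately have "(\<Sum>j\<in>{k}. (cmod (a j))\<^sup>2 * ?r n ^ (2 * j)) \<le> (LINT \<zeta>|arc_measure. (cmod (f (of_real (?r n) * \<zeta>)))\<^sup>2)"
        using inner_radius(1)[of n] by (elim sums_le[rotated]) auto
      then show ?thesis by simp
    qed
    then show "\<exists>N. \<forall>n\<ge>N. (cmod (a k))\<^sup>2 * ?r n ^ (2 * k) \<le> (LINT \<zeta>|arc_measure. (cmod (f (of_real (?r n) * \<zeta>)))\<^sup>2)"
      by blast
  qed
  show "0 \<le> Re (H2_inner f f)" using le[of 0] zero_le_power2[of "cmod (a 0)"] by linarith
  show "f = (\<lambda>_. 0)" if "H2_inner f f = 0"
  proof
    fix z
    have "a k = 0" for k using le[of k] that by simp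
    then have "f z = 0" if "cmod z < 1" using a(1)[OF that] by (simp add: sums_iff)
    then show "f z = 0" using H2_outside[OF f, of z] by linarith
  qed
qed

lemma H2_inner_mult_inner:
  assumes \<Theta>: "inner_function \<Theta>" and f: "f \<in> H2" and g: "g \<in> H2"
  shows "H2_inner (\<lambda>z. \<Theta> z * f z) (\<lambda>z. \<Theta> z * g z) = H2_inner f g"
proof -
  have Hinf: "\<Theta> \<in> Hinf" and unim: "AE \<zeta> in arc_measure. cmod (boundary_fun \<Theta> \<zeta>) = 1"
    using \<Theta> by (auto simp: inner_function_def)
  \<comment> \<open>The inner function may be nonzero off the disk and so need not belong to
    \<open>H2\<close>. Its radial limits are borrowed from its cut-off, which agrees with it along
    the radii.\<close>
  have lim: "AE \<zeta> in arc_measure. ((\<lambda>r. \<Theta> (of_real r * \<zeta>)) \<longlongrightarrow> boundary_fun \<Theta> \<zeta>) (at_left (1::real))"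
    using radial_limit_AE[OF H2_mult_Hinf[OF Hinf disk_one_H2]] AE_arc_circle
  proof eventually_elim
    case (elim \<zeta>)
    then obtain l where l: "((\<lambda>r. \<Theta> (of_real r * \<zeta>) * disk_one (of_real r * \<zeta>)) \<longlongrightarrow> l) (at_left (1::real))" by blast
    have "\<forall>\<^sub>F r in at_left (1::real). \<Theta> (of_real r * \<zeta>) * disk_one (of_real r * \<zeta>) = \<Theta> (of_real r * \<zeta>)"
      by (rule eventually_at_leftI[of 0]) (use elim in \<open>auto simp: disk_one_def norm_mult\<close>)
    from tendsto_cong[OF this] l have "((\<lambda>r. \<Theta> (of_real r * \<zeta>)) \<longlongrightarrow> l) (at_left (1::real))" by simp
    then show ?case using boundary_fun_eqI by metis
  qed
  have mult: "AE \<zeta> in arc_measure. boundary_fun (\<lambda>z. \<Theta> z * h z) \<zeta> = boundary_fun \<Theta> \<zeta> * boundary_fun h \<zeta>" if "h \<in> H2" for h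
    using lim boundary_fun_tendsto[OF that] by eventually_elim (intro boundary_fun_eqI tendsto_mult)
  note [measurable] = boundary_fun_measurable[OF f] boundary_fun_measurable[OF g]
    boundary_fun_measurable[OF H2_mult_Hinf[OF Hinf f]] boundary_fun_measurable[OF H2_mult_Hinf[OF Hinf g]]
  show ?thesis unfolding H2_inner_def L2_inner_def
  proof (rule integral_cong_AE)
    show "AE \<zeta> in arc_measure. boundary_fun (\<lambda>z. \<Theta> z * f z) \<zeta> * cnj (boundary_fun (\<lambda>z. \<Theta> z * g z) \<zeta>) =
      boundary_fun f \<zeta> * cnj (boundary_fun g \<zeta>)"
      using mult[OF f] mult[OF g] unim
    proof eventually_elim
      case (elim \<zeta>)
      have "boundary_fun \<Theta> \<zeta> * cnj (boundary_fun \<Theta> \<zeta>) = 1"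
        using elim(3) by (simp flip: complex_norm_square)
      then show ?case unfolding elim(1,2)
        by (metis (no_types) complex_cnj_mult mult.assoc mult.left_commute mult_1)
    qed
  qed measurable
qed

lemma inner_function_continuousI:
  assumes hol: "\<Theta> holomorphic_on ball 0 1" and cont: "continuous_on (cball 0 1) \<Theta>"
    and unim: "\<And>\<zeta>. cmod \<zeta> = 1 \<Longrightarrow> cmod (\<Theta> \<zeta>) = 1"
  shows "inner_function \<Theta>"
  unfolding inner_function_def Hinf_def mem_Collect_eq
proof (intro conjI hol AE_arcI)
  have "compact (\<Theta> ` cball 0 1)" by (rule compact_continuous_image[OF cont]) simp
  then show "bounded (\<Theta> ` ball 0 1)" by (rule bounded_subset[OF compact_imp_bounded]) auto
  fix \<zeta> :: complex assume \<zeta>: "cmod \<zeta> = 1"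
  have "((\<lambda>r::real. of_real r * \<zeta>) \<longlongrightarrow> of_real 1 * \<zeta>) (at_left 1)" by (intro tendsto_intros)
  then have "((\<lambda>r. \<Theta> (of_real r * \<zeta>)) \<longlongrightarrow> \<Theta> \<zeta>) (at_left (1::real))"
    by (intro continuous_on_tendsto_compose[OF cont] eventually_at_leftI[of 0]) (use \<zeta> in \<open>auto simp: norm_mult\<close>)
  then show "cmod (boundary_fun \<Theta> \<zeta>) = 1" using unim[OF \<zeta>] by (simp add: boundary_fun_eqI)
qed

section \<open>Model spaces\<close>

lemma Hinf_continuousI:
  assumes "\<phi> holomorphic_on ball 0 1" "continuous_on (cball 0 1) \<phi>"
  shows "\<phi> \<in> Hinf"
proof -
  have "compact (\<phi> ` cball 0 1)" by (rule compact_continuous_image[OF assms(2)]) simp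
  then have "bounded (\<phi> ` ball 0 1)" by (rule bounded_subset[OF compact_imp_bounded]) auto
  with assms show ?thesis by (simp add: Hinf_def)
qed

lemma inner_function_id: "inner_function (\<lambda>z. z)"
  by (rule inner_function_continuousI) (auto intro!: holomorphic_intros continuous_intros)

lemma inner_function_Hinf: "inner_function \<Theta> \<Longrightarrow> \<Theta> \<in> Hinf"
  by (simp add: inner_function_def)

lemma H2_shift: "f \<in> H2 \<Longrightarrow> (\<lambda>z. z * f z) \<in> H2"
  by (rule H2_mult_Hinf[OF inner_function_Hinf[OF inner_function_id]])

lemma H2_inner_diff_left:
  "f \<in> H2 \<Longrightarrow> g \<in> H2 \<Longrightarrow> h \<in> H2 \<Longrightarrow> H2_inner (\<lambda>z. f z - g z) h = H2_inner f h - H2_inner g h"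
  using H2_inner_lincomb_left[of f g h 1 "- 1"] by simp

lemma H2_inner_scale_left: "f \<in> H2 \<Longrightarrow> h \<in> H2 \<Longrightarrow> H2_inner (\<lambda>z. a * f z) h = a * H2_inner f h"
  using H2_inner_lincomb_left[of f f h a 0] by simp

lemma H2_inner_zero_left: "f \<in> H2 \<Longrightarrow> H2_inner (\<lambda>z. 0) f = 0"
  using H2_inner_scale_left[of f f 0] by simp

lemma H2_inner_sum_left:
  assumes h: "h \<in> H2"
  shows "finite I \<Longrightarrow> (\<And>i. i \<in> I \<Longrightarrow> f i \<in> H2) \<Longrightarrow>
    H2_inner (\<lambda>z. \<Sum>i\<in>I. a i * f i z) h = (\<Sum>i\<in>I. a i * H2_inner (f i) h)"
proof (induction I rule: finite_induct)
  case (insert i I)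
  then show ?case
    using H2_inner_lincomb_left[OF _ H2_sum h, of "f i" I f "a i" 1 a] by simp
qed (simp add: H2_inner_zero_left h)

lemma H2_inner_sum_right:
  assumes "h \<in> H2" "finite I" "\<And>i. i \<in> I \<Longrightarrow> f i \<in> H2"
  shows "H2_inner h (\<lambda>z. \<Sum>i\<in>I. a i * f i z) = (\<Sum>i\<in>I. cnj (a i) * H2_inner h (f i))"
proof -
  have "cnj (H2_inner (\<lambda>z. \<Sum>i\<in>I. a i * f i z) h) = cnj (\<Sum>i\<in>I. a i * H2_inner (f i) h)"
    by (subst H2_inner_sum_left[OF assms]) auto
  then show ?thesis by (simp add: H2_inner_commute)
qed

lemma H2_inner_disk_one_shift:
  "f \<in> H2 \<Longrightarrow> H2_inner disk_one (\<lambda>z. z * f z) = 0"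
  using H2_inner_one[OF H2_shift, of f] H2_inner_commute[of "\<lambda>z. z * f z" disk_one] by simp

lemma H2_backward_shift:
  assumes f: "f \<in> H2"
  obtains g where "g \<in> H2" "\<And>z. f z = f 0 * disk_one z + z * g z"
proof -
  have mem: "(\<lambda>z. f z - f 0 * disk_one z) \<in> H2"
    by (intro H2_diff H2_scale f disk_one_H2)
  obtain g where g: "g \<in> H2" "\<And>z. f z - f 0 * disk_one z = (z - 0) * g z"
    by (rule H2_divide[OF mem, of 0]) (simp, simp add: disk_one_def, rule that)
  have "f z = f 0 * disk_one z + z * g z" for z
    using g(2)[of z] by (simp add: diff_eq_eq add.commute)
  with g(1) show ?thesis by (rule that)
qed

text \<open>The backward shift is the adjoint of multiplication by \<open>z\<close>: constants are
  orthogonal to all multiples of \<open>z\<close>, and multiplication by \<open>z\<close> is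
  isometric.\<close>

lemma H2_inner_backward_shift:
  assumes g: "g \<in> H2" and h: "h \<in> H2" and f: "\<And>z. f z = c * disk_one z + z * g z"
  shows "H2_inner f (\<lambda>z. z * h z) = H2_inner g h"
proof -
  have "f = (\<lambda>z. c * disk_one z + 1 * (z * g z))" using f by auto
  then have "H2_inner f (\<lambda>z. z * h z) =
      c * H2_inner disk_one (\<lambda>z. z * h z) + 1 * H2_inner (\<lambda>z. z * g z) (\<lambda>z. z * h z)"
    by (simp only: H2_inner_lincomb_left[OF disk_one_H2 H2_shift[OF g] H2_shift[OF h]])
  then show ?thesis
    by (simp add: H2_inner_disk_one_shift h H2_inner_mult_inner[OF inner_function_id g h])
qed

lemma model_space_H2: "f \<in> model_space \<Theta> \<Longrightarrow> f \<in> H2"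
  by (simp add: model_space_def)

lemma model_space_orth: "f \<in> model_space \<Theta> \<Longrightarrow> g \<in> H2 \<Longrightarrow> H2_inner f (\<lambda>z. \<Theta> z * g z) = 0"
  by (simp add: model_space_def)

lemma model_space_orth': "f \<in> model_space \<Theta> \<Longrightarrow> g \<in> H2 \<Longrightarrow> H2_inner (\<lambda>z. \<Theta> z * g z) f = 0"
  using model_space_orth[of f \<Theta> g] H2_inner_commute[of f "\<lambda>z. \<Theta> z * g z"] by simp

lemma model_space_lincomb:
  assumes \<Theta>: "\<Theta> \<in> Hinf" and f: "f \<in> model_space \<Theta>" and g: "g \<in> model_space \<Theta>"
  shows "(\<lambda>z. a * f z + b * g z) \<in> model_space \<Theta>"
  unfolding model_space_def mem_Collect_eq
  using H2_inner_lincomb_left[OF model_space_H2[OF f] model_space_H2[OF g] H2_mult_Hinf[OF \<Theta>]]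
  by (auto simp: H2_lincomb model_space_H2[OF f] model_space_H2[OF g] model_space_orth[OF f] model_space_orth[OF g])

lemma model_space_diff:
  "\<Theta> \<in> Hinf \<Longrightarrow> f \<in> model_space \<Theta> \<Longrightarrow> g \<in> model_space \<Theta> \<Longrightarrow> (\<lambda>z. f z - g z) \<in> model_space \<Theta>"
  using model_space_lincomb[of \<Theta> f g 1 "- 1"] by simp

lemma model_space_sum:
  assumes \<Theta>: "\<Theta> \<in> Hinf"
  shows "finite I \<Longrightarrow> (\<And>i. i \<in> I \<Longrightarrow> f i \<in> model_space \<Theta>) \<Longrightarrow> (\<lambda>z. \<Sum>i\<in>I. a i * f i z) \<in> model_space \<Theta>"
proof (induction I rule: finite_induct)
  case empty
  then show ?case by (auto simp: model_space_def H2_zero H2_inner_zero_left H2_mult_Hinf[OF \<Theta>])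
next
  case (insert i I)
  then show ?case using model_space_lincomb[OF \<Theta>, of "f i" "\<lambda>z. \<Sum>i\<in>I. a i * f i z" "a i" 1] by simp
qed

text \<open>The space of multiples of \<open>\<Theta>\<close> is invariant under multiplication by
  \<open>z\<close>, so its orthogonal complement is invariant under the adjoint.\<close>

lemma model_space_backward_shift:
  assumes \<Theta>: "\<Theta> \<in> Hinf" and f: "f \<in> model_space \<Theta>"
  obtains g where "g \<in> model_space \<Theta>" "\<And>z. f z = f 0 * disk_one z + z * g z"
proof -
  obtain g where g: "g \<in> H2" and eq: "\<And>z. f z = f 0 * disk_one z + z * g z"
    by (rule H2_backward_shift[OF model_space_H2[OF f]]) (rule that)
  have "H2_inner g (\<lambda>z. \<Theta> z * h z) = 0" if h: "h \<in> H2" for h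
  proof -
    have "H2_inner g (\<lambda>z. \<Theta> z * h z) = H2_inner f (\<lambda>z. z * (\<Theta> z * h z))"
      by (rule H2_inner_backward_shift[symmetric, OF g H2_mult_Hinf[OF \<Theta> h] eq])
    also have "\<dots> = H2_inner f (\<lambda>z. \<Theta> z * (z * h z))" by (simp add: mult.left_commute)
    also have "\<dots> = 0" by (rule model_space_orth[OF f H2_shift[OF h]])
    finally show ?thesis .
  qed
  with g have "g \<in> model_space \<Theta>" by (simp add: model_space_def)
  then show ?thesis using eq by (rule that)
qed

text \<open>This is the truncated Toeplitz operator with symbol \<open>z\<close>, given without
  \<open>model_proj\<close>: for \<open>f\<close> in the model space, \<open>z f\<close> leaves that
  space only in the direction of the unit vector \<open>\<Theta>\<close>, whose component is
  subtracted.\<close>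

definition compressed_shift :: "(complex \<Rightarrow> complex) \<Rightarrow> (complex \<Rightarrow> complex) \<Rightarrow> complex \<Rightarrow> complex" where
  "compressed_shift \<Theta> f =
    (\<lambda>z. z * f z - H2_inner (\<lambda>z. z * f z) (\<lambda>z. \<Theta> z * disk_one z) * (\<Theta> z * disk_one z))"

text \<open>Writing a test function as \<open>h 0 + z h'\<close>, the part with \<open>h'\<close> is
  orthogonal to \<open>z f\<close> by the isometry of \<open>z\<close> and the orthogonality of
  \<open>f\<close>. The constant part is what the correction term removes.\<close>

lemma compressed_shift_model_space:
  assumes \<Theta>: "inner_function \<Theta>" and f: "f \<in> model_space \<Theta>"
  shows "compressed_shift \<Theta> f \<in> model_space \<Theta>"
proof -
  note \<Theta>' = inner_function_Hinf[OF \<Theta>]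
  note fH = model_space_H2[OF f]
  let ?c = "H2_inner (\<lambda>z. z * f z) (\<lambda>z. \<Theta> z * disk_one z)"
  have mem: "(\<lambda>z. \<Theta> z * disk_one z) \<in> H2" by (rule H2_mult_Hinf[OF \<Theta>' disk_one_H2])
  have "H2_inner (compressed_shift \<Theta> f) (\<lambda>z. \<Theta> z * h z) = 0" if h: "h \<in> H2" for h
  proof -
    obtain h' where h': "h' \<in> H2" and eq: "\<And>z. h z = h 0 * disk_one z + z * h' z"
      by (rule H2_backward_shift[OF h]) (rule that)
    have eq': "\<Theta> z * h z = h 0 * (\<Theta> z * disk_one z) + 1 * (z * (\<Theta> z * h' z))" for z
      by (subst eq) (simp add: algebra_simps)
    have "H2_inner (\<lambda>z. z * f z) (\<lambda>z. \<Theta> z * h z) =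
      cnj (h 0) * ?c + cnj 1 * H2_inner (\<lambda>z. z * f z) (\<lambda>z. z * (\<Theta> z * h' z))"
      unfolding eq' by (rule H2_inner_lincomb_right[OF mem H2_shift[OF H2_mult_Hinf[OF \<Theta>' h']] H2_shift[OF fH]])
    also have "H2_inner (\<lambda>z. z * f z) (\<lambda>z. z * (\<Theta> z * h' z)) = 0"
      using H2_inner_mult_inner[OF inner_function_id fH H2_mult_Hinf[OF \<Theta>' h']] model_space_orth[OF f h'] by simp
    finally have 1: "H2_inner (\<lambda>z. z * f z) (\<lambda>z. \<Theta> z * h z) = cnj (h 0) * ?c" by simp
    have 2: "H2_inner (\<lambda>z. \<Theta> z * disk_one z) (\<lambda>z. \<Theta> z * h z) = cnj (h 0)"
      using H2_inner_mult_inner[OF \<Theta> disk_one_H2 h] H2_inner_one[OF h] H2_inner_commute[of h disk_one] by simp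
    show ?thesis unfolding compressed_shift_def
      using H2_inner_diff_left[OF H2_shift[OF fH] H2_scale[OF mem] H2_mult_Hinf[OF \<Theta>' h]]
        H2_inner_scale_left[OF mem H2_mult_Hinf[OF \<Theta>' h]]
      by (simp add: 1 2)
  qed
  moreover have "compressed_shift \<Theta> f \<in> H2" unfolding compressed_shift_def
    by (intro H2_diff H2_shift H2_scale mem fH)
  ultimately show ?thesis by (simp add: model_space_def)
qed

text \<open>Both sides of \<open>\<langle>z f, z g\<rangle> = \<langle>f, g\<rangle>\<close> are expanded along \<open>K \<oplus> \<complex> \<Theta>\<close>.\<close>

lemma model_space_eigenvector_inner:
  assumes \<Theta>: "inner_function \<Theta>" and f: "f \<in> model_space \<Theta>" and g: "g \<in> model_space \<Theta>"
    and zf: "\<And>z. z * f z = \<alpha> * f z + c * (\<Theta> z * disk_one z)"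
    and zg: "\<And>z. z * g z = \<beta> * g z + d * (\<Theta> z * disk_one z)"
  shows "H2_inner f g * (1 - \<alpha> * cnj \<beta>) = c * cnj d"
proof -
  note \<Theta>' = inner_function_Hinf[OF \<Theta>]
  note fH = model_space_H2[OF f] and gH = model_space_H2[OF g]
  let ?T = "\<lambda>z. \<Theta> z * disk_one z"
  have mem: "?T \<in> H2" by (rule H2_mult_Hinf[OF \<Theta>' disk_one_H2])
  have one: "H2_inner ?T ?T = 1"
    using H2_inner_mult_inner[OF \<Theta> disk_one_H2 disk_one_H2] H2_inner_one[OF disk_one_H2]
    by (simp add: disk_one_def)
  have "H2_inner f g = H2_inner (\<lambda>z. z * f z) (\<lambda>z. z * g z)"
    by (rule H2_inner_mult_inner[symmetric, OF inner_function_id fH gH])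
  also have "\<dots> = \<alpha> * H2_inner f (\<lambda>z. z * g z) + c * H2_inner ?T (\<lambda>z. z * g z)"
    unfolding zf by (rule H2_inner_lincomb_left[OF fH mem H2_shift[OF gH]])
  also have "H2_inner f (\<lambda>z. z * g z) = cnj \<beta> * H2_inner f g"
    unfolding zg using H2_inner_lincomb_right[OF gH mem fH, of \<beta> d] model_space_orth[OF f disk_one_H2] by simp
  also have "H2_inner ?T (\<lambda>z. z * g z) = cnj d"
    unfolding zg using H2_inner_lincomb_right[OF gH mem mem, of \<beta> d] model_space_orth'[OF g disk_one_H2] one by simp
  finally have "H2_inner f g - \<alpha> * (cnj \<beta> * H2_inner f g) = c * cnj d"
    by (metis add_diff_cancel_left')
  then show ?thesis by (simp only: right_diff_distrib mult_1_left mult_1_right mult.commute mult.left_commute)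
qed

section \<open>Projections and truncated Toeplitz operators on the model space\<close>

lemma L2_inner_boundary_diff:
  assumes h: "h \<in> H2" and q: "q \<in> H2" and k: "k \<in> H2"
  shows "L2_inner (\<lambda>\<zeta>. boundary_fun h \<zeta> - boundary_fun q \<zeta>) (boundary_fun k) = H2_inner h k - H2_inner q k"
  unfolding L2_inner_def H2_inner_def
  using boundary_product_integrable[OF h k] boundary_product_integrable[OF q k] by (simp add: left_diff_distrib)

text \<open>The definite description requires uniqueness: the difference of two candidates lies in
  the model space and is orthogonal to it, hence to itself.\<close>

lemma model_proj_eqI:
  assumes \<Theta>: "\<Theta> \<in> Hinf" and h: "h \<in> H2" and p: "p \<in> model_space \<Theta>"
    and eq: "\<And>k. k \<in> model_space \<Theta> \<Longrightarrow> H2_inner h k = H2_inner p k"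
  shows "model_proj \<Theta> (boundary_fun h) = p"
  unfolding model_proj_def
proof (rule the_equality)
  show "p \<in> model_space \<Theta> \<and> (\<forall>k\<in>model_space \<Theta>. L2_inner (\<lambda>\<zeta>. boundary_fun h \<zeta> - boundary_fun p \<zeta>) (boundary_fun k) = 0)"
    using p eq by (auto simp: L2_inner_boundary_diff h model_space_H2)
  fix q assume "q \<in> model_space \<Theta> \<and> (\<forall>k\<in>model_space \<Theta>. L2_inner (\<lambda>\<zeta>. boundary_fun h \<zeta> - boundary_fun q \<zeta>) (boundary_fun k) = 0)"
  then have q: "q \<in> model_space \<Theta>" and q': "\<And>k. k \<in> model_space \<Theta> \<Longrightarrow> H2_inner h k = H2_inner q k"
    by (auto simp: L2_inner_boundary_diff h model_space_H2)
  let ?d = "\<lambda>z. q z - p z"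
  have d: "?d \<in> model_space \<Theta>" by (rule model_space_diff[OF \<Theta> q p])
  have "H2_inner ?d ?d = 0"
    using H2_inner_diff_left[OF model_space_H2[OF q] model_space_H2[OF p] model_space_H2[OF d]] eq[OF d] q'[OF d] by simp
  from H2_inner_self(3)[OF model_space_H2[OF d] this] show "q = p" by (simp add: fun_eq_iff)
qed

lemma linear_combination_image:
  fixes U :: "complex ^ 'n \<Rightarrow> complex \<Rightarrow> complex"
  assumes U: "\<And>a b u v. U (a *s u + b *s v) = (\<lambda>z. a * U u z + b * U v z)"
  shows "finite I \<Longrightarrow> U (\<Sum>i\<in>I. a i *s u i) = (\<lambda>z. \<Sum>i\<in>I. a i * U (u i) z)"
proof (induction I rule: finite_induct)
  case empty
  show ?case using U[of 0 0 0 0] by simp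
next
  case (insert i I)
  then show ?case using U[of "a i" "u i" 1 "\<Sum>i\<in>I. a i *s u i"] by simp
qed

lemma unitary_onto_modelD:
  assumes "unitary_onto_model \<Theta> U"
  shows "U (a *s u + b *s v) = (\<lambda>z. a * U u z + b * U v z)" "U v \<in> model_space \<Theta>"
    "f \<in> model_space \<Theta> \<Longrightarrow> \<exists>v. U v = f" "U u = U v \<Longrightarrow> u = v" "H2_inner (U u) (U v) = cinner u v"
proof -
  have U: "\<forall>a b u v. U (a *s u + b *s v) = (\<lambda>z. a * U u z + b * U v z)" "bij_betw U UNIV (model_space \<Theta>)"
    "\<forall>u v. H2_inner (U u) (U v) = cinner u v"
    using assms unfolding unitary_onto_model_def by - (elim conjE, assumption)+
  show "U (a *s u + b *s v) = (\<lambda>z. a * U u z + b * U v z)" by (rule U(1)[rule_format])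
  show "H2_inner (U u) (U v) = cinner u v" by (rule U(3)[rule_format])
  show "U v \<in> model_space \<Theta>" using U(2) by (auto simp: bij_betw_def)
  show "f \<in> model_space \<Theta> \<Longrightarrow> \<exists>v. U v = f" using U(2) by (metis bij_betw_iff_bijections)
  show "U u = U v \<Longrightarrow> u = v" using U(2) by (auto simp: bij_betw_def inj_on_def)
qed

text \<open>The images of the unit vectors under \<open>U\<close> form a finite orthonormal basis of
  the model space, so the projection can be written down as the expansion in that basis.\<close>

lemma TTO_properties:
  assumes \<Theta>: "\<Theta> \<in> Hinf" and U: "unitary_onto_model \<Theta> U" and \<phi>: "\<phi> \<in> Hinf" and f: "f \<in> model_space \<Theta>"
  shows "TTO \<Theta> \<phi> f \<in> model_space \<Theta>"
    and "k \<in> model_space \<Theta> \<Longrightarrow> H2_inner (\<lambda>z. \<phi> z * f z) k = H2_inner (TTO \<Theta> \<phi> f) k"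
proof -
  note UD = unitary_onto_modelD[OF U]
  let ?h = "\<lambda>z. \<phi> z * f z"
  have h: "?h \<in> H2" by (rule H2_mult_Hinf[OF \<phi> model_space_H2[OF f]])
  define p where "p = U (\<chi> i. H2_inner ?h (U (axis i 1)))"
  have p: "p \<in> model_space \<Theta>" unfolding p_def by (rule UD)
  have eq: "H2_inner ?h k = H2_inner p k" if k: "k \<in> model_space \<Theta>" for k
  proof -
    obtain v where v: "U v = k" using UD(3)[OF k] by blast
    have "H2_inner ?h (U v) = H2_inner ?h (U (\<Sum>i\<in>UNIV. v $ i *s axis i 1))" by (simp add: basis_expansion)
    also have "\<dots> = H2_inner ?h (\<lambda>z. \<Sum>i\<in>UNIV. v $ i * U (axis i 1) z)"
      by (subst linear_combination_image[OF UD(1)]) auto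
    also have "\<dots> = (\<Sum>i\<in>UNIV. cnj (v $ i) * H2_inner ?h (U (axis i 1)))"
      by (rule H2_inner_sum_right[OF h]) (auto intro: model_space_H2 UD)
    also have "\<dots> = H2_inner p (U v)" unfolding p_def UD(5) by (simp add: cinner_def mult.commute)
    finally show ?thesis by (simp add: v)
  qed
  have "TTO \<Theta> \<phi> f = p" unfolding TTO_def by (rule model_proj_eqI[OF \<Theta> h p eq])
  with p eq show "TTO \<Theta> \<phi> f \<in> model_space \<Theta>"
    "k \<in> model_space \<Theta> \<Longrightarrow> H2_inner ?h k = H2_inner (TTO \<Theta> \<phi> f) k" by auto
qed

text \<open>Both sides are tested against \<open>k\<close> in the model space. Multiples of
  \<open>\<Theta>\<close>, also after multiplication by \<open>\<phi>\<close>, drop out; moving the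
  remaining factor \<open>z\<close> onto \<open>k\<close> produces the backward shift of
  \<open>k\<close>. That lies in the model space again, where \<open>\<phi> f\<close> and its
  projection cannot be told apart.\<close>

lemma TTO_compressed_shift_commute:
  assumes \<Theta>: "inner_function \<Theta>" and U: "unitary_onto_model \<Theta> U" and \<phi>: "\<phi> \<in> Hinf" and f: "f \<in> model_space \<Theta>"
  shows "TTO \<Theta> \<phi> (compressed_shift \<Theta> f) = compressed_shift \<Theta> (TTO \<Theta> \<phi> f)"
proof -
  note \<Theta>' = inner_function_Hinf[OF \<Theta>]
  note T = TTO_properties[OF \<Theta>' U \<phi> f]
  note Af = compressed_shift_model_space[OF \<Theta> f]
  let ?T1 = "\<lambda>z. \<Theta> z * disk_one z"
  have T1: "?T1 \<in> H2" by (rule H2_mult_Hinf[OF \<Theta>' disk_one_H2])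
  have \<phi>f: "(\<lambda>z. \<phi> z * f z) \<in> H2" by (rule H2_mult_Hinf[OF \<phi> model_space_H2[OF f]])
  have \<phi>1: "(\<lambda>z. \<phi> z * disk_one z) \<in> H2" by (rule H2_mult_Hinf[OF \<phi> disk_one_H2])
  have shift: "H2_inner (\<lambda>z. z * (\<phi> z * f z)) k = H2_inner (\<lambda>z. z * TTO \<Theta> \<phi> f z) k" if k: "k \<in> model_space \<Theta>" for k
  proof -
    obtain k' where k': "k' \<in> model_space \<Theta>" and eq: "\<And>z. k z = k 0 * disk_one z + z * k' z"
      by (rule model_space_backward_shift[OF \<Theta>' k]) (rule that)
    have *: "H2_inner (\<lambda>z. z * g z) k = H2_inner g k'" if "g \<in> H2" for g
      using H2_inner_backward_shift[OF model_space_H2[OF k'] that eq]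
        H2_inner_commute[of k "\<lambda>z. z * g z"] H2_inner_commute[of k' g] by simp
    show ?thesis using *[OF \<phi>f] *[OF model_space_H2[OF T(1)]] T(2)[OF k'] by simp
  qed
  show ?thesis unfolding TTO_def[of \<Theta> \<phi> "compressed_shift \<Theta> f"]
  proof (rule model_proj_eqI[OF \<Theta>' H2_mult_Hinf[OF \<phi> model_space_H2[OF Af]] compressed_shift_model_space[OF \<Theta> T(1)]])
    fix k assume k: "k \<in> model_space \<Theta>"
    note kH = model_space_H2[OF k]
    let ?c = "H2_inner (\<lambda>z. z * f z) ?T1"
    have "(\<lambda>z. \<phi> z * compressed_shift \<Theta> f z) = (\<lambda>z. z * (\<phi> z * f z) - ?c * (\<Theta> z * (\<phi> z * disk_one z)))"
      by (simp add: compressed_shift_def fun_eq_iff algebra_simps)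
    then have "H2_inner (\<lambda>z. \<phi> z * compressed_shift \<Theta> f z) k = H2_inner (\<lambda>z. z * (\<phi> z * f z)) k"
      using H2_inner_diff_left[OF H2_shift[OF \<phi>f] H2_scale[OF H2_mult_Hinf[OF \<Theta>' \<phi>1]] kH]
        H2_inner_scale_left[OF H2_mult_Hinf[OF \<Theta>' \<phi>1] kH] model_space_orth'[OF k \<phi>1] by simp
    also have "\<dots> = H2_inner (\<lambda>z. z * TTO \<Theta> \<phi> f z) k" by (rule shift[OF k])
    also have "\<dots> = H2_inner (compressed_shift \<Theta> (TTO \<Theta> \<phi> f)) k"
      unfolding compressed_shift_def
      using H2_inner_diff_left[OF H2_shift[OF model_space_H2[OF T(1)]] H2_scale[OF T1] kH]
        H2_inner_scale_left[OF T1 kH] model_space_orth'[OF k disk_one_H2] by simp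
    finally show "H2_inner (\<lambda>z. \<phi> z * compressed_shift \<Theta> f z) k = H2_inner (compressed_shift \<Theta> (TTO \<Theta> \<phi> f)) k" .
  qed
qed

lemma eigenvectors_independent:
  fixes M :: "complex ^ 'n ^ 'n"
  assumes inj: "inj_on ev I" and M: "\<And>i. i \<in> I \<Longrightarrow> M *v x i = ev i *s x i" and nz: "\<And>i. i \<in> I \<Longrightarrow> x i \<noteq> 0"
    and fin: "finite I" and sum: "(\<Sum>i\<in>I. a i *s x i) = 0" and i: "i \<in> I"
  shows "a i = 0"
  using fin inj M nz sum i
proof (induction I arbitrary: a i rule: finite_induct)
  case (insert j I)
  have lin: "M *v (\<Sum>i\<in>J. b i *s x i) = (\<Sum>i\<in>J. b i *s (M *v x i))" for b J
    by (induction J rule: infinite_finite_induct) (auto simp: matrix_vector_right_distrib vector_scalar_commute)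
  have "0 = M *v (\<Sum>i\<in>insert j I. a i *s x i) - ev j *s (\<Sum>i\<in>insert j I. a i *s x i)"
    using insert.prems by simp
  also have "\<dots> = (\<Sum>i\<in>insert j I. a i *s (ev i *s x i)) - (\<Sum>i\<in>insert j I. a i *s (ev j *s x i))"
    unfolding lin using insert.prems(2) by (simp add: vec.scale_sum_right vector_smult_assoc mult.commute)
  also have "\<dots> = (\<Sum>i\<in>I. (a i * (ev i - ev j)) *s x i)"
    using insert.hyps by (simp add: vector_smult_assoc vector_sub_rdistrib right_diff_distrib sum_subtractf)
  finally have "(\<Sum>i\<in>I. (a i * (ev i - ev j)) *s x i) = 0" by simp
  then have "a i * (ev i - ev j) = 0" if "i \<in> I" for i
    using insert.prems that by (intro insert.IH) auto
  then have zero: "a i = 0" if "i \<in> I" for i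
    using that insert.hyps insert.prems(1) by (auto simp: inj_on_def)
  then have "a j *s x j = 0" using insert.prems(4) insert.hyps by simp
  then have "a j = 0" using insert.prems(3)[of j] by (simp add: vector_mul_eq_0)
  with zero insert.prems(5) show ?case by auto
qed auto

section \<open>Eigenvectors and Gram matrices\<close>

text \<open>The coordinates are entries of \<open>Y *v v\<close>, where \<open>Y\<close> inverts the
  matrix whose columns are the eigenvectors. They are thus linear in \<open>v\<close> by
  construction, which is what the definition of a unitary map by its values on eigenvectors
  needs.\<close>

lemma eigenvectors_span:
  fixes M :: "complex ^ 'n ^ 'n" and x :: "nat \<Rightarrow> complex ^ 'n"
  assumes inj: "inj_on ev I" and M: "\<And>i. i \<in> I \<Longrightarrow> M *v x i = ev i *s x i" and nz: "\<And>i. i \<in> I \<Longrightarrow> x i \<noteq> 0"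
    and fin: "finite I" and card: "card I = CARD('n)"
  obtains a :: "complex ^ 'n \<Rightarrow> nat \<Rightarrow> complex"
    where "\<And>v. v = (\<Sum>i\<in>I. a v i *s x i)"
    and "\<And>b c u v. a (b *s u + c *s v) = (\<lambda>i. b * a u i + c * a v i)"
    and "\<And>b i. i \<in> I \<Longrightarrow> a (\<Sum>j\<in>I. b j *s x j) i = b i"
proof -
  obtain h where h: "bij_betw h (UNIV :: 'n set) I"
    using finite_same_card_bij[of "UNIV :: 'n set" I] fin card by auto
  then have hI: "h k \<in> I" for k by (auto simp: bij_betw_def)
  define X :: "complex ^ 'n ^ 'n" where "X = (\<chi> r c. x (h c) $ r)"
  have X: "X *v w = (\<Sum>k\<in>UNIV. w $ k *s x (h k))" for w
    by (simp add: X_def matrix_vector_mult_def vec_eq_iff mult.commute)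
  have "inj ((*v) X)"
  proof (rule injI)
    fix u v assume "X *v u = X *v v"
    then have sum0: "(\<Sum>k\<in>UNIV. (u $ k - v $ k) *s x (h k)) = 0"
      by (simp add: X vector_sub_rdistrib sum_subtractf)
    have "u $ k - v $ k = 0" for k
    proof (rule eigenvectors_independent[of "\<lambda>k. ev (h k)" UNIV M "\<lambda>k. x (h k)" "\<lambda>k. u $ k - v $ k" k])
      show "inj (\<lambda>k. ev (h k))"
        using comp_inj_on[of h UNIV ev] h inj by (simp add: bij_betw_def o_def)
    qed (use hI M nz sum0 in simp_all)
    then show "u = v" by (simp add: vec_eq_iff)
  qed
  then obtain Y where Y: "Y ** X = mat 1" using matrix_left_invertible_injective by metis
  then have Y': "X ** Y = mat 1" using matrix_left_right_inverse by metis
  define a where "a v i = (Y *v v) $ (inv_into UNIV h i)" for v i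
  have ah: "a v (h k) = (Y *v v) $ k" for v k
    using h by (simp add: a_def bij_betw_def)
  have re: "(\<Sum>i\<in>I. f i) = (\<Sum>k\<in>UNIV. f (h k))" for f :: "nat \<Rightarrow> complex ^ 'n"
    by (rule sum.reindex_bij_betw[OF h, symmetric])
  show ?thesis
  proof
    show "v = (\<Sum>i\<in>I. a v i *s x i)" for v
    proof -
      have "(\<Sum>i\<in>I. a v i *s x i) = X *v (Y *v v)" by (simp add: re ah X)
      then show ?thesis by (simp add: matrix_vector_mul_assoc Y')
    qed
    show "a (b *s u + c *s v) = (\<lambda>i. b * a u i + c * a v i)" for b c u v
      by (simp add: a_def matrix_vector_right_distrib vector_scalar_commute fun_eq_iff)
    show "a (\<Sum>j\<in>I. b j *s x j) i = b i" if "i \<in> I" for b i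
    proof -
      obtain k where k: "i = h k" using h \<open>i \<in> I\<close> by (auto simp: bij_betw_def)
      have "(\<Sum>j\<in>I. b j *s x j) = X *v (\<chi> k. b (h k))" by (simp add: re X)
      then show ?thesis unfolding k ah by (simp add: matrix_vector_mul_assoc Y)
    qed
  qed
qed

lemma matrix_vector_mult_sum_scaled:
  "M *v (\<Sum>i\<in>I. a i *s x i) = (\<Sum>i\<in>I. a i *s (M *v x i))" for M :: "complex ^ 'n ^ 'm"
  by (induction I rule: infinite_finite_induct) (auto simp: matrix_vector_right_distrib vector_scalar_commute)

lemma eigenspace_one_dimensional:
  fixes M :: "complex ^ 'n ^ 'n" and x :: "nat \<Rightarrow> complex ^ 'n"
  assumes inj: "inj_on ev I" and M: "\<And>i. i \<in> I \<Longrightarrow> M *v x i = ev i *s x i" and nz: "\<And>i. i \<in> I \<Longrightarrow> x i \<noteq> 0"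
    and fin: "finite I" and card: "card I = CARD('n)" and i: "i \<in> I" and v: "M *v v = ev i *s v"
  obtains c where "v = c *s x i"
proof -
  obtain a where a: "\<And>v. v = (\<Sum>i\<in>I. a v i *s x i)"
    by (rule eigenvectors_span[OF inj M nz fin card]) (assumption | rule that)+
  have "0 = M *v (\<Sum>j\<in>I. a v j *s x j) - ev i *s (\<Sum>j\<in>I. a v j *s x j)"
    using v by (simp flip: a)
  also have "\<dots> = (\<Sum>j\<in>I. a v j *s (ev j *s x j)) - (\<Sum>j\<in>I. a v j *s (ev i *s x j))"
    using M by (simp add: matrix_vector_mult_sum_scaled vec.scale_sum_right vector_smult_assoc mult.commute)
  also have "\<dots> = (\<Sum>j\<in>I. (a v j * (ev j - ev i)) *s x j)"
    by (simp add: vector_smult_assoc vector_sub_rdistrib right_diff_distrib sum_subtractf)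
  finally have sum0: "(\<Sum>j\<in>I. (a v j * (ev j - ev i)) *s x j) = 0" by simp
  have coeff: "a v j * (ev j - ev i) = 0" if "j \<in> I" for j
    by (rule eigenvectors_independent[OF inj M nz fin sum0 that])
  have "a v j *s x j = (if j = i then a v i *s x i else 0)" if j: "j \<in> I" for j
  proof (cases "j = i")
    case False
    then have "ev j \<noteq> ev i" using inj_onD[OF inj _ j i] by blast
    then have "a v j = 0" using coeff[OF j] by simp
    then show ?thesis using False by simp
  qed simp
  then have "(\<Sum>j\<in>I. a v j *s x j) = (\<Sum>j\<in>I. if j = i then a v i *s x i else 0)"
    by (rule sum.cong[OF refl])
  also have "\<dots> = a v i *s x i" by (subst sum.delta[OF fin]) (simp add: i)
  finally have "v = a v i *s x i" unfolding a[of v, symmetric] .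
  then show ?thesis by (rule that)
qed

section \<open>The Hermitian inner product and unit eigenvectors\<close>

lemma cinner_self: "cinner v v = of_real ((norm v)\<^sup>2)"
proof -
  have "cinner v v = of_real (\<Sum>i\<in>UNIV. (cmod (v $ i))\<^sup>2)"
    unfolding cinner_def of_real_sum complex_norm_square ..
  also have "(\<Sum>i\<in>UNIV. (cmod (v $ i))\<^sup>2) = (norm v)\<^sup>2"
    by (simp add: norm_vec_def L2_set_def sum_nonneg)
  finally show ?thesis .
qed

lemma cinner_commute: "cnj (cinner u v) = cinner v u"
  by (simp add: cinner_def mult.commute)

lemma cinner_diff_scale_left: "cinner (a *s u - b *s v) w = a * cinner u w - b * cinner v w"
  by (simp add: cinner_def sum_distrib_left sum_subtractf algebra_simps)

lemma cinner_diff_scale_right: "cinner w (a *s u - b *s v) = cnj a * cinner w u - cnj b * cinner w v"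
  by (simp add: cinner_def sum_distrib_left sum_subtractf algebra_simps)

text \<open>The equality case of Cauchy-Schwarz: the component of \<open>u\<close> orthogonal to
  \<open>v\<close> has squared norm 1 minus the squared modulus of the inner product.\<close>

lemma cinner_eq_1_imp_dependent:
  assumes u: "norm u = 1" and v: "norm v = 1" and c: "cmod (cinner u v) = 1"
  shows "u = cinner u v *s v"
proof -
  let ?c = "cinner u v" and ?w = "1 *s u - cinner u v *s v"
  have "?c * cnj ?c = 1" using c by (simp flip: complex_norm_square)
  moreover have "cinner v u = cnj ?c" by (simp add: cinner_commute)
  ultimately have "cinner ?w ?w = 0"
    unfolding cinner_diff_scale_left cinner_diff_scale_right
    using u v by (simp add: cinner_self mult.commute)
  then show ?thesis by (simp add: cinner_self)
qed

lemma eigenvectors_not_dependent: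
  fixes M :: "complex ^ 'n ^ 'n"
  assumes "M *v u = a *s u" "M *v v = b *s v" "a \<noteq> b" "norm u = 1" "u = c *s v"
  shows False
proof -
  have "a *s u = b *s u"
    using assms(1,2,5) by (metis vector_scalar_commute vector_smult_assoc mult.commute)
  then have "(a - b) *s u = 0" by (simp add: vector_sub_rdistrib)
  then show False using assms(3,4) by (auto simp: vector_mul_eq_0)
qed

text \<open>The only way in which distinct eigenvalues separate points: it forbids coinciding
  \<open>\<alpha> i\<close> in one direction and \<open>z i = 0\<close> in the other.\<close>

lemma eigenvectors_cmod_cinner_ne_1:
  fixes M :: "complex ^ 'n ^ 'n"
  assumes "M *v u = a *s u" "M *v v = b *s v" "a \<noteq> b" "norm u = 1" "norm v = 1"
  shows "cmod (cinner u v) \<noteq> 1"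
  using eigenvectors_not_dependent[OF assms(1-4)] cinner_eq_1_imp_dependent[OF assms(4,5)] by blast

section \<open>Automorphisms of the disk\<close>

lemma unit_disk_denom_nonzero: "cmod a < 1 \<Longrightarrow> cmod b \<le> 1 \<Longrightarrow> 1 - cnj a * b \<noteq> 0"
proof
  assume "cmod a < 1" "cmod b \<le> 1" "1 - cnj a * b = 0"
  then have "cmod (cnj a * b) = 1" by (simp flip: eq_iff_diff_eq_0)
  moreover have "cmod (cnj a * b) < 1"
    using \<open>cmod a < 1\<close> \<open>cmod b \<le> 1\<close> mult_mono[of "cmod a" "cmod a" "cmod b" 1] by (simp add: norm_mult)
  ultimately show False by simp
qed

text \<open>The disk automorphism sending \<open>c\<close> to 0. It acts on points when the
  configuration is normalized and, as a function of \<open>w\<close>, is the Blaschke factor with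
  zero \<open>c\<close>.\<close>

definition mobius :: "complex \<Rightarrow> complex \<Rightarrow> complex" where
  "mobius c w = (w - c) / (1 - cnj c * w)"

text \<open>Apart from a constant, the automorphism changes \<open>1 - a * cnj b\<close> by one
  factor depending on \<open>a\<close> and one depending on \<open>b\<close>. This is the reason why
  its effect cancels in cyclic products.\<close>

lemma mobius_pick:
  assumes "1 - cnj c * a \<noteq> 0" "1 - cnj c * b \<noteq> 0"
  shows "1 - mobius c a * cnj (mobius c b) =
    (1 - c * cnj c) * (1 - a * cnj b) / ((1 - cnj c * a) * (1 - c * cnj b))"
proof -
  have "cnj (1 - cnj c * b) = 1 - c * cnj b" by simp
  then have "1 - c * cnj b \<noteq> 0" using assms(2) by (metis complex_cnj_zero_iff)
  with assms show ?thesis by (simp add: mobius_def divide_simps) (simp add: algebra_simps)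
qed

lemma one_minus_norm_square: "complex_of_real (1 - (cmod z)\<^sup>2) = 1 - z * cnj z"
  by (simp only: of_real_diff complex_norm_square of_real_1)

lemma mobius_triple_identity:
  assumes a: "cmod a < 1" and b: "cmod b < 1" and c: "cmod c < 1"
  shows "of_real ((1 - (cmod (mobius c a))\<^sup>2) * (1 - (cmod (mobius c b))\<^sup>2)) / (1 - cnj (mobius c b) * mobius c a) =
    (1 - c * cnj c) * (1 - a * cnj a) * (1 - b * cnj b) /
      ((1 - c * cnj a) * (1 - a * cnj b) * (1 - b * cnj c))"
proof -
  have nz: "1 - cnj p * q \<noteq> 0" "1 - p * cnj q \<noteq> 0" if "cmod p < 1" "cmod q < 1" for p q
    using unit_disk_denom_nonzero[of p q] unit_disk_denom_nonzero[of q p] that by (auto simp: mult.commute)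
  \<comment> \<open>The cancellation with each denominator and its conjugate treated as independent
    variables, so that it becomes an identity of rational functions.\<close>
  have gen: "(K * A / (p * p')) * (K * B / (q * q')) / (K * D / (p * q')) = K * A * B / (p' * D * q)"
    if "K \<noteq> 0" "p \<noteq> 0" "p' \<noteq> 0" "q \<noteq> 0" "q' \<noteq> 0" "D \<noteq> 0" for K A B D p p' q q' :: complex
    using that by (simp add: divide_simps)
  have "of_real ((1 - (cmod (mobius c a))\<^sup>2) * (1 - (cmod (mobius c b))\<^sup>2)) / (1 - cnj (mobius c b) * mobius c a) =
    (1 - mobius c a * cnj (mobius c a)) * (1 - mobius c b * cnj (mobius c b)) / (1 - mobius c a * cnj (mobius c b))"
    unfolding of_real_mult one_minus_norm_square by (simp only: mult.commute)
  also have "\<dots> = (1 - c * cnj c) * (1 - a * cnj a) * (1 - b * cnj b) /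
      ((1 - c * cnj a) * (1 - a * cnj b) * (1 - b * cnj c))"
    unfolding mobius_pick[OF nz(1)[OF c a] nz(1)[OF c a]] mobius_pick[OF nz(1)[OF c b] nz(1)[OF c b]]
      mobius_pick[OF nz(1)[OF c a] nz(1)[OF c b]]
    mult.commute[of b "cnj c"]
    by (rule gen) (use nz[OF c a] nz[OF c b] nz[OF c c] nz[OF a b] in auto)
  finally show ?thesis .
qed

section \<open>Necessity: the Gram matrix of the eigenvectors\<close>

lemma TTO_eigenvector_gram:
  fixes M :: "complex ^ 'n ^ 'n" and x :: "nat \<Rightarrow> complex ^ 'n"
  assumes inj: "inj_on ev I" and M: "\<And>i. i \<in> I \<Longrightarrow> M *v x i = ev i *s x i" and unit: "\<And>i. i \<in> I \<Longrightarrow> norm (x i) = 1"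
    and fin: "finite I" and card: "card I = CARD('n)"
    and \<Theta>: "inner_function \<Theta>" and \<phi>: "\<phi> \<in> Hinf" and eq: "unitarily_equiv_TTO M \<Theta> \<phi>"
  obtains \<alpha> c where "\<And>i. i \<in> I \<Longrightarrow> cmod (\<alpha> i) < 1" "inj_on \<alpha> I" "\<And>i. i \<in> I \<Longrightarrow> c i \<noteq> 0"
    "\<And>i j. i \<in> I \<Longrightarrow> j \<in> I \<Longrightarrow> cinner (x i) (x j) * (1 - \<alpha> i * cnj (\<alpha> j)) = c i * cnj (c j)"
proof -
  obtain U where U: "unitary_onto_model \<Theta> U" and UM: "\<And>v. U (M *v v) = TTO \<Theta> \<phi> (U v)"
    using eq by (auto simp: unitarily_equiv_TTO_def)
  note UD = unitary_onto_modelD[OF U]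
  note \<Theta>' = inner_function_Hinf[OF \<Theta>]
  have nz: "x i \<noteq> 0" if "i \<in> I" for i using unit[OF that] by auto
  have U_scale: "U (a *s v) = (\<lambda>z. a * U v z)" for a v
    using UD(1)[of a v 0 v] by simp
  let ?c = "\<lambda>i. H2_inner (\<lambda>z. z * U (x i) z) (\<lambda>z. \<Theta> z * disk_one z)"
  have "\<exists>a. compressed_shift \<Theta> (U (x i)) = (\<lambda>z. a * U (x i) z)" if i: "i \<in> I" for i
  proof -
    \<comment> \<open>The commutation relation is pulled back through \<open>U\<close>: the preimage
      \<open>v\<close> is an eigenvector of \<open>M\<close> for \<open>ev i\<close>, hence a
      multiple of \<open>x i\<close>.\<close>
    obtain v where v: "U v = compressed_shift \<Theta> (U (x i))"
      using UD(3)[OF compressed_shift_model_space[OF \<Theta> UD(2)]] by blast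
    have "U (M *v v) = compressed_shift \<Theta> (U (M *v x i))"
      unfolding UM v by (rule TTO_compressed_shift_commute[OF \<Theta> U \<phi> UD(2)])
    also have "\<dots> = compressed_shift \<Theta> (\<lambda>z. ev i * U (x i) z)"
      by (simp only: M[OF i] U_scale)
    also have "\<dots> = (\<lambda>z. ev i * compressed_shift \<Theta> (U (x i)) z)"
    proof -
      have "H2_inner (\<lambda>z. z * (ev i * U (x i) z)) (\<lambda>z. \<Theta> z * disk_one z) = ev i * ?c i"
        using H2_inner_scale_left[OF H2_shift[OF model_space_H2[OF UD(2)]] H2_mult_Hinf[OF \<Theta>' disk_one_H2], of "ev i" "x i"]
        by (simp add: mult.left_commute)
      then show ?thesis by (simp add: compressed_shift_def fun_eq_iff algebra_simps)
    qed
    also have "\<dots> = U (ev i *s v)" by (simp only: U_scale v)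
    finally have Mv: "M *v v = ev i *s v" by (rule UD(4))
    obtain a where "v = a *s x i"
      by (rule eigenspace_one_dimensional[OF inj M nz fin card i Mv]) (assumption | rule that)+
    then have "compressed_shift \<Theta> (U (x i)) = (\<lambda>z. a * U (x i) z)"
      using v by (simp only: U_scale)
    then show ?thesis ..
  qed
  then obtain \<alpha> where \<alpha>: "\<And>i. i \<in> I \<Longrightarrow> compressed_shift \<Theta> (U (x i)) = (\<lambda>z. \<alpha> i * U (x i) z)"
    by metis
  have shift: "z * U (x i) z = \<alpha> i * U (x i) z + ?c i * (\<Theta> z * disk_one z)" if "i \<in> I" for i z
    using fun_cong[OF \<alpha>[OF that], of z] by (simp add: compressed_shift_def diff_eq_eq)
  have gram: "cinner (x i) (x j) * (1 - \<alpha> i * cnj (\<alpha> j)) = ?c i * cnj (?c j)" if "i \<in> I" "j \<in> I" for i j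
    using model_space_eigenvector_inner[OF \<Theta> UD(2) UD(2) shift[OF that(1)] shift[OF that(2)]]
    unfolding UD(5) .
  have norm_eq: "1 - (cmod (\<alpha> i))\<^sup>2 = (cmod (?c i))\<^sup>2" if "i \<in> I" for i
  proof -
    have "of_real (1 - (cmod (\<alpha> i))\<^sup>2) = (of_real ((cmod (?c i))\<^sup>2) :: complex)"
      using gram[OF that that] unit[OF that]
      unfolding one_minus_norm_square complex_norm_square by (simp add: cinner_self)
    then show ?thesis by (simp only: of_real_eq_iff)
  qed
  have c_nz: "?c i \<noteq> 0" if i: "i \<in> I" for i
  proof
    \<comment> \<open>The diagonal of the Gram relation would put \<open>\<alpha> i\<close> on the
      circle, and \<open>z - \<alpha> i\<close> would annihilate the eigenfunction while having no
      zero in the disk.\<close>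
    assume c0: "?c i = 0"
    then have "(cmod (\<alpha> i))\<^sup>2 = 1" using norm_eq[OF i] by simp
    then have \<alpha>1: "cmod (\<alpha> i) = 1" by (simp add: power2_eq_1_iff) (smt (verit) norm_ge_zero)
    have H: "U (x i) \<in> H2" by (rule model_space_H2[OF UD(2)])
    have "U (x i) z = 0" for z
    proof (cases "cmod z < 1")
      case True
      then have "z \<noteq> \<alpha> i" using \<alpha>1 by auto
      moreover have "z * U (x i) z = \<alpha> i * U (x i) z" using shift[OF i, of z] c0 by simp
      ultimately show ?thesis by simp
    next
      case False
      then show ?thesis by (intro H2_outside[OF H]) simp
    qed
    then have "U (x i) = (\<lambda>z. 0)" by auto
    then have "U (x i) = U 0" using U_scale[of 0 "x i"] by simp
    then show False using UD(4) nz[OF i] by blast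
  qed
  have lt: "cmod (\<alpha> i) < 1" if "i \<in> I" for i
  proof -
    have "0 < (cmod (?c i))\<^sup>2" using c_nz[OF that] by simp
    then have "(cmod (\<alpha> i))\<^sup>2 < 1\<^sup>2" unfolding norm_eq[OF that, symmetric] by simp
    then show ?thesis by (rule power2_less_imp_less) simp
  qed
  \<comment> \<open>If two of the points coincide, the diagonal and off-diagonal Gram relations have
    the same modulus on the right, which makes the inner product of the two unit eigenvectors
    unimodular.\<close>
  have "inj_on \<alpha> I"
  proof (rule inj_onI, rule ccontr)
    fix i j assume ij: "i \<in> I" "j \<in> I" and \<alpha>eq: "\<alpha> i = \<alpha> j" and ne: "i \<noteq> j"
    let ?d = "1 - (cmod (\<alpha> i))\<^sup>2"
    have "cmod (cinner (x i) (x j)) * cmod (1 - \<alpha> i * cnj (\<alpha> i)) = cmod (?c i) * cmod (?c j)"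
      using arg_cong[OF gram[OF ij], of cmod] \<alpha>eq by (simp only: norm_mult complex_mod_cnj)
    also have "cmod (1 - \<alpha> i * cnj (\<alpha> i)) = ?d"
      unfolding one_minus_norm_square[symmetric] norm_of_real using norm_eq[OF ij(1)] by simp
    also have "cmod (?c j) = cmod (?c i)"
      using norm_eq[OF ij(1)] norm_eq[OF ij(2)] \<alpha>eq by (simp add: power2_eq_iff_nonneg)
    also have "cmod (?c i) * cmod (?c i) = ?d" using norm_eq[OF ij(1)] by (simp add: power2_eq_square)
    finally have "cmod (cinner (x i) (x j)) * ?d = 1 * ?d" by simp
    moreover have "?d \<noteq> 0" using norm_eq[OF ij(1)] c_nz[OF ij(1)] by simp
    ultimately have "cmod (cinner (x i) (x j)) = 1" by (simp only: mult_cancel_right) simp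
    moreover have "ev i \<noteq> ev j" using inj ij ne by (auto simp: inj_on_def)
    ultimately show False
      using eigenvectors_cmod_cinner_ne_1[OF M[OF ij(1)] M[OF ij(2)] _ unit[OF ij(1)] unit[OF ij(2)]] by blast
  qed
  with lt c_nz gram show ?thesis by (intro that[of \<alpha> ?c])
qed

lemma mobius_in_disk:
  assumes "cmod c < 1" "cmod a < 1"
  shows "cmod (mobius c a) < 1"
proof -
  have nz: "1 - cnj c * a \<noteq> 0" using unit_disk_denom_nonzero assms by simp
  have "cnj (1 - cnj c * a) = 1 - c * cnj a" by simp
  then have "complex_of_real (1 - (cmod (mobius c a))\<^sup>2) =
      of_real ((1 - (cmod c)\<^sup>2) * (1 - (cmod a)\<^sup>2)) / of_real ((cmod (1 - cnj c * a))\<^sup>2)"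
    unfolding of_real_mult one_minus_norm_square mobius_pick[OF nz nz] complex_norm_square by simp
  then have eq: "1 - (cmod (mobius c a))\<^sup>2 = (1 - (cmod c)\<^sup>2) * (1 - (cmod a)\<^sup>2) / (cmod (1 - cnj c * a))\<^sup>2"
    by (simp only: of_real_divide[symmetric] of_real_eq_iff)
  have "0 < (1 - (cmod c)\<^sup>2) * (1 - (cmod a)\<^sup>2) / (cmod (1 - cnj c * a))\<^sup>2"
    using assms nz by (intro divide_pos_pos mult_pos_pos) (auto simp: power_less_one_iff abs_square_less_1)
  then have "(cmod (mobius c a))\<^sup>2 < 1\<^sup>2" using eq by simp
  then show ?thesis by (rule power2_less_imp_less) simp
qed

lemma mobius_inj:
  assumes c: "cmod c < 1" and ab: "cmod a < 1" "cmod b < 1" and eq: "mobius c a = mobius c b"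
  shows "a = b"
proof -
  have "(a - c) * (1 - cnj c * b) = (b - c) * (1 - cnj c * a)"
    using eq unit_disk_denom_nonzero[OF c, of a] unit_disk_denom_nonzero[OF c, of b] ab
    by (simp add: mobius_def frac_eq_eq)
  then have "(a - b) * (1 - cnj c * c) = 0" by (simp add: algebra_simps)
  then show ?thesis using unit_disk_denom_nonzero[OF c, of c] c by simp
qed

lemma unitarily_equiv_imp_triple_identity:
  fixes M :: "complex ^ 'n ^ 'n" and x :: "nat \<Rightarrow> complex ^ 'n"
  assumes n_def: "n = CARD('n)" and inj: "inj_on ev {1..n}"
    and M: "\<And>i. i \<in> {1..n} \<Longrightarrow> M *v x i = ev i *s x i"
    and unit: "\<And>i. i \<in> {1..n} \<Longrightarrow> norm (x i) = 1"
    and eq: "unitarily_equiv_analytic_TTO M"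
  shows "\<exists>z :: nat \<Rightarrow> complex. inj_on z {1..<n} \<and> z ` {1..<n} \<subseteq> ball 0 1 \<and>
       (\<forall>i j. 1 \<le> i \<and> i \<le> j \<and> j < n \<longrightarrow>
          cinner (x n) (x i) * cinner (x i) (x j) * cinner (x j) (x n) =
            of_real ((1 - (cmod (z i))\<^sup>2) * (1 - (cmod (z j))\<^sup>2)) / (1 - cnj (z j) * z i))"
proof -
  obtain \<Theta> \<phi> where \<Theta>: "inner_function \<Theta>" and \<phi>: "\<phi> \<in> Hinf" and equiv: "unitarily_equiv_TTO M \<Theta> \<phi>"
    using eq by (auto simp: unitarily_equiv_analytic_TTO_def)
  have card: "card {1..n} = CARD('n)" by (simp add: n_def)
  obtain \<alpha> c where \<alpha>: "\<And>i. i \<in> {1..n} \<Longrightarrow> cmod (\<alpha> i) < 1" "inj_on \<alpha> {1..n}" and c: "\<And>i. i \<in> {1..n} \<Longrightarrow> c i \<noteq> 0"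
    and gram: "\<And>i j. i \<in> {1..n} \<Longrightarrow> j \<in> {1..n} \<Longrightarrow> cinner (x i) (x j) * (1 - \<alpha> i * cnj (\<alpha> j)) = c i * cnj (c j)"
    by (rule TTO_eigenvector_gram[OF inj M unit _ card \<Theta> \<phi> equiv]) (simp | assumption | rule that)+
  have n: "n \<in> {1..n}" using n_def by (simp add: Suc_leI)
  have nz: "1 - \<alpha> i * cnj (\<alpha> j) \<noteq> 0" if "i \<in> {1..n}" "j \<in> {1..n}" for i j
    using unit_disk_denom_nonzero[of "\<alpha> j" "\<alpha> i"] \<alpha>(1)[OF that(1)] \<alpha>(1)[OF that(2)] by (simp add: mult.commute)
  have G: "cinner (x i) (x j) = c i * cnj (c j) / (1 - \<alpha> i * cnj (\<alpha> j))" if "i \<in> {1..n}" "j \<in> {1..n}" for i j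
    using gram[OF that] nz[OF that] by (simp add: eq_divide_eq)
  have cc: "c i * cnj (c i) = 1 - \<alpha> i * cnj (\<alpha> i)" if "i \<in> {1..n}" for i
    using gram[OF that that] unit[OF that] by (simp add: cinner_self)
  define z where "z i = mobius (\<alpha> n) (\<alpha> i)" for i
  have "inj_on z {1..<n}"
  proof (rule inj_onI)
    fix i j assume ij: "i \<in> {1..<n}" "j \<in> {1..<n}" and eq: "z i = z j"
    then have i: "i \<in> {1..n}" and j: "j \<in> {1..n}" by simp_all
    have "\<alpha> i = \<alpha> j" using mobius_inj[OF \<alpha>(1)[OF n] \<alpha>(1)[OF i] \<alpha>(1)[OF j]] eq by (simp only: z_def)
    then show "i = j" by (rule inj_onD[OF \<alpha>(2) _ i j])
  qed
  moreover have "z ` {1..<n} \<subseteq> ball 0 1"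
    using mobius_in_disk[OF \<alpha>(1)[OF n] \<alpha>(1)] by (auto simp: z_def)
  moreover have "cinner (x n) (x i) * cinner (x i) (x j) * cinner (x j) (x n) =
            of_real ((1 - (cmod (z i))\<^sup>2) * (1 - (cmod (z j))\<^sup>2)) / (1 - cnj (z j) * z i)"
    if "1 \<le> i \<and> i \<le> j \<and> j < n" for i j
  proof -
    have i: "i \<in> {1..n}" and j: "j \<in> {1..n}" using that by auto
    \<comment> \<open>In the cyclic product every \<open>c\<close> meets its own conjugate, so the
      phases vanish and only the \<open>1 - \<alpha> i * cnj (\<alpha> i)\<close> remain.\<close>
    have "cinner (x n) (x i) * cinner (x i) (x j) * cinner (x j) (x n) =
      (c n * cnj (c n)) * (c i * cnj (c i)) * (c j * cnj (c j)) /
        ((1 - \<alpha> n * cnj (\<alpha> i)) * (1 - \<alpha> i * cnj (\<alpha> j)) * (1 - \<alpha> j * cnj (\<alpha> n)))"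
      unfolding G[OF n i] G[OF i j] G[OF j n] by (simp add: mult_ac)
    also have "\<dots> = of_real ((1 - (cmod (z i))\<^sup>2) * (1 - (cmod (z j))\<^sup>2)) / (1 - cnj (z j) * z i)"
      unfolding cc[OF n] cc[OF i] cc[OF j] z_def
      by (rule mobius_triple_identity[symmetric, OF \<alpha>(1)[OF i] \<alpha>(1)[OF j] \<alpha>(1)[OF n]])
    finally show ?thesis .
  qed
  ultimately show ?thesis by blast
qed

section \<open>Finite Blaschke products\<close>

lemma mobius_holomorphic: "cmod c < 1 \<Longrightarrow> mobius c holomorphic_on ball 0 1"
  unfolding mobius_def by (intro holomorphic_intros unit_disk_denom_nonzero) auto

lemma mobius_continuous: "cmod c < 1 \<Longrightarrow> continuous_on (cball 0 1) (mobius c)"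
  unfolding mobius_def by (intro continuous_intros ballI unit_disk_denom_nonzero) auto

lemma mobius_unimodular:
  assumes "cmod c < 1" "cmod \<zeta> = 1"
  shows "cmod (mobius c \<zeta>) = 1"
proof -
  have "\<zeta> * cnj \<zeta> = 1" using assms by (simp flip: complex_norm_square)
  then have "1 - cnj c * \<zeta> = \<zeta> * cnj (\<zeta> - c)" by (simp add: algebra_simps)
  then have "cmod (1 - cnj c * \<zeta>) = cmod (\<zeta> - c)" using assms by (metis complex_mod_cnj mult_1 norm_mult)
  moreover have "1 - cnj c * \<zeta> \<noteq> 0" using unit_disk_denom_nonzero[of c \<zeta>] assms by simp
  ultimately show ?thesis by (metis divide_self mobius_def norm_divide norm_eq_zero)
qed

lemma blaschke_inner:
  assumes "\<And>i. i \<in> I \<Longrightarrow> cmod (w i) < 1"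
  shows "inner_function (\<lambda>z. \<Prod>i\<in>I. mobius (w i) z)"
proof (rule inner_function_continuousI)
  show "(\<lambda>z. \<Prod>i\<in>I. mobius (w i) z) holomorphic_on ball 0 1"
    by (intro holomorphic_on_prod mobius_holomorphic assms)
  show "continuous_on (cball 0 1) (\<lambda>z. \<Prod>i\<in>I. mobius (w i) z)"
    by (intro continuous_on_prod mobius_continuous assms)
  show "cmod (\<Prod>i\<in>I. mobius (w i) \<zeta>) = 1" if "cmod \<zeta> = 1" for \<zeta>
    unfolding prod_norm[symmetric] by (intro prod.neutral ballI mobius_unimodular assms that)
qed

lemma cauchy_kernel_Hinf:
  assumes "cmod c < 1"
  shows "(\<lambda>z. 1 / (1 - cnj c * z)) \<in> Hinf"
  by (rule Hinf_continuousI; intro holomorphic_intros continuous_intros ballI unit_disk_denom_nonzero)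
    (use assms in auto)

lemma polynomial_prod_Hinf: "(\<lambda>z. \<Prod>i\<in>I. a i - b i * z) \<in> Hinf"
  by (rule Hinf_continuousI; intro holomorphic_intros continuous_intros holomorphic_on_prod continuous_on_prod)

lemma H2_factor_zeros:
  assumes "finite I" "inj_on w I" "\<And>i. i \<in> I \<Longrightarrow> cmod (w i) < 1" "\<And>i. i \<in> I \<Longrightarrow> f (w i) = 0" "f \<in> H2"
  shows "\<exists>q\<in>H2. \<forall>z. f z = (\<Prod>i\<in>I. z - w i) * q z"
  using assms
proof (induction I rule: finite_induct)
  case (insert j I)
  then obtain q where q: "q \<in> H2" "\<And>z. f z = (\<Prod>i\<in>I. z - w i) * q z" by (auto simp: inj_on_def)
  have "(\<Prod>i\<in>I. w j - w i) \<noteq> 0"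
    using insert.hyps insert.prems(1) by (auto simp: inj_on_def prod_zero_iff)
  then have "q (w j) = 0" using q(2)[of "w j"] insert.prems(3)[of j] by simp
  moreover have "cmod (w j) < 1" using insert.prems(2) by simp
  ultimately obtain g where g: "g \<in> H2" "\<And>z. q z = (z - w j) * g z"
    using H2_divide[OF q(1)] by metis
  then have "f z = (\<Prod>i\<in>insert j I. z - w i) * g z" for z
    using q(2)[of z] insert.hyps by (simp add: mult_ac)
  with g(1) show ?case by blast
qed auto

text \<open>On the disk this is the Blaschke product divided by \<open>z - w i\<close>, with the
  zero at \<open>w i\<close> already cancelled, so that its value there is available without a
  limit.\<close>

definition blaschke_kernel :: "(nat \<Rightarrow> complex) \<Rightarrow> nat set \<Rightarrow> nat \<Rightarrow> complex \<Rightarrow> complex" where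
  "blaschke_kernel w I i z = (\<Prod>j\<in>I - {i}. mobius (w j) z) * (1 / (1 - cnj (w i) * z) * disk_one z)"

text \<open>The Cauchy kernel equals 1 plus \<open>z\<close> times \<open>cnj c\<close> times
  itself, so it is an eigenvector of the adjoint shift with eigenvalue \<open>cnj c\<close>. It is
  therefore orthogonal to all multiples of \<open>z - c\<close>, and \<open>mobius c z * g z\<close>
  is one.\<close>

lemma cauchy_kernel_orth:
  assumes c: "cmod c < 1" and g: "g \<in> H2"
  shows "H2_inner (\<lambda>z. 1 / (1 - cnj c * z) * disk_one z) (\<lambda>z. mobius c z * g z) = 0"
proof -
  let ?k = "\<lambda>z. 1 / (1 - cnj c * z) * disk_one z"
  let ?h = "\<lambda>z. 1 / (1 - cnj c * z) * g z"
  have k: "?k \<in> H2" by (rule H2_mult_Hinf[OF cauchy_kernel_Hinf[OF c] disk_one_H2])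
  have h: "?h \<in> H2" by (rule H2_mult_Hinf[OF cauchy_kernel_Hinf[OF c] g])
  have eq: "?k z = 1 * disk_one z + z * (cnj c * ?k z)" for z
    using unit_disk_denom_nonzero[OF c, of z] by (auto simp: disk_one_def divide_simps)
  have "H2_inner ?k (\<lambda>z. z * ?h z) = cnj c * H2_inner ?k ?h"
    using H2_inner_backward_shift[OF H2_scale[OF k] h eq] H2_inner_scale_left[OF k h] by simp
  moreover have "(\<lambda>z. mobius c z * g z) = (\<lambda>z. 1 * (z * ?h z) + (- c) * ?h z)"
    by (simp add: mobius_def fun_eq_iff diff_divide_distrib left_diff_distrib)
  ultimately show ?thesis
    using H2_inner_lincomb_right[OF H2_shift[OF h] h k, of 1 "- c"] by simp
qed

section \<open>The model space of a finite Blaschke product with simple zeros\<close>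

context
  fixes w :: "nat \<Rightarrow> complex" and I :: "nat set"
  assumes fin: "finite I" and w: "\<And>i. i \<in> I \<Longrightarrow> cmod (w i) < 1" and inj: "inj_on w I"
begin

lemma blaschke_split: "i \<in> I \<Longrightarrow> (\<Prod>j\<in>I. mobius (w j) z) = (\<Prod>j\<in>I - {i}. mobius (w j) z) * mobius (w i) z"
  using fin by (simp add: prod.remove mult.commute)

lemma blaschke_kernel_H2: "i \<in> I \<Longrightarrow> blaschke_kernel w I i \<in> H2"
  unfolding blaschke_kernel_def using w
  by (intro H2_mult_Hinf inner_function_Hinf blaschke_inner cauchy_kernel_Hinf disk_one_H2) auto

text \<open>The factor 1 is kept to match the shape required by
  \<open>model_space_eigenvector_inner\<close>; both constants being 1, the Gram entries become
  \<open>1 / (1 - w i * cnj (w j))\<close>.\<close>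

lemma blaschke_kernel_shift:
  assumes i: "i \<in> I"
  shows "z * blaschke_kernel w I i z = w i * blaschke_kernel w I i z + 1 * ((\<Prod>j\<in>I. mobius (w j) z) * disk_one z)"
proof -
  have "(z - w i) * blaschke_kernel w I i z = (\<Prod>j\<in>I. mobius (w j) z) * disk_one z"
    unfolding blaschke_split[OF i] blaschke_kernel_def by (simp add: mobius_def)
  then show ?thesis by (simp add: left_diff_distrib diff_eq_eq add.commute)
qed

text \<open>The kernel and any multiple of the Blaschke product share the inner factor formed by the
  other zeros. Cancelling it isometrically leaves the case of a single zero.\<close>

lemma blaschke_kernel_model_space:
  assumes i: "i \<in> I"
  shows "blaschke_kernel w I i \<in> model_space (\<lambda>z. \<Prod>j\<in>I. mobius (w j) z)"
  unfolding model_space_def mem_Collect_eq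
proof (intro conjI ballI blaschke_kernel_H2[OF i])
  fix g assume g: "g \<in> H2"
  have inner: "inner_function (\<lambda>z. \<Prod>j\<in>I - {i}. mobius (w j) z)" by (rule blaschke_inner) (use w in auto)
  have m: "mobius (w i) \<in> Hinf" by (intro Hinf_continuousI mobius_holomorphic mobius_continuous w i)
  have k: "(\<lambda>z. 1 / (1 - cnj (w i) * z) * disk_one z) \<in> H2"
    by (rule H2_mult_Hinf[OF cauchy_kernel_Hinf[OF w[OF i]] disk_one_H2])
  have eq: "blaschke_kernel w I i = (\<lambda>z. (\<Prod>j\<in>I - {i}. mobius (w j) z) * (1 / (1 - cnj (w i) * z) * disk_one z))"
    by (simp add: blaschke_kernel_def fun_eq_iff)
  show "H2_inner (blaschke_kernel w I i) (\<lambda>z. (\<Prod>j\<in>I. mobius (w j) z) * g z) = 0"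
    unfolding blaschke_split[OF i] mult.assoc eq
      H2_inner_mult_inner[OF inner k H2_mult_Hinf[OF m g]]
    by (rule cauchy_kernel_orth[OF w[OF i] g])
qed

lemma blaschke_kernel_gram:
  assumes "i \<in> I" "j \<in> I"
  shows "H2_inner (blaschke_kernel w I i) (blaschke_kernel w I j) * (1 - w i * cnj (w j)) = 1"
  using model_space_eigenvector_inner[OF blaschke_inner[OF w] blaschke_kernel_model_space[OF assms(1)]
      blaschke_kernel_model_space[OF assms(2)] blaschke_kernel_shift[OF assms(1)] blaschke_kernel_shift[OF assms(2)]]
  by simp

lemma blaschke_kernel_zero:
  assumes "i \<in> I" "j \<in> I" "i \<noteq> j"
  shows "blaschke_kernel w I i (w j) = 0"
proof -
  have "(\<Prod>l\<in>I - {i}. mobius (w l) (w j)) = 0"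
    using fin assms by (intro prod_zero) (auto simp: mobius_def)
  then show ?thesis by (simp add: blaschke_kernel_def)
qed

lemma blaschke_kernel_nonzero:
  assumes i: "i \<in> I"
  shows "blaschke_kernel w I i (w i) \<noteq> 0"
proof -
  have nz: "1 - cnj (w j) * w i \<noteq> 0" if "j \<in> I" for j
    using unit_disk_denom_nonzero[OF w[OF that], of "w i"] w[OF i] by simp
  have "mobius (w j) (w i) \<noteq> 0" if "j \<in> I - {i}" for j
    using that nz[of j] inj_onD[OF inj, of i j] i by (auto simp: mobius_def)
  then have "(\<Prod>l\<in>I - {i}. mobius (w l) (w i)) \<noteq> 0" using fin by (simp add: prod_zero_iff)
  then show ?thesis using nz[OF i] w[OF i] by (simp add: blaschke_kernel_def disk_one_def)
qed

text \<open>The kernel with index \<open>i\<close> vanishes at all the other zeros, so a combination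
  of kernels interpolates \<open>f\<close> at the points \<open>w i\<close>. The remainder vanishes
  at all of them and is a multiple of the Blaschke product, yet lies in the model space, so it is
  orthogonal to itself.\<close>

lemma model_space_blaschke_span:
  assumes f: "f \<in> model_space (\<lambda>z. \<Prod>j\<in>I. mobius (w j) z)"
  obtains b where "f = (\<lambda>z. \<Sum>i\<in>I. b i * blaschke_kernel w I i z)"
proof -
  let ?\<Theta> = "\<lambda>z. \<Prod>j\<in>I. mobius (w j) z"
  have \<Theta>: "?\<Theta> \<in> Hinf" by (rule inner_function_Hinf[OF blaschke_inner[OF w]])
  define b where "b i = f (w i) / blaschke_kernel w I i (w i)" for i
  define r where "r z = f z - (\<Sum>i\<in>I. b i * blaschke_kernel w I i z)" for z
  have r: "r \<in> model_space ?\<Theta>" unfolding r_def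
    by (intro model_space_diff[OF \<Theta> f] model_space_sum[OF \<Theta> fin] blaschke_kernel_model_space)
  have "r (w j) = 0" if j: "j \<in> I" for j
  proof -
    have "(\<Sum>i\<in>I. b i * blaschke_kernel w I i (w j)) = (\<Sum>i\<in>I. if i = j then f (w j) else 0)"
      by (rule sum.cong[OF refl]) (use blaschke_kernel_zero[OF _ j] blaschke_kernel_nonzero[OF j] in \<open>auto simp: b_def\<close>)
    then show ?thesis using fin j by (simp add: r_def)
  qed
  then obtain q where q: "q \<in> H2" "\<And>z. r z = (\<Prod>i\<in>I. z - w i) * q z"
    using H2_factor_zeros[OF fin inj w _ model_space_H2[OF r]] by blast
  \<comment> \<open>The denominators of the Blaschke factors are moved into the cofactor, turning
    the polynomial factor of \<open>r\<close> into the Blaschke product.\<close>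
  define q' where "q' z = (\<Prod>i\<in>I. 1 - cnj (w i) * z) * q z" for z
  have q': "q' \<in> H2" unfolding q'_def by (rule H2_mult_Hinf[OF polynomial_prod_Hinf q(1)])
  have "r z = ?\<Theta> z * q' z" for z
  proof (cases "cmod z < 1")
    case True
    then have "(\<Prod>i\<in>I. 1 - cnj (w i) * z) \<noteq> 0"
      using fin unit_disk_denom_nonzero[OF w] by (auto simp: prod_zero_iff)
    then show ?thesis by (simp add: q(2) q'_def mobius_def prod_dividef)
  next
    case False
    then show ?thesis using H2_outside[OF model_space_H2[OF r]] H2_outside[OF q'] by simp
  qed
  then have "r = (\<lambda>z. ?\<Theta> z * q' z)" by auto
  then have "H2_inner r r = 0" using model_space_orth[OF r q'] by simp
  then have "r = (\<lambda>z. 0)" by (rule H2_inner_self(3)[OF model_space_H2[OF r]])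
  then have "f = (\<lambda>z. \<Sum>i\<in>I. b i * blaschke_kernel w I i z)" by (simp add: r_def fun_eq_iff)
  then show ?thesis by (rule that)
qed

lemma Hinf_interpolation:
  obtains \<phi> where "\<phi> \<in> Hinf" "\<And>i. i \<in> I \<Longrightarrow> \<phi> (w i) = (v i :: complex)"
proof -
  define L where "L i z = (\<Prod>j\<in>I - {i}. z - w j)" for i and z :: complex
  define \<phi> where "\<phi> z = (\<Sum>i\<in>I. v i / L i (w i) * L i z)" for z
  have "\<phi> \<in> Hinf" unfolding \<phi>_def L_def
    by (rule Hinf_continuousI)
      (intro holomorphic_intros holomorphic_on_sum holomorphic_on_prod,
       intro continuous_intros continuous_on_sum continuous_on_prod)
  moreover have "\<phi> (w j) = v j" if j: "j \<in> I" for j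
  proof -
    have "L j (w j) \<noteq> 0"
      unfolding L_def using fin inj_onD[OF inj] j by (auto simp: prod_zero_iff)
    moreover have "L i (w j) = 0" if "i \<noteq> j" for i
      unfolding L_def using fin j that by (intro prod_zero) auto
    ultimately have "\<phi> (w j) = (\<Sum>i\<in>I. if i = j then v j else 0)"
      unfolding \<phi>_def by (intro sum.cong) auto
    then show ?thesis using fin j by simp
  qed
  ultimately show ?thesis by (rule that)
qed

text \<open>Since \<open>\<phi> - \<phi> (w i)\<close> is divisible by \<open>z - w i\<close>, its
  product with the kernel is a multiple of the Blaschke product and disappears against the model
  space. The weak form is the one that \<open>model_proj_eqI\<close> consumes.\<close>

lemma interpolant_eigenfunction:
  assumes \<phi>: "\<phi> \<in> Hinf" and i: "i \<in> I" and k: "k \<in> model_space (\<lambda>z. \<Prod>j\<in>I. mobius (w j) z)"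
  shows "H2_inner (\<lambda>z. \<phi> z * blaschke_kernel w I i z) k = \<phi> (w i) * H2_inner (blaschke_kernel w I i) k"
proof -
  let ?\<Theta> = "\<lambda>z. \<Prod>j\<in>I. mobius (w j) z"
  let ?e = "blaschke_kernel w I i"
  have \<Theta>: "?\<Theta> \<in> Hinf" by (rule inner_function_Hinf[OF blaschke_inner[OF w]])
  have mem: "(\<lambda>z. \<phi> z * disk_one z - \<phi> (w i) * disk_one z) \<in> H2"
    by (intro H2_diff H2_scale H2_mult_Hinf \<phi> disk_one_H2)
  obtain h where h: "h \<in> H2" "\<And>z. \<phi> z * disk_one z - \<phi> (w i) * disk_one z = (z - w i) * h z"
    using H2_divide[OF mem w[OF i]] w[OF i] by (auto simp: disk_one_def)
  have "\<phi> z * ?e z = \<phi> (w i) * ?e z + 1 * (?\<Theta> z * h z)" for z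
  proof (cases "cmod z < 1")
    case True
    have "(\<phi> z - \<phi> (w i)) * ?e z = h z * ((z - w i) * ?e z)"
      using h(2)[of z] True by (simp add: disk_one_def)
    also have "(z - w i) * ?e z = ?\<Theta> z"
      using blaschke_kernel_shift[OF i, of z] True by (simp add: disk_one_def left_diff_distrib diff_eq_eq add.commute)
    finally have "(\<phi> z - \<phi> (w i)) * ?e z = ?\<Theta> z * h z" by (simp only: mult.commute)
    then show ?thesis by (simp only: left_diff_distrib diff_eq_eq add.commute mult_1_left)
  next
    case False
    then show ?thesis using H2_outside[OF h(1)] H2_outside[OF blaschke_kernel_H2[OF i]] by simp
  qed
  then show ?thesis
    using H2_inner_lincomb_left[OF blaschke_kernel_H2[OF i] H2_mult_Hinf[OF \<Theta> h(1)] model_space_H2[OF k], of "\<phi> (w i)" 1]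
      model_space_orth'[OF k h(1)] by simp
qed

end

section \<open>Sufficiency: the unitary map from a Gram matrix\<close>

lemma cinner_sum_sum:
  "cinner (\<Sum>i\<in>I. a i *s x i) (\<Sum>j\<in>J. b j *s y j) = (\<Sum>i\<in>I. \<Sum>j\<in>J. a i * cnj (b j) * cinner (x i) (y j))"
proof -
  have left: "cinner (\<Sum>i\<in>I. a i *s x i) v = (\<Sum>i\<in>I. a i * cinner (x i) v)" for v and a :: "_ \<Rightarrow> complex" and I x
    unfolding cinner_def by (simp add: sum_component sum_distrib_right sum_distrib_left mult.assoc)
      (rule sum.swap)
  have right: "cinner u (\<Sum>j\<in>J. b j *s y j) = (\<Sum>j\<in>J. cnj (b j) * cinner u (y j))" for u
    by (subst cinner_commute[symmetric]) (simp add: left cinner_commute)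
  have "cinner (\<Sum>i\<in>I. a i *s x i) (\<Sum>j\<in>J. b j *s y j) =
      (\<Sum>i\<in>I. a i * (\<Sum>j\<in>J. cnj (b j) * cinner (x i) (y j)))"
    by (subst left) (simp only: right)
  then show ?thesis by (simp add: sum_distrib_left mult.assoc)
qed

text \<open>The scaled kernels \<open>d i * k i\<close> have the same Gram matrix as the
  eigenvectors \<open>x i\<close>, so matching the two bases is unitary. The symbol is chosen to
  have the value \<open>ev i\<close> at \<open>w i\<close>, which makes the matched vectors
  eigenvectors for the same eigenvalue.\<close>

lemma gram_imp_unitarily_equiv:
  fixes M :: "complex ^ 'n ^ 'n" and x :: "nat \<Rightarrow> complex ^ 'n"
  assumes ev: "inj_on ev I" and M: "\<And>i. i \<in> I \<Longrightarrow> M *v x i = ev i *s x i" and nz: "\<And>i. i \<in> I \<Longrightarrow> x i \<noteq> 0"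
    and fin: "finite I" and card: "card I = CARD('n)"
    and w: "\<And>i. i \<in> I \<Longrightarrow> cmod (w i) < 1" and inj: "inj_on w I" and d: "\<And>i. i \<in> I \<Longrightarrow> d i \<noteq> 0"
    and gram: "\<And>i j. i \<in> I \<Longrightarrow> j \<in> I \<Longrightarrow> cinner (x i) (x j) * (1 - w i * cnj (w j)) = d i * cnj (d j)"
  shows "unitarily_equiv_analytic_TTO M"
proof -
  define \<Theta> where "\<Theta> = (\<lambda>z. \<Prod>i\<in>I. mobius (w i) z)"
  define k where "k = blaschke_kernel w I"
  have inner: "inner_function \<Theta>" unfolding \<Theta>_def by (rule blaschke_inner[OF w])
  note \<Theta> = inner_function_Hinf[OF inner]
  have kK: "k i \<in> model_space \<Theta>" if "i \<in> I" for i
    unfolding k_def \<Theta>_def by (rule blaschke_kernel_model_space[OF fin w inj that])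
  note kH = model_space_H2[OF kK]
  have k_gram: "d i * cnj (d j) * H2_inner (k i) (k j) = cinner (x i) (x j)" if "i \<in> I" "j \<in> I" for i j
  proof -
    have k1: "H2_inner (k i) (k j) * (1 - w i * cnj (w j)) = 1"
      unfolding k_def by (rule blaschke_kernel_gram[OF fin w inj that])
    have "d i * cnj (d j) * H2_inner (k i) (k j) =
        cinner (x i) (x j) * (H2_inner (k i) (k j) * (1 - w i * cnj (w j)))"
      unfolding gram[OF that, symmetric] by (simp only: mult.assoc mult.commute mult.left_commute)
    then show ?thesis by (simp only: k1 mult_1_right)
  qed
  obtain \<phi> where \<phi>: "\<phi> \<in> Hinf" and \<phi>w: "\<And>i. i \<in> I \<Longrightarrow> \<phi> (w i) = ev i"
    by (rule Hinf_interpolation[OF fin w inj]) (assumption | rule that)+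
  obtain a :: "complex ^ 'n \<Rightarrow> nat \<Rightarrow> complex" where a: "\<And>v. v = (\<Sum>i\<in>I. a v i *s x i)"
    and a_lin: "\<And>b c u v. a (b *s u + c *s v) = (\<lambda>i. b * a u i + c * a v i)"
    and a_sum: "\<And>b i. i \<in> I \<Longrightarrow> a (\<Sum>j\<in>I. b j *s x j) i = b i"
    by (rule eigenvectors_span[OF ev M nz fin card]) (assumption | rule that)+
  define U where "U v = (\<lambda>z. \<Sum>i\<in>I. (a v i * d i) * k i z)" for v
  have UK: "U v \<in> model_space \<Theta>" for v
    unfolding U_def by (rule model_space_sum[OF \<Theta> fin kK])
  have U_lin: "U (b *s u + c *s v) = (\<lambda>z. b * U u z + c * U v z)" for b c u v
    unfolding U_def a_lin by (simp add: algebra_simps sum.distrib sum_distrib_left)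
  have U_inner: "H2_inner (U u) (U v) = cinner u v" for u v
  proof -
    have "H2_inner (U u) (U v) = (\<Sum>i\<in>I. (a u i * d i) * (\<Sum>j\<in>I. cnj (a v j * d j) * H2_inner (k i) (k j)))"
      unfolding U_def
      by (subst H2_inner_sum_left[OF _ fin kH])
        (auto intro!: H2_sum fin kH sum.cong simp: H2_inner_sum_right[OF kH fin kH])
    also have "\<dots> = (\<Sum>i\<in>I. \<Sum>j\<in>I. a u i * cnj (a v j) * (d i * cnj (d j) * H2_inner (k i) (k j)))"
      by (simp add: sum_distrib_left mult_ac)
    also have "\<dots> = (\<Sum>i\<in>I. \<Sum>j\<in>I. a u i * cnj (a v j) * cinner (x i) (x j))"
      by (intro sum.cong refl) (simp only: k_gram)
    also have "\<dots> = cinner (\<Sum>i\<in>I. a u i *s x i) (\<Sum>j\<in>I. a v j *s x j)"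
      by (rule cinner_sum_sum[symmetric])
    also have "\<dots> = cinner u v" unfolding a[symmetric] ..
    finally show ?thesis .
  qed
  have "bij_betw U UNIV (model_space \<Theta>)"
    unfolding bij_betw_def
  proof
    show "inj U"
    proof (rule injI)
      fix u v assume "U u = U v"
      then have "U (1 *s u + (- 1) *s v) = (\<lambda>z. 0)" unfolding U_lin by simp
      then have "cinner (1 *s u + (- 1) *s v) (1 *s u + (- 1) *s v) = 0"
        using U_inner[of "1 *s u + (- 1) *s v" "1 *s u + (- 1) *s v"] H2_inner_zero_left[OF H2_zero] by simp
      then show "u = v" by (simp add: cinner_self)
    qed
    show "range U = model_space \<Theta>"
    proof (intro equalityI subsetI)
      fix f assume f: "f \<in> model_space \<Theta>"
      obtain b where b: "f = (\<lambda>z. \<Sum>i\<in>I. b i * blaschke_kernel w I i z)"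
        by (rule model_space_blaschke_span[OF fin w inj f[unfolded \<Theta>_def]]) (assumption | rule that)+
      have "U (\<Sum>i\<in>I. (b i / d i) *s x i) = f"
        unfolding U_def b k_def by (intro ext sum.cong refl) (simp add: a_sum d)
      then show "f \<in> range U" by blast
    qed (use UK in auto)
  qed
  then have unitary: "unitary_onto_model \<Theta> U"
    using U_lin U_inner by (simp add: unitary_onto_model_def)
  have "U (M *v v) = TTO \<Theta> \<phi> (U v)" for v
    unfolding TTO_def
  proof (rule model_proj_eqI[symmetric, OF \<Theta> H2_mult_Hinf[OF \<phi> model_space_H2[OF UK]] UK])
    fix g assume g: "g \<in> model_space \<Theta>"
    note gH = model_space_H2[OF g]
    have "M *v v = (\<Sum>i\<in>I. (a v i * ev i) *s x i)"
      by (subst a[of v]) (simp add: matrix_vector_mult_sum_scaled M vector_smult_assoc)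
    then have aM: "a (M *v v) i = a v i * ev i" if "i \<in> I" for i using a_sum[OF that] by simp
    have "(\<lambda>z. \<phi> z * U v z) = (\<lambda>z. \<Sum>i\<in>I. (a v i * d i) * (\<phi> z * k i z))"
      unfolding U_def by (simp add: sum_distrib_left mult_ac)
    then have "H2_inner (\<lambda>z. \<phi> z * U v z) g = (\<Sum>i\<in>I. (a v i * d i) * H2_inner (\<lambda>z. \<phi> z * k i z) g)"
      using H2_inner_sum_left[OF gH fin H2_mult_Hinf[OF \<phi> kH], of "\<lambda>i. i" "\<lambda>i. a v i * d i"] by simp
    also have "\<dots> = (\<Sum>i\<in>I. (a (M *v v) i * d i) * H2_inner (k i) g)"
    proof (rule sum.cong[OF refl])
      fix i assume i: "i \<in> I"
      have "H2_inner (\<lambda>z. \<phi> z * k i z) g = ev i * H2_inner (k i) g"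
        unfolding k_def \<phi>w[OF i, symmetric]
        by (rule interpolant_eigenfunction[OF fin w inj \<phi> i g[unfolded \<Theta>_def]])
      then show "(a v i * d i) * H2_inner (\<lambda>z. \<phi> z * k i z) g = (a (M *v v) i * d i) * H2_inner (k i) g"
        by (simp add: aM[OF i])
    qed
    also have "\<dots> = H2_inner (U (M *v v)) g"
      unfolding U_def by (rule H2_inner_sum_left[symmetric, OF gH fin kH])
    finally show "H2_inner (\<lambda>z. \<phi> z * U v z) g = H2_inner (U (M *v v)) g" .
  qed
  moreover have "\<not> \<Theta> constant_on ball 0 1"
  proof
    assume "\<Theta> constant_on ball 0 1"
    then obtain c where c: "\<And>z. cmod z < 1 \<Longrightarrow> \<Theta> z = c" by (auto simp: constant_on_def)
    obtain i where i: "i \<in> I" using card by fastforce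
    have "\<Theta> (w i) = 0" unfolding \<Theta>_def using fin i by (intro prod_zero) (auto simp: mobius_def)
    then have "c = 0" using c[OF w[OF i]] by simp
    \<comment> \<open>A constant with a zero is 0, contradicting that multiplication by an inner
      function preserves the norm of 1.\<close>
    then have "(\<lambda>z. \<Theta> z * disk_one z) = (\<lambda>z. 0)" using c by (auto simp: disk_one_def)
    then have "H2_inner disk_one disk_one = 0"
      using H2_inner_mult_inner[OF inner disk_one_H2 disk_one_H2] H2_inner_zero_left[OF H2_zero] by simp
    then show False using H2_inner_one[OF disk_one_H2] by (simp add: disk_one_def)
  qed
  ultimately show ?thesis
    unfolding unitarily_equiv_analytic_TTO_def unitarily_equiv_TTO_def
    using inner \<phi> unitary by blast
qed

lemma triple_identity_imp_unitarily_equiv: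
  fixes M :: "complex ^ 'n ^ 'n" and x :: "nat \<Rightarrow> complex ^ 'n"
  assumes n_def: "n = CARD('n)" and inj: "inj_on ev {1..n}"
    and M: "\<And>i. i \<in> {1..n} \<Longrightarrow> M *v x i = ev i *s x i"
    and unit: "\<And>i. i \<in> {1..n} \<Longrightarrow> norm (x i) = 1"
    and z_inj: "inj_on z {1..<n}" and z: "z ` {1..<n} \<subseteq> ball 0 1"
    and id: "\<And>i j. 1 \<le> i \<and> i \<le> j \<and> j < n \<Longrightarrow>
          cinner (x n) (x i) * cinner (x i) (x j) * cinner (x j) (x n) =
            of_real ((1 - (cmod (z i))\<^sup>2) * (1 - (cmod (z j))\<^sup>2)) / (1 - cnj (z j) * z i)"
  shows "unitarily_equiv_analytic_TTO M"
proof -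
  have n: "n \<in> {1..n}" using n_def by (simp add: Suc_leI)
  have self: "cinner (x i) (x i) = 1" if "i \<in> {1..n}" for i using unit[OF that] by (simp add: cinner_self)
  \<comment> \<open>With the last point at 0, the Gram relation for \<open>j = n\<close> reads
    \<open>cinner (x i) (x n) = d i * cnj (d n)\<close>. Taking \<open>d n = 1\<close> leaves this
    choice of \<open>d\<close>.\<close>
  define w where "w i = (if i = n then 0 else z i)" for i
  define d where "d i = cinner (x i) (x n)" for i
  have z1: "cmod (z i) < 1" if "1 \<le> i" "i < n" for i
    using subsetD[OF z imageI[of i "{1..<n}" z]] that by simp
  have w1: "cmod (w i) < 1" if "i \<in> {1..n}" for i using z1[of i] that by (auto simp: w_def)
  have dn: "d n = 1" using self[OF n] by (simp add: d_def)
  have d_cnj: "cinner (x n) (x i) = cnj (d i)" for i by (simp add: d_def cinner_commute)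
  have dd: "d i * cnj (d i) = of_real (1 - (cmod (w i))\<^sup>2)" if "i \<in> {1..n}" for i
  proof (cases "i = n")
    case False
    then have i: "1 \<le> i" "i < n" using that by auto
    let ?r = "complex_of_real (1 - (cmod (z i))\<^sup>2)"
    have r: "?r \<noteq> 0" using z1[OF i] norm_ge_zero[of "z i"] unfolding of_real_eq_0_iff
      by (simp add: power2_eq_1_iff del: norm_ge_zero)
    \<comment> \<open>The diagonal case of the identity: the middle inner product is 1, and the
      denominator equals one of the two factors above it.\<close>
    have "cnj (d i) * d i = ?r * ?r / ?r"
      using id[of i i] i self[OF that] unfolding d_cnj d_def[symmetric] one_minus_norm_square[of "z i", symmetric]
        mult.commute[of "cnj (z i)"] of_real_mult by (simp only: mult_1_right order_refl simp_thms)
    then show ?thesis using r False by (simp add: w_def mult.commute)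
  qed (simp add: dn w_def)
  have w_lt: "(cmod (w i))\<^sup>2 < 1" if "i \<in> {1..n}" for i
    using w1[OF that] by (simp add: abs_square_less_1)
  have d_nz: "d i \<noteq> 0" if "i \<in> {1..n}" for i
  proof
    assume "d i = 0"
    then have "complex_of_real (1 - (cmod (w i))\<^sup>2) = 0" using dd[OF that] by simp
    then have "1 - (cmod (w i))\<^sup>2 = 0" by (simp only: of_real_eq_0_iff)
    then show False using w_lt[OF that] by simp
  qed
  \<comment> \<open>Multiplying by \<open>cnj (d i) * d j\<close> completes the entry to a triple
    product, whose value is prescribed; the factor is nonzero and can be cancelled. The identity is
    given for \<open>i \<le> j\<close> only, and Hermitian symmetry supplies the rest.\<close>
  have gram_le: "cinner (x i) (x j) * (1 - w i * cnj (w j)) = d i * cnj (d j)"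
    if ij: "i \<in> {1..n}" "j \<in> {1..n}" "i \<le> j" for i j
  proof (cases "j = n")
    case True
    then show ?thesis by (simp add: w_def d_def self[OF n])
  next
    case False
    then have lt: "1 \<le> i \<and> i \<le> j \<and> j < n" using ij by auto
    have wz: "w i = z i" "w j = z j" using lt by (auto simp: w_def)
    have nz: "1 - w i * cnj (w j) \<noteq> 0"
      using unit_disk_denom_nonzero[of "w j" "w i"] w1[OF ij(1)] w1[OF ij(2)] by (simp add: mult.commute)
    have "cnj (d i) * cinner (x i) (x j) * d j = (d i * cnj (d i)) * (d j * cnj (d j)) / (1 - w i * cnj (w j))"
      using id[OF lt] unfolding d_cnj d_def[symmetric] of_real_mult dd[OF ij(1)] dd[OF ij(2)] wz
      by (simp only: mult.commute[of "cnj (z j)"])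
    then have "(cnj (d i) * d j) * (cinner (x i) (x j) * (1 - w i * cnj (w j))) = (cnj (d i) * d j) * (d i * cnj (d j))"
      using nz by (simp add: eq_divide_eq mult_ac)
    then show ?thesis using d_nz[OF ij(1)] d_nz[OF ij(2)] by (simp only: mult_cancel_left) simp
  qed
  have gram: "cinner (x i) (x j) * (1 - w i * cnj (w j)) = d i * cnj (d j)"
    if ij: "i \<in> {1..n}" "j \<in> {1..n}" for i j
  proof (cases "i \<le> j")
    case False
    then have "cnj (cinner (x j) (x i) * (1 - w j * cnj (w i))) = cnj (d j * cnj (d i))"
      using gram_le[OF ij(2,1)] by simp
    then show ?thesis by (simp add: cinner_commute mult.commute)
  qed (use gram_le[OF ij] in simp)
  \<comment> \<open>Injectivity of \<open>z\<close> does not separate its values from the added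
    point \<open>w n = 0\<close>. A zero among them would make \<open>cinner (x i) (x n)\<close>
    unimodular.\<close>
  have z_nz: "z i \<noteq> 0" if "1 \<le> i" "i < n" for i
  proof
    assume z0: "z i = 0"
    have i: "i \<in> {1..n}" using that by simp
    have "d i * cnj (d i) = 1" using dd[OF i] z0 that by (simp add: w_def)
    then have "(cmod (d i))\<^sup>2 = 1" by (simp only: complex_norm_square[symmetric] of_real_eq_1_iff)
    then have "cmod (d i) = 1" using norm_ge_zero[of "d i"] unfolding power2_eq_1_iff by linarith
    moreover have "ev i \<noteq> ev n" using inj_onD[OF inj _ i n] that by auto
    ultimately show False
      using eigenvectors_cmod_cinner_ne_1[OF M[OF i] M[OF n] _ unit[OF i] unit[OF n]] by (simp add: d_def)
  qed
  have "inj_on w {1..n}"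
  proof (rule inj_onI)
    fix i j assume ij: "i \<in> {1..n}" "j \<in> {1..n}" and eq: "w i = w j"
    show "i = j"
    proof (cases "i = n \<or> j = n")
      case True
      then show ?thesis using eq ij z_nz[of i] z_nz[of j] by (auto simp: w_def split: if_splits)
    next
      case False
      then show ?thesis using eq ij inj_onD[OF z_inj, of i j] by (auto simp: w_def)
    qed
  qed
  moreover have "x i \<noteq> 0" if "i \<in> {1..n}" for i using unit[OF that] by auto
  ultimately show ?thesis
    by (intro gram_imp_unitarily_equiv[OF inj M _ _ _ w1 _ d_nz gram]) (auto simp: n_def)
qed

theorem theorem1p1:
  fixes M :: "complex ^ 'n ^ 'n"
    and ev :: "nat \<Rightarrow> complex"
    and x :: "nat \<Rightarrow> complex ^ 'n"
    and n :: nat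
  assumes n_def: "n = CARD('n)"
    and distinct: "inj_on ev {1..n}"
    and eigen: "\<And>i. i \<in> {1..n} \<Longrightarrow> M *v x i = ev i *s x i"
    and unit: "\<And>i. i \<in> {1..n} \<Longrightarrow> norm (x i) = 1"
  shows "unitarily_equiv_analytic_TTO M \<longleftrightarrow>
    (\<exists>z :: nat \<Rightarrow> complex. inj_on z {1..<n} \<and> z ` {1..<n} \<subseteq> ball 0 1 \<and>
       (\<forall>i j. 1 \<le> i \<and> i \<le> j \<and> j < n \<longrightarrow>
          cinner (x n) (x i) * cinner (x i) (x j) * cinner (x j) (x n) =
            of_real ((1 - (cmod (z i))\<^sup>2) * (1 - (cmod (z j))\<^sup>2)) / (1 - cnj (z j) * z i)))"
proof (rule iffI, goal_cases)
  case 1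
  with n_def distinct eigen unit show ?case by (rule unitarily_equiv_imp_triple_identity)
next
  case 2
  then obtain z :: "nat \<Rightarrow> complex" where z: "inj_on z {1..<n}" "z ` {1..<n} \<subseteq> ball 0 1"
    "\<And>i j. 1 \<le> i \<and> i \<le> j \<and> j < n \<Longrightarrow>
          cinner (x n) (x i) * cinner (x i) (x j) * cinner (x j) (x n) =
            of_real ((1 - (cmod (z i))\<^sup>2) * (1 - (cmod (z j))\<^sup>2)) / (1 - cnj (z j) * z i)"
    by blast
  show ?case
    by (rule triple_identity_imp_unitarily_equiv[OF n_def distinct eigen unit z])
qed

end
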